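(* Let $M=G/H$ be a commutative homogeneous space of a compact Lie group $G$ and let $A$ be an invariant function algebra on $M$. Then $A$ is self-conjugate with respect to complex conjugation (i.e. $f\in A$ implies $\overline f\in A$) if and only if $A$ contains no proper $G$-invariant ideal, i.e. no $G$-invariant ideal $I$ with $I\neq 0$ and $I\neq A$, where two invariant ideals are considered in the following sense: whenever $A$ is an invariant function algebra, an ideal is invariant if it is mapped into itself by all translations $f(x)\mapsto f(g^{-1}x)$, $g\in G$.
   Context: $G$ need not be connected. A homogeneous space $M=G/H$ of a compact Lie group $G$ ($H$ closed) is called commutative if it is multiplicity free, i.e. the quasiregular representation $f(x)\mapsto f(g^{-1}x)$ of $G$ in $C(M)$ contains every irreducible representation of $G$ with multiplicity $0$ or $1$ (equivalently, $(G,H)$ is a Gelfand pair). $C(M)$ is the Banach algebra of continuous complex-valued functions with the sup-norm. An invariant function algebra on $M$ is a closed $G$-invariant subalgebra of $C(M)$ containing the constants. *)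

theory Defs
  imports
    "HOL-Analysis.Analysis"
    "HOL-Algebra.Algebra"
    "HOL-Library.Extended_Nat"
    "Jordan_Normal_Form.Matrix"
begin

section \<open>Compact Lie groups\<close>

text \<open>
  Manifolds are modelled on \<open>Euclidean_space n\<close>, i.e. \<open>\<real>\<^sup>n\<close> realised as the sequences
  vanishing from index \<open>n\<close> on. This keeps the dimension a natural number and, unlike the
  \<open>euclidean_space\<close> type class, includes dimension \<open>0\<close>, so that finite groups are Lie groups.
\<close>

definition partial_deriv :: "nat \<Rightarrow> ((nat \<Rightarrow> real) \<Rightarrow> real) \<Rightarrow> (nat \<Rightarrow> real) \<Rightarrow> real" where
  "partial_deriv i f x = deriv (\<lambda>t. f (x(i := t))) (x i)"

text \<open>\<open>Ck_on n k S f\<close>: \<open>f\<close> is of class \<open>C\<^sup>k\<close> on the set \<open>S\<close>, which is meant to be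
  open in \<open>\<real>\<^sup>n\<close>.\<close>

primrec Ck_on ::
  "nat \<Rightarrow> nat \<Rightarrow> (nat \<Rightarrow> real) set \<Rightarrow> ((nat \<Rightarrow> real) \<Rightarrow> real) \<Rightarrow> bool" where
  "Ck_on n 0 S f \<longleftrightarrow> continuous_map (subtopology (Euclidean_space n) S) euclideanreal f"
| "Ck_on n (Suc k) S f \<longleftrightarrow>
     continuous_map (subtopology (Euclidean_space n) S) euclideanreal f \<and>
     (\<forall>i<n. (\<forall>x\<in>S. (\<lambda>t. f (x(i := t))) field_differentiable at (x i)) \<and>
            Ck_on n k S (partial_deriv i f))"

definition smooth_map_on ::
  "nat \<Rightarrow> nat \<Rightarrow> (nat \<Rightarrow> real) set \<Rightarrow> ((nat \<Rightarrow> real) \<Rightarrow> (nat \<Rightarrow> real)) \<Rightarrow> bool" where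
  "smooth_map_on n m S F \<longleftrightarrow> (\<forall>j<m. \<forall>k. Ck_on n k S (\<lambda>x. F x j))"

type_synonym 'g chart = "'g set \<times> ('g \<Rightarrow> nat \<Rightarrow> real)"

definition is_chart :: "'g topology \<Rightarrow> nat \<Rightarrow> 'g chart \<Rightarrow> bool" where
  "is_chart T n c \<longleftrightarrow> (case c of (U, \<phi>) \<Rightarrow>
     openin T U \<and> openin (Euclidean_space n) (\<phi> ` U) \<and>
     homeomorphic_map (subtopology T U) (subtopology (Euclidean_space n) (\<phi> ` U)) \<phi>)"

definition smooth_atlas :: "'g topology \<Rightarrow> nat \<Rightarrow> 'g chart set \<Rightarrow> bool" where
  "smooth_atlas T n \<A> \<longleftrightarrow>
     (\<forall>c\<in>\<A>. is_chart T n c) \<and> (\<Union>(fst ` \<A>)) = topspace T \<and>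
     (\<forall>(U, \<phi>)\<in>\<A>. \<forall>(V, \<psi>)\<in>\<A>.
        smooth_map_on n n (\<phi> ` (U \<inter> V)) (\<lambda>x. \<psi> (inv_into U \<phi> x)))"

definition topological_group :: "('g, 'm) monoid_scheme \<Rightarrow> 'g topology \<Rightarrow> bool" where
  "topological_group G T \<longleftrightarrow>
     Group.group G \<and> topspace T = carrier G \<and>
     continuous_map (prod_topology T T) T (\<lambda>(g, h). g \<otimes>\<^bsub>G\<^esub> h) \<and>
     continuous_map T T (\<lambda>g. inv\<^bsub>G\<^esub> g)"

text \<open>The two halves of a point of \<open>\<real>\<^sup>n\<^sup>+\<^sup>n = \<real>\<^sup>n \<times> \<real>\<^sup>n\<close>.\<close>

definition fst_coords :: "nat \<Rightarrow> (nat \<Rightarrow> real) \<Rightarrow> nat \<Rightarrow> real" where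
  "fst_coords n z = (\<lambda>i. if i < n then z i else 0)"

definition snd_coords :: "nat \<Rightarrow> (nat \<Rightarrow> real) \<Rightarrow> nat \<Rightarrow> real" where
  "snd_coords n z = (\<lambda>i. if i < n then z (n + i) else 0)"

definition smooth_group_mult ::
  "('g, 'm) monoid_scheme \<Rightarrow> nat \<Rightarrow> 'g chart set \<Rightarrow> bool" where
  "smooth_group_mult G n \<A> \<longleftrightarrow>
     (\<forall>(U, \<phi>)\<in>\<A>. \<forall>(V, \<psi>)\<in>\<A>. \<forall>(W, \<theta>)\<in>\<A>.
        let m = (\<lambda>z. inv_into U \<phi> (fst_coords n z) \<otimes>\<^bsub>G\<^esub> inv_into V \<psi> (snd_coords n z))
        in smooth_map_on (n + n) n
             {z \<in> topspace (Euclidean_space (n + n)).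
                fst_coords n z \<in> \<phi> ` U \<and> snd_coords n z \<in> \<psi> ` V \<and> m z \<in> W}
             (\<lambda>z. \<theta> (m z)))"

definition smooth_group_inv ::
  "('g, 'm) monoid_scheme \<Rightarrow> nat \<Rightarrow> 'g chart set \<Rightarrow> bool" where
  "smooth_group_inv G n \<A> \<longleftrightarrow>
     (\<forall>(U, \<phi>)\<in>\<A>. \<forall>(V, \<psi>)\<in>\<A>.
        smooth_map_on n n {x \<in> \<phi> ` U. inv\<^bsub>G\<^esub> (inv_into U \<phi> x) \<in> V}
          (\<lambda>x. \<psi> (inv\<^bsub>G\<^esub> (inv_into U \<phi> x))))"

definition lie_group ::
  "('g, 'm) monoid_scheme \<Rightarrow> 'g topology \<Rightarrow> nat \<Rightarrow> 'g chart set \<Rightarrow> bool" where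
  "lie_group G T n \<A> \<longleftrightarrow>
     topological_group G T \<and> Hausdorff_space T \<and> second_countable T \<and>
     smooth_atlas T n \<A> \<and> smooth_group_mult G n \<A> \<and> smooth_group_inv G n \<A>"

definition compact_lie_group ::
  "('g, 'm) monoid_scheme \<Rightarrow> 'g topology \<Rightarrow> nat \<Rightarrow> 'g chart set \<Rightarrow> bool" where
  "compact_lie_group G T n \<A> \<longleftrightarrow> lie_group G T n \<A> \<and> compact_space T"


section \<open>The homogeneous space \<open>G/H\<close> and its continuous functions\<close>

text \<open>The quotient topology on the set of left cosets.\<close>

definition coset_topology ::
  "('g, 'm) monoid_scheme \<Rightarrow> 'g topology \<Rightarrow> 'g set \<Rightarrow> 'g set topology" where
  "coset_topology G T H =
     topology (\<lambda>\<U>. \<U> \<subseteq> lcosets\<^bsub>G\<^esub> H \<and> openin T {g \<in> topspace T. g <#\<^bsub>G\<^esub> H \<in> \<U>})"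

lemma openin_coset_topology:
  "openin (coset_topology G T H) \<U> \<longleftrightarrow>
     \<U> \<subseteq> lcosets\<^bsub>G\<^esub> H \<and> openin T {g \<in> topspace T. g <#\<^bsub>G\<^esub> H \<in> \<U>}"
proof -
  have Int: "{g \<in> topspace T. g <#\<^bsub>G\<^esub> H \<in> S \<inter> S'} =
      {g \<in> topspace T. g <#\<^bsub>G\<^esub> H \<in> S} \<inter> {g \<in> topspace T. g <#\<^bsub>G\<^esub> H \<in> S'}" for S S'
    by blast
  have Un: "{g \<in> topspace T. g <#\<^bsub>G\<^esub> H \<in> \<Union>K} =
      (\<Union>S\<in>K. {g \<in> topspace T. g <#\<^bsub>G\<^esub> H \<in> S})" for K
    by blast
  have "istopology (\<lambda>\<U>. \<U> \<subseteq> lcosets\<^bsub>G\<^esub> H \<and> openin T {g \<in> topspace T. g <#\<^bsub>G\<^esub> H \<in> \<U>})"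
    unfolding istopology_def Int Un by blast
  then show ?thesis
    by (simp add: coset_topology_def topology_inverse')
qed

text \<open>\<open>C(M)\<close> for \<open>M = G/H\<close> with the sup-metric. Its elements are extensional, i.e. equal to
  \<open>undefined\<close> outside \<open>M\<close>, so pointwise operations are restricted to \<open>M\<close>.\<close>

abbreviation CM_metric ::
  "('g, 'm) monoid_scheme \<Rightarrow> 'g topology \<Rightarrow> 'g set \<Rightarrow> ('g set \<Rightarrow> complex) metric" where
  "CM_metric G T H \<equiv> cfunspace (coset_topology G T H) euclidean_metric"

definition translate ::
  "('g, 'm) monoid_scheme \<Rightarrow> 'g set \<Rightarrow> 'g \<Rightarrow> ('g set \<Rightarrow> complex) \<Rightarrow> 'g set \<Rightarrow> complex" where
  "translate G H g f = (\<lambda>x \<in> lcosets\<^bsub>G\<^esub> H. f (inv\<^bsub>G\<^esub> g <#\<^bsub>G\<^esub> x))"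


section \<open>Multiplicities in the quasiregular representation\<close>

definition continuous_rep ::
  "('g, 'm) monoid_scheme \<Rightarrow> 'g topology \<Rightarrow> nat \<Rightarrow> ('g \<Rightarrow> complex mat) \<Rightarrow> bool" where
  "continuous_rep G T d \<rho> \<longleftrightarrow>
     \<rho> \<in> hom G (units_of (ring_mat TYPE(complex) d ())) \<and>
     (\<forall>i<d. \<forall>j<d. continuous_map T euclidean (\<lambda>g. \<rho> g $$ (i, j)))"

definition invariant_subspace ::
  "('g, 'm) monoid_scheme \<Rightarrow> nat \<Rightarrow> ('g \<Rightarrow> complex mat) \<Rightarrow> complex vec set \<Rightarrow> bool" where
  "invariant_subspace G d \<rho> W \<longleftrightarrow>
     W \<subseteq> carrier_vec d \<and> 0\<^sub>v d \<in> W \<and>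
     (\<forall>v\<in>W. \<forall>w\<in>W. v + w \<in> W) \<and> (\<forall>c. \<forall>v\<in>W. c \<cdot>\<^sub>v v \<in> W) \<and>
     (\<forall>g\<in>carrier G. \<forall>v\<in>W. \<rho> g *\<^sub>v v \<in> W)"

text \<open>Irreducible representations of a compact group are finite-dimensional, so it suffices
  to consider the representation spaces \<open>\<complex>\<^sup>d\<close>.\<close>

definition irreducible_rep ::
  "('g, 'm) monoid_scheme \<Rightarrow> 'g topology \<Rightarrow> nat \<Rightarrow> ('g \<Rightarrow> complex mat) \<Rightarrow> bool" where
  "irreducible_rep G T d \<rho> \<longleftrightarrow>
     continuous_rep G T d \<rho> \<and> d > 0 \<and>
     (\<forall>W. invariant_subspace G d \<rho> W \<longrightarrow> W = {0\<^sub>v d} \<or> W = carrier_vec d)"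

definition intertwiners ::
  "('g, 'm) monoid_scheme \<Rightarrow> 'g topology \<Rightarrow> 'g set \<Rightarrow> nat \<Rightarrow> ('g \<Rightarrow> complex mat)
     \<Rightarrow> (complex vec \<Rightarrow> 'g set \<Rightarrow> complex) set" where
  "intertwiners G T H d \<rho> = {\<Phi>.
     (\<forall>v\<in>carrier_vec d. \<Phi> v \<in> mspace (CM_metric G T H)) \<and>
     (\<forall>v\<in>carrier_vec d. \<forall>w\<in>carrier_vec d.
        \<Phi> (v + w) = (\<lambda>x \<in> lcosets\<^bsub>G\<^esub> H. \<Phi> v x + \<Phi> w x)) \<and>
     (\<forall>c. \<forall>v\<in>carrier_vec d. \<Phi> (c \<cdot>\<^sub>v v) = (\<lambda>x \<in> lcosets\<^bsub>G\<^esub> H. c * \<Phi> v x)) \<and>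
     (\<forall>g\<in>carrier G. \<forall>v\<in>carrier_vec d. \<Phi> (\<rho> g *\<^sub>v v) = translate G H g (\<Phi> v))}"

text \<open>The multiplicity of \<open>\<rho>\<close> in \<open>C(M)\<close> is the dimension of the space of intertwiners: the
  largest length of a linearly independent family, or \<open>\<infinity>\<close>.\<close>

definition multiplicity_in_CM ::
  "('g, 'm) monoid_scheme \<Rightarrow> 'g topology \<Rightarrow> 'g set \<Rightarrow> nat \<Rightarrow> ('g \<Rightarrow> complex mat) \<Rightarrow> enat" where
  "multiplicity_in_CM G T H d \<rho> = Sup {enat k | k.
     \<exists>\<Phi>. (\<forall>i<k. \<Phi> i \<in> intertwiners G T H d \<rho>) \<and>
         (\<forall>c. (\<forall>v\<in>carrier_vec d. \<forall>x\<in>lcosets\<^bsub>G\<^esub> H. (\<Sum>i<k. c i * \<Phi> i v x) = 0)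
               \<longrightarrow> (\<forall>i<k. c i = 0))}"

definition commutative_homogeneous_space ::
  "('g, 'm) monoid_scheme \<Rightarrow> 'g topology \<Rightarrow> 'g set \<Rightarrow> bool" where
  "commutative_homogeneous_space G T H \<longleftrightarrow>
     (\<forall>d \<rho>. irreducible_rep G T d \<rho> \<longrightarrow> multiplicity_in_CM G T H d \<rho> \<in> {0, 1})"


section \<open>Invariant function algebras and their ideals\<close>

definition invariant_function_algebra ::
  "('g, 'm) monoid_scheme \<Rightarrow> 'g topology \<Rightarrow> 'g set \<Rightarrow> ('g set \<Rightarrow> complex) set \<Rightarrow> bool" where
  "invariant_function_algebra G T H A \<longleftrightarrow>
     closedin (mtopology_of (CM_metric G T H)) A \<and>
     (\<forall>c. (\<lambda>x \<in> lcosets\<^bsub>G\<^esub> H. c) \<in> A) \<and>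
     (\<forall>f\<in>A. \<forall>h\<in>A. (\<lambda>x \<in> lcosets\<^bsub>G\<^esub> H. f x + h x) \<in> A) \<and>
     (\<forall>f\<in>A. \<forall>h\<in>A. (\<lambda>x \<in> lcosets\<^bsub>G\<^esub> H. f x * h x) \<in> A) \<and>
     (\<forall>c. \<forall>f\<in>A. (\<lambda>x \<in> lcosets\<^bsub>G\<^esub> H. c * f x) \<in> A) \<and>
     (\<forall>g\<in>carrier G. \<forall>f\<in>A. translate G H g f \<in> A)"

definition self_conjugate ::
  "('g, 'm) monoid_scheme \<Rightarrow> 'g set \<Rightarrow> ('g set \<Rightarrow> complex) set \<Rightarrow> bool" where
  "self_conjugate G H A \<longleftrightarrow> (\<forall>f\<in>A. (\<lambda>x \<in> lcosets\<^bsub>G\<^esub> H. cnj (f x)) \<in> A)"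

definition pointwise_ring :: "'x set \<Rightarrow> ('x \<Rightarrow> complex) set \<Rightarrow> ('x \<Rightarrow> complex) ring" where
  "pointwise_ring M A =
     \<lparr>carrier = A,
      mult = (\<lambda>f h. \<lambda>x\<in>M. f x * h x), one = (\<lambda>x\<in>M. 1),
      ring.zero = (\<lambda>x\<in>M. 0), ring.add = (\<lambda>f h. \<lambda>x\<in>M. f x + h x)\<rparr>"

text \<open>Ideals are not required to be closed. As \<open>A\<close> contains the constants, ring ideals of \<open>A\<close>
  are the same as algebra ideals.\<close>

definition invariant_ideal ::
  "('g, 'm) monoid_scheme \<Rightarrow> 'g set \<Rightarrow> ('g set \<Rightarrow> complex) set \<Rightarrow> ('g set \<Rightarrow> complex) set \<Rightarrow> bool" where
  "invariant_ideal G H A I \<longleftrightarrow>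
     ideal I (pointwise_ring (lcosets\<^bsub>G\<^esub> H) A) \<and>
     (\<forall>g\<in>carrier G. \<forall>f\<in>I. translate G H g f \<in> I)"

definition proper_invariant_ideal ::
  "('g, 'm) monoid_scheme \<Rightarrow> 'g set \<Rightarrow> ('g set \<Rightarrow> complex) set \<Rightarrow> ('g set \<Rightarrow> complex) set \<Rightarrow> bool" where
  "proper_invariant_ideal G H A I \<longleftrightarrow>
     invariant_ideal G H A I \<and> I \<noteq> {\<lambda>x \<in> lcosets\<^bsub>G\<^esub> H. 0} \<and> I \<noteq> A"

end

theory Submission
  imports Defs "HOL-Complex_Analysis.Great_Picard"
begin

text \<open>
  The theorem rests on one observation. Let \<open>mean\<close> be the invariant integral and let
  \<open>J = {f \<in> A. mean (f a) = 0 for all a \<in> A}\<close>. This is an invariant ideal of \<open>A\<close>, it does not contain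
  \<open>1\<close>, and it consists of the \<open>f \<in> A\<close> whose conjugate is orthogonal to \<open>A\<close>. If \<open>A\<close> has no proper
  invariant ideal then \<open>J = 0\<close>. If moreover \<open>A\<close> were not self-conjugate, then, since
  finite-dimensional invariant spaces are dense, there would be an irreducible \<open>V \<subseteq> A\<close> whose conjugate
  \<open>W\<close> is not contained in \<open>A\<close>. In a multiplicity free space the irreducible \<open>W\<close> is the only copy
  of its isomorphism type, so \<open>W\<close> is orthogonal to \<open>A\<close> (\<open>multiplicity_free_orth\<close>); this says
  \<open>V \<subseteq> J = 0\<close>, a contradiction (\<open>self_conjugate_of_mean_ideal_zero\<close>).

  Conversely, in a self-conjugate \<open>A\<close> a nonzero invariant ideal contains some \<open>|f|\<^sup>2 \<noteq> 0\<close>, hence a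
  finite sum of its translates that is strictly positive; such a function is invertible in \<open>A\<close>
  (\<open>inverse_in\<close>, \<open>ideal_eq_algebra\<close>).

  The analytic tools are developed for von Neumann's almost periodic functions on a group: the
  invariant mean (\<open>osc_step\<close>, \<open>has_mean\<close>) as a limit of finite averages, and the density of
  finite-dimensional invariant spaces (\<open>Peter_Weyl\<close>), obtained from the eigenspaces of convolution with
  a central kernel. Continuous functions on a compact group are almost periodic
  (\<open>ap_continuous\<close>), and functions on \<open>G/H\<close> are treated through their lifts to \<open>G\<close>.
\<close>

section \<open>Almost periodic functions on a group\<close>

context Group.group
begin

lemma inv_cancel:
  assumes "x \<in> carrier G" "z \<in> carrier G"
  shows "x \<otimes> (inv x \<otimes> z) = z" "inv x \<otimes> (x \<otimes> z) = z"
  using assms by (simp_all flip: m_assoc)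

text \<open>
  Almost periodicity in von Neumann's sense: the functions \<open>(h, z) \<mapsto> f (h g z)\<close> on \<open>G \<times> G\<close>, one for
  each \<open>g\<close>, are totally bounded in the uniform norm. This stands for compactness throughout the
  harmonic analysis below, and it makes sense on a group without topology. The two-sided form is
  chosen because it survives averaging \<open>f\<close> over translates on either side. Functions are only
  looked at on \<open>carrier G\<close>; their values elsewhere are arbitrary.
\<close>

definition near :: "('a \<Rightarrow> complex) \<Rightarrow> real \<Rightarrow> 'a \<Rightarrow> 'a \<Rightarrow> bool" where
  "near f \<epsilon> g n \<longleftrightarrow>
     (\<forall>h\<in>carrier G. \<forall>z\<in>carrier G. cmod (f (h \<otimes> g \<otimes> z) - f (h \<otimes> n \<otimes> z)) \<le> \<epsilon>)"

definition ap :: "('a \<Rightarrow> complex) \<Rightarrow> bool" where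
  "ap f \<longleftrightarrow> (\<forall>\<epsilon>>0. \<exists>N. finite N \<and> N \<subseteq> carrier G \<and> (\<forall>g\<in>carrier G. \<exists>n\<in>N. near f \<epsilon> g n))"

lemma nearD: "near f \<epsilon> g n \<Longrightarrow> h \<in> carrier G \<Longrightarrow> z \<in> carrier G \<Longrightarrow>
    cmod (f (h \<otimes> g \<otimes> z) - f (h \<otimes> n \<otimes> z)) \<le> \<epsilon>"
  by (simp add: near_def)

lemma near_point: "near f \<epsilon> g n \<Longrightarrow> g \<in> carrier G \<Longrightarrow> n \<in> carrier G \<Longrightarrow> cmod (f g - f n) \<le> \<epsilon>"
  unfolding near_def by (metis l_one one_closed r_one)

lemma near_trans_sym: "near f a g n \<Longrightarrow> near f b y n \<Longrightarrow> near f (a + b) g y"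
  unfolding near_def
proof (intro ballI)
  fix h z assume *: "\<forall>h\<in>carrier G. \<forall>z\<in>carrier G. cmod (f (h \<otimes> g \<otimes> z) - f (h \<otimes> n \<otimes> z)) \<le> a"
    "\<forall>h\<in>carrier G. \<forall>z\<in>carrier G. cmod (f (h \<otimes> y \<otimes> z) - f (h \<otimes> n \<otimes> z)) \<le> b"
    and h: "h \<in> carrier G" "z \<in> carrier G"
  show "cmod (f (h \<otimes> g \<otimes> z) - f (h \<otimes> y \<otimes> z)) \<le> a + b"
    using norm_triangle_le_diff[of "f (h \<otimes> g \<otimes> z) - f (h \<otimes> n \<otimes> z)" "f (h \<otimes> y \<otimes> z) - f (h \<otimes> n \<otimes> z)" "a+b"]
      * h by (smt (verit) diff_diff_eq2 diff_add_cancel)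
qed

text \<open>
  A common net for two functions: each pair of points from the two nets that is met by some group
  element is replaced by one such element, at the price of a factor \<open>2\<close>.
\<close>

lemma ap_join:
  assumes "ap f1" "ap f2" "\<epsilon> > 0"
  obtains N where "finite N" "N \<subseteq> carrier G"
    "\<And>g. g \<in> carrier G \<Longrightarrow> \<exists>n\<in>N. near f1 \<epsilon> g n \<and> near f2 \<epsilon> g n"
proof -
  have "\<epsilon> / 2 > 0" using assms by simp
  then obtain N1 N2 where N1: "finite N1" "N1 \<subseteq> carrier G" "\<And>g. g\<in>carrier G \<Longrightarrow> \<exists>n\<in>N1. near f1 (\<epsilon>/2) g n"
    and N2: "finite N2" "N2 \<subseteq> carrier G" "\<And>g. g\<in>carrier G \<Longrightarrow> \<exists>n\<in>N2. near f2 (\<epsilon>/2) g n"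
    using assms unfolding ap_def by meson
  define Q where "Q p y \<longleftrightarrow> y \<in> carrier G \<and> near f1 (\<epsilon>/2) y (fst p) \<and> near f2 (\<epsilon>/2) y (snd p)" for p y
  define N where "N = (\<lambda>p. SOME y. Q p y) ` {p \<in> N1 \<times> N2. \<exists>y. Q p y}"
  have "finite N" unfolding N_def using N1 N2 by simp
  moreover have "N \<subseteq> carrier G"
    unfolding N_def by (auto simp: Q_def intro: someI2)
  moreover have "\<exists>n\<in>N. near f1 \<epsilon> g n \<and> near f2 \<epsilon> g n" if g: "g \<in> carrier G" for g
  proof -
    obtain n1 n2 where n: "n1 \<in> N1" "near f1 (\<epsilon>/2) g n1" "n2 \<in> N2" "near f2 (\<epsilon>/2) g n2"
      using N1(3)[OF g] N2(3)[OF g] by blast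
    then have Q: "Q (n1,n2) g" using g by (simp add: Q_def)
    define y where "y = (SOME y. Q (n1,n2) y)"
    have "Q (n1,n2) y" unfolding y_def using Q by (rule someI)
    moreover have "y \<in> N" unfolding N_def y_def using Q n by blast
    ultimately show ?thesis using n near_trans_sym[of _ "\<epsilon>/2" g _ "\<epsilon>/2" y]
      by (force simp: Q_def)
  qed
  ultimately show ?thesis using that by blast
qed

text \<open>
  The source of all closure properties: a function controlled by two almost periodic ones is
  almost periodic.
\<close>

lemma ap_of_near:
  assumes "ap f1" "ap f2"
    and "\<And>\<epsilon>. \<epsilon> > 0 \<Longrightarrow> \<exists>\<delta>>0. \<forall>g\<in>carrier G. \<forall>n\<in>carrier G. near f1 \<delta> g n \<longrightarrow> near f2 \<delta> g n \<longrightarrow> near F \<epsilon> g n"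
  shows "ap F"
  unfolding ap_def
proof (intro allI impI)
  fix \<epsilon> :: real assume "\<epsilon> > 0"
  then obtain \<delta> where d: "\<delta> > 0" "\<forall>g\<in>carrier G. \<forall>n\<in>carrier G. near f1 \<delta> g n \<longrightarrow> near f2 \<delta> g n \<longrightarrow> near F \<epsilon> g n"
    using assms(3) by blast
  obtain N where N: "finite N" "N \<subseteq> carrier G" "\<And>g. g \<in> carrier G \<Longrightarrow> \<exists>n\<in>N. near f1 \<delta> g n \<and> near f2 \<delta> g n"
    using ap_join[OF assms(1,2) d(1)] by blast
  have "\<exists>n\<in>N. near F \<epsilon> g n" if "g \<in> carrier G" for g
    using N(3)[OF that] N(2) d(2) that by (meson subsetD)
  with N(1,2) show "\<exists>N. finite N \<and> N \<subseteq> carrier G \<and> (\<forall>g\<in>carrier G. \<exists>n\<in>N. near F \<epsilon> g n)"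
    by (intro exI[of _ N]) simp
qed

lemma ap_pointwise:
  assumes "ap f1" "ap f2"
    and "\<And>\<epsilon>. \<epsilon> > 0 \<Longrightarrow> \<exists>\<delta>>0. \<forall>x\<in>carrier G. \<forall>y\<in>carrier G.
       cmod (f1 x - f1 y) \<le> \<delta> \<longrightarrow> cmod (f2 x - f2 y) \<le> \<delta> \<longrightarrow> cmod (F x - F y) \<le> \<epsilon>"
  shows "ap F"
proof (rule ap_of_near[OF assms(1,2)])
  fix \<epsilon> :: real assume "\<epsilon> > 0"
  with assms(3) obtain \<delta> where "\<delta> > 0" "\<forall>x\<in>carrier G. \<forall>y\<in>carrier G.
       cmod (f1 x - f1 y) \<le> \<delta> \<longrightarrow> cmod (f2 x - f2 y) \<le> \<delta> \<longrightarrow> cmod (F x - F y) \<le> \<epsilon>" by blast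
  then show "\<exists>\<delta>>0. \<forall>g\<in>carrier G. \<forall>n\<in>carrier G. near f1 \<delta> g n \<longrightarrow> near f2 \<delta> g n \<longrightarrow> near F \<epsilon> g n"
    unfolding near_def by (metis m_closed)
qed

lemma ap_bounded:
  assumes "ap f" obtains C where "C > 0" "\<And>g. g \<in> carrier G \<Longrightarrow> cmod (f g) \<le> C"
proof -
  obtain N where N: "finite N" "N \<subseteq> carrier G" "\<forall>g\<in>carrier G. \<exists>n\<in>N. near f 1 g n"
    using assms[unfolded ap_def, rule_format, of 1] by auto
  have "cmod (f g) \<le> 1 + (\<Sum>n\<in>N. cmod (f n))" if g: "g \<in> carrier G" for g
  proof -
    obtain n where n: "n \<in> N" "near f 1 g n" using N g by blast
    then have "cmod (f g - f n) \<le> 1" using near_point g N by blast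
    moreover have "cmod (f n) \<le> (\<Sum>n\<in>N. cmod (f n))" using n N by (intro member_le_sum) auto
    ultimately show ?thesis using norm_triangle_sub[of "f g" "f n"] by linarith
  qed
  moreover have "1 + (\<Sum>n\<in>N. cmod (f n)) > 0" by (simp add: add_pos_nonneg sum_nonneg)
  ultimately show ?thesis using that by blast
qed

lemma ap_const [simp]: "ap (\<lambda>_. c)"
  unfolding ap_def near_def using one_closed by (intro allI impI exI[of _ "{\<one>}"]) auto

lemma ap_cong: "ap f \<Longrightarrow> (\<And>x. x \<in> carrier G \<Longrightarrow> f x = f' x) \<Longrightarrow> ap f'"
  by (rule ap_pointwise[of f f]) auto

lemma ap_add: assumes "ap f1" "ap f2" shows "ap (\<lambda>x. f1 x + f2 x)"
proof (rule ap_pointwise[OF assms])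
  fix \<epsilon> :: real assume "\<epsilon> > 0"
  have "cmod (f1 x + f2 x - (f1 y + f2 y)) \<le> \<epsilon>" if "cmod (f1 x - f1 y) \<le> \<epsilon>/2" "cmod (f2 x - f2 y) \<le> \<epsilon>/2" for x y
    using norm_triangle_mono[OF that] by (simp add: algebra_simps)
  then show "\<exists>\<delta>>0. \<forall>x\<in>carrier G. \<forall>y\<in>carrier G. cmod (f1 x - f1 y) \<le> \<delta> \<longrightarrow>
       cmod (f2 x - f2 y) \<le> \<delta> \<longrightarrow> cmod (f1 x + f2 x - (f1 y + f2 y)) \<le> \<epsilon>"
    using \<open>\<epsilon> > 0\<close> by (intro exI[of _ "\<epsilon>/2"]) auto
qed

lemma ap_mult: assumes "ap f1" "ap f2" shows "ap (\<lambda>x. f1 x * f2 x)"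
proof (rule ap_pointwise[OF assms])
  fix \<epsilon> :: real assume e: "\<epsilon> > 0"
  obtain C1 where C1: "C1 > 0" "\<And>g. g \<in> carrier G \<Longrightarrow> cmod (f1 g) \<le> C1" using ap_bounded assms by blast
  obtain C2 where C2: "C2 > 0" "\<And>g. g \<in> carrier G \<Longrightarrow> cmod (f2 g) \<le> C2" using ap_bounded assms by blast
  define d where "d = \<epsilon> / (C1 + C2)"
  have d: "d > 0" "(C1 + C2) * d = \<epsilon>" using e C1 C2 by (auto simp: d_def)
  have "cmod (f1 x * f2 x - f1 y * f2 y) \<le> \<epsilon>" if "x \<in> carrier G" "y \<in> carrier G"
    "cmod (f1 x - f1 y) \<le> d" "cmod (f2 x - f2 y) \<le> d" for x y
  proof -
    have "f1 x * f2 x - f1 y * f2 y = f1 x * (f2 x - f2 y) + (f1 x - f1 y) * f2 y"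
      by (simp add: algebra_simps)
    then have "cmod (f1 x * f2 x - f1 y * f2 y) \<le> cmod (f1 x) * cmod (f2 x - f2 y) + cmod (f1 x - f1 y) * cmod (f2 y)"
      by (metis norm_mult norm_triangle_ineq)
    also have "\<dots> \<le> C1 * d + d * C2"
      using that C1 C2 d by (intro add_mono mult_mono) auto
    finally show ?thesis using d by (simp add: algebra_simps)
  qed
  then show "\<exists>\<delta>>0. \<forall>x\<in>carrier G. \<forall>y\<in>carrier G. cmod (f1 x - f1 y) \<le> \<delta> \<longrightarrow>
       cmod (f2 x - f2 y) \<le> \<delta> \<longrightarrow> cmod (f1 x * f2 x - f1 y * f2 y) \<le> \<epsilon>"
    using d by blast
qed

lemma ap_cmult: "ap f \<Longrightarrow> ap (\<lambda>x. c * f x)"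
  using ap_mult[OF ap_const] by simp

lemma ap_contraction:
  assumes "ap f" "\<And>x y. cmod (r x - r y) \<le> cmod (x - y)" shows "ap (\<lambda>x. r (f x))"
  by (rule ap_pointwise[OF assms(1,1)]) (meson assms(2) order_trans)

lemma ap_cnj: "ap f \<Longrightarrow> ap (\<lambda>x. cnj (f x))"
  by (rule ap_contraction[where r = cnj]) (simp_all flip: complex_cnj_diff)

lemma ap_Re: "ap f \<Longrightarrow> ap (\<lambda>x. complex_of_real (Re (f x)))"
proof (rule ap_contraction[where r = "\<lambda>z. complex_of_real (Re z)"])
  show "cmod (complex_of_real (Re x) - complex_of_real (Re y)) \<le> cmod (x - y)" for x y
    using abs_Re_le_cmod[of "x - y"] by (simp flip: of_real_diff)
qed

lemma ap_sum: "finite S \<Longrightarrow> (\<And>i. i \<in> S \<Longrightarrow> ap (F i)) \<Longrightarrow> ap (\<lambda>x. \<Sum>i\<in>S. F i x)"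
  by (induction S rule: finite_induct) (auto intro: ap_add)

lemma ap_translate:
  assumes "ap f" "u \<in> carrier G" "v \<in> carrier G" shows "ap (\<lambda>x. f (u \<otimes> x \<otimes> v))"
proof (rule ap_of_near[OF assms(1,1)])
  fix \<epsilon> :: real assume "\<epsilon> > 0"
  have "near (\<lambda>x. f (u \<otimes> x \<otimes> v)) \<epsilon> g n" if "g \<in> carrier G" "n \<in> carrier G" "near f \<epsilon> g n" for g n
    unfolding near_def
  proof (intro ballI)
    fix h z assume h: "h \<in> carrier G" "z \<in> carrier G"
    have "u \<otimes> (h \<otimes> x \<otimes> z) \<otimes> v = (u \<otimes> h) \<otimes> x \<otimes> (z \<otimes> v)" if "x \<in> carrier G" for x
      using that h assms by (simp add: m_assoc)
    then show "cmod (f (u \<otimes> (h \<otimes> g \<otimes> z) \<otimes> v) - f (u \<otimes> (h \<otimes> n \<otimes> z) \<otimes> v)) \<le> \<epsilon>"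
      using that h assms unfolding near_def by simp
  qed
  then show "\<exists>\<delta>>0. \<forall>g\<in>carrier G. \<forall>n\<in>carrier G. near f \<delta> g n \<longrightarrow> near f \<delta> g n \<longrightarrow> near (\<lambda>x. f (u \<otimes> x \<otimes> v)) \<epsilon> g n"
    using \<open>\<epsilon> > 0\<close> by blast
qed

lemma ap_ltrans: "ap f \<Longrightarrow> u \<in> carrier G \<Longrightarrow> ap (\<lambda>x. f (u \<otimes> x))"
  by (rule ap_cong[OF ap_translate[of f u "\<one>"]]) auto

lemma ap_rtrans: "ap f \<Longrightarrow> v \<in> carrier G \<Longrightarrow> ap (\<lambda>x. f (x \<otimes> v))"
  by (rule ap_cong[OF ap_translate[of f "\<one>" v]]) auto

lemma inv_triple: "x \<in> carrier G \<Longrightarrow> y \<in> carrier G \<Longrightarrow> z \<in> carrier G \<Longrightarrow>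
   inv (x \<otimes> y \<otimes> z) = inv z \<otimes> inv y \<otimes> inv x"
  by (simp add: inv_mult_group m_assoc)

lemma near_inv:
  assumes "near f \<epsilon> (inv g) (inv n)" "g \<in> carrier G" "n \<in> carrier G"
  shows "near (\<lambda>x. f (inv x)) \<epsilon> g n"
  using assms unfolding near_def by (simp add: inv_triple)

lemma ap_inv: assumes "ap f" shows "ap (\<lambda>x. f (inv x))"
  unfolding ap_def
proof (intro allI impI)
  fix \<epsilon> :: real assume "\<epsilon> > 0"
  obtain N where N: "finite N" "N \<subseteq> carrier G" "\<And>g. g\<in>carrier G \<Longrightarrow> \<exists>n\<in>N. near f \<epsilon> g n"
    using assms[unfolded ap_def, rule_format, OF \<open>\<epsilon> > 0\<close>] by auto
  have "\<exists>n\<in>(\<lambda>x. inv x) ` N. near (\<lambda>x. f (inv x)) \<epsilon> g n" if g: "g \<in> carrier G" for g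
  proof -
    obtain n where n: "n \<in> N" "near f \<epsilon> (inv g) n" using N(3)[of "inv g"] g by auto
    have nc: "n \<in> carrier G" using n N(2) by blast
    then have "near f \<epsilon> (inv g) (inv (inv n))" using n(2) by simp
    then have "near (\<lambda>x. f (inv x)) \<epsilon> g (inv n)" using near_inv g nc by simp
    then show ?thesis using n(1) by blast
  qed
  then show "\<exists>N. finite N \<and> N \<subseteq> carrier G \<and> (\<forall>g\<in>carrier G. \<exists>n\<in>N. near (\<lambda>x. f (inv x)) \<epsilon> g n)"
    using N(1,2) by (intro exI[of _ "(\<lambda>x. inv x) ` N"]) auto
qed

subsection \<open>Finite averages\<close>

text \<open>
  The functionals \<open>f \<mapsto> \<Sum>\<^sub>g w\<^sub>g f g\<close> with a finitely supported probability weight \<open>w\<close> on \<open>G\<close>.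
  The inductive form avoids all bookkeeping of index sets: linearity, bounds and the exchange of two
  averages are one-line inductions.
\<close>

inductive avg :: "(('a \<Rightarrow> complex) \<Rightarrow> complex) \<Rightarrow> bool" where
  avg_point: "g \<in> carrier G \<Longrightarrow> avg (\<lambda>f. f g)"
| avg_mix: "avg \<Lambda>1 \<Longrightarrow> avg \<Lambda>2 \<Longrightarrow> 0 \<le> t \<Longrightarrow> t \<le> 1 \<Longrightarrow>
     avg (\<lambda>f. complex_of_real t * \<Lambda>1 f + (1 - complex_of_real t) * \<Lambda>2 f)"

lemma avg_add: "avg \<Lambda> \<Longrightarrow> \<Lambda> (\<lambda>x. f x + h x) = \<Lambda> f + \<Lambda> h"
  by (induction rule: avg.induct) (auto simp: algebra_simps)

lemma avg_cmult: "avg \<Lambda> \<Longrightarrow> \<Lambda> (\<lambda>x. c * f x) = c * \<Lambda> f"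
  by (induction rule: avg.induct) (auto simp: algebra_simps)

lemma avg_const: "avg \<Lambda> \<Longrightarrow> \<Lambda> (\<lambda>x. c) = c"
  by (induction rule: avg.induct) (auto simp: algebra_simps)

lemma avg_cong: "avg \<Lambda> \<Longrightarrow> (\<And>x. x \<in> carrier G \<Longrightarrow> f x = h x) \<Longrightarrow> \<Lambda> f = \<Lambda> h"
  by (induction rule: avg.induct) auto

lemma avg_cnj: "avg \<Lambda> \<Longrightarrow> \<Lambda> (\<lambda>x. cnj (f x)) = cnj (\<Lambda> f)"
  by (induction rule: avg.induct) auto

lemma avg_Im0: "avg \<Lambda> \<Longrightarrow> (\<And>x. x \<in> carrier G \<Longrightarrow> Im (f x) = 0) \<Longrightarrow> Im (\<Lambda> f) = 0"
  by (induction rule: avg.induct) auto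

lemma convex_comb_le: fixes a b c t :: real
  assumes "a \<le> c" "b \<le> c" "0 \<le> t" "t \<le> 1" shows "t * a + (1 - t) * b \<le> c"
  using assms convex_bound_le[of a c b t "1 - t"] by simp

lemma avg_Re_le: "avg \<Lambda> \<Longrightarrow> (\<And>x. x \<in> carrier G \<Longrightarrow> Re (f x) \<le> c) \<Longrightarrow> Re (\<Lambda> f) \<le> c"
  by (induction rule: avg.induct) (auto intro: convex_comb_le)

lemma avg_cmod_le: "avg \<Lambda> \<Longrightarrow> (\<And>x. x \<in> carrier G \<Longrightarrow> cmod (f x) \<le> c) \<Longrightarrow> cmod (\<Lambda> f) \<le> c"
proof (induction rule: avg.induct)
  case (avg_mix \<Lambda>1 \<Lambda>2 t)
  have "cmod (complex_of_real t * \<Lambda>1 f + (1 - complex_of_real t) * \<Lambda>2 f) \<le> t * cmod (\<Lambda>1 f) + (1 - t) * cmod (\<Lambda>2 f)"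
    using avg_mix norm_of_real[of "1 - t", where ?'a = complex]
    by (intro order_trans[OF norm_triangle_ineq]) (simp add: norm_mult)
  also have "\<dots> \<le> c" using avg_mix by (intro convex_comb_le) auto
  finally show ?case .
qed auto

lemma avg_diff: "avg \<Lambda> \<Longrightarrow> \<Lambda> (\<lambda>x. f x - h x) = \<Lambda> f - \<Lambda> h"
  using avg_add[of \<Lambda> f "\<lambda>x. (-1) * h x"] avg_cmult[of \<Lambda> "-1" h] by simp

lemma avg_diff_le: "avg \<Lambda> \<Longrightarrow> (\<And>x. x \<in> carrier G \<Longrightarrow> cmod (f x - h x) \<le> c) \<Longrightarrow> cmod (\<Lambda> f - \<Lambda> h) \<le> c"
  using avg_cmod_le[of \<Lambda> "\<lambda>x. f x - h x" c] by (simp add: avg_diff)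

lemma avg_const_le: "avg \<Lambda> \<Longrightarrow> (\<And>x. x \<in> carrier G \<Longrightarrow> cmod (f x - d) \<le> c) \<Longrightarrow> cmod (\<Lambda> f - d) \<le> c"
  using avg_diff_le[of \<Lambda> f "\<lambda>_. d" c] by (simp add: avg_const)

lemma avg_bind: "avg \<Lambda> \<Longrightarrow> (\<And>g. g \<in> carrier G \<Longrightarrow> avg (\<Theta> g)) \<Longrightarrow> avg (\<lambda>f. \<Lambda> (\<lambda>g. \<Theta> g f))"
  by (induction rule: avg.induct) (auto intro: avg.intros)

lemma avg_map: "avg \<Lambda> \<Longrightarrow> (\<And>g. g \<in> carrier G \<Longrightarrow> r g \<in> carrier G) \<Longrightarrow> avg (\<lambda>f. \<Lambda> (\<lambda>g. f (r g)))"
  using avg_bind[of \<Lambda> "\<lambda>g f. f (r g)"] by (simp add: avg_point)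

lemma avg_exchange: "avg \<Lambda> \<Longrightarrow> avg \<Lambda>' \<Longrightarrow> \<Lambda> (\<lambda>x. \<Lambda>' (\<lambda>y. F x y)) = \<Lambda>' (\<lambda>y. \<Lambda> (\<lambda>x. F x y))"
  by (induction rule: avg.induct) (simp_all add: avg_add[of \<Lambda>'] avg_cmult[of \<Lambda>'])

lemma avg_uniform: "finite N \<Longrightarrow> N \<noteq> {} \<Longrightarrow> N \<subseteq> carrier G \<Longrightarrow> avg (\<lambda>f. (\<Sum>n\<in>N. f n) / of_nat (card N))"
proof (induction N rule: finite_ne_induct)
  case (singleton x)
  then show ?case using avg_point[of x] by simp
next
  case (insert x N)
  define k where "k = card N"
  have k: "k > 0" using insert by (simp add: k_def card_gt_0_iff)
  define t :: real where "t = 1 / (1 + k)"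
  have t: "0 \<le> t" "t \<le> 1" by (auto simp: t_def)
  have "avg (\<lambda>f. complex_of_real t * f x + (1 - complex_of_real t) * ((\<Sum>n\<in>N. f n) / of_nat k))"
    using insert t k_def by (intro avg_mix avg_point) auto
  moreover have "complex_of_real t * f x + (1 - complex_of_real t) * ((\<Sum>n\<in>N. f n) / of_nat k)
     = (\<Sum>n\<in>insert x N. f n) / of_nat (card (insert x N))" for f
  proof -
    have "complex_of_real t = 1 / (1 + of_nat k)" by (simp add: t_def)
    moreover have "1 - complex_of_real t = of_nat k / (1 + of_nat k)"
    proof -
      have "1 - t = real k / (1 + real k)" by (simp add: t_def field_simps)
      then show ?thesis
        by (metis of_real_1 of_real_add of_real_diff of_real_divide of_real_of_nat_eq)
    qed
    ultimately show ?thesis using insert k by (simp add: k_def[symmetric] add_divide_distrib)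
  qed
  ultimately show ?case by simp
qed

text \<open>
  The average \<open>\<Lambda>\<close> turns every two-sided translate of \<open>f\<close> into almost the same constant \<open>c\<close>.
  The mean value of \<open>f\<close> will be the limit of such constants.
\<close>

definition good :: "('a \<Rightarrow> complex) \<Rightarrow> (('a \<Rightarrow> complex) \<Rightarrow> complex) \<Rightarrow> complex \<Rightarrow> real \<Rightarrow> bool" where
  "good f \<Lambda> c \<epsilon> \<longleftrightarrow> (\<forall>x\<in>carrier G. \<forall>y\<in>carrier G. cmod (\<Lambda> (\<lambda>g. f (x \<otimes> g \<otimes> y)) - c) \<le> \<epsilon>)"

text \<open>
  Convolution of the weights. It inherits flattening from either factor, so finitely many functions
  can be flattened by a single average.
\<close>

definition conv where "conv \<Lambda>1 \<Lambda>2 = (\<lambda>f::'a \<Rightarrow> complex. (\<Lambda>1 (\<lambda>a. \<Lambda>2 (\<lambda>b. f (a \<otimes> b))) :: complex))"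

lemma avg_conv: "avg \<Lambda>1 \<Longrightarrow> avg \<Lambda>2 \<Longrightarrow> avg (conv \<Lambda>1 \<Lambda>2)"
  unfolding conv_def by (rule avg_bind) (auto intro: avg_map)

lemma good_conv:
  assumes "avg \<Lambda>1" "avg \<Lambda>2"
  shows good_conv1: "good f \<Lambda>1 c \<epsilon> \<Longrightarrow> good f (conv \<Lambda>1 \<Lambda>2) c \<epsilon>"
    and good_conv2: "good f \<Lambda>2 c \<epsilon> \<Longrightarrow> good f (conv \<Lambda>1 \<Lambda>2) c \<epsilon>"
proof -
  show "good f (conv \<Lambda>1 \<Lambda>2) c \<epsilon>" if g: "good f \<Lambda>1 c \<epsilon>"
    unfolding good_def
  proof (intro ballI)
    fix x y assume xy: "x \<in> carrier G" "y \<in> carrier G"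
    have "conv \<Lambda>1 \<Lambda>2 (\<lambda>g. f (x \<otimes> g \<otimes> y)) = \<Lambda>2 (\<lambda>b. \<Lambda>1 (\<lambda>a. f (x \<otimes> (a \<otimes> b) \<otimes> y)))"
      unfolding conv_def by (rule avg_exchange[OF assms])
    also have "\<dots> = \<Lambda>2 (\<lambda>b. \<Lambda>1 (\<lambda>a. f (x \<otimes> a \<otimes> (b \<otimes> y))))"
      by (rule avg_cong[OF assms(2)], rule avg_cong[OF assms(1)]) (simp add: xy m_assoc)
    finally have eq: "conv \<Lambda>1 \<Lambda>2 (\<lambda>g. f (x \<otimes> g \<otimes> y)) = \<dots>" .
    show "cmod (conv \<Lambda>1 \<Lambda>2 (\<lambda>g. f (x \<otimes> g \<otimes> y)) - c) \<le> \<epsilon>"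
      unfolding eq by (rule avg_const_le[OF assms(2)]) (use g xy in \<open>simp add: good_def\<close>)
  qed
  show "good f (conv \<Lambda>1 \<Lambda>2) c \<epsilon>" if g: "good f \<Lambda>2 c \<epsilon>"
    unfolding good_def
  proof (intro ballI)
    fix x y assume xy: "x \<in> carrier G" "y \<in> carrier G"
    have eq: "conv \<Lambda>1 \<Lambda>2 (\<lambda>g. f (x \<otimes> g \<otimes> y)) = \<Lambda>1 (\<lambda>a. \<Lambda>2 (\<lambda>b. f (x \<otimes> a \<otimes> b \<otimes> y)))"
      unfolding conv_def
      by (rule avg_cong[OF assms(1)], rule avg_cong[OF assms(2)]) (simp add: xy m_assoc)
    show "cmod (conv \<Lambda>1 \<Lambda>2 (\<lambda>g. f (x \<otimes> g \<otimes> y)) - c) \<le> \<epsilon>"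
      unfolding eq by (rule avg_const_le[OF assms(1)]) (use g xy in \<open>simp add: good_def\<close>)
  qed
qed

lemma good_unique: assumes "avg \<Lambda>1" "avg \<Lambda>2" "good f \<Lambda>1 c1 e1" "good f \<Lambda>2 c2 e2"
  shows "cmod (c1 - c2) \<le> e1 + e2"
proof -
  let ?z = "conv \<Lambda>1 \<Lambda>2 (\<lambda>g. f (\<one> \<otimes> g \<otimes> \<one>))"
  have "cmod (?z - c1) \<le> e1" "cmod (?z - c2) \<le> e2"
    using good_conv1[OF assms(1,2,3)] good_conv2[OF assms(1,2,4)] one_closed unfolding good_def by blast+
  then show ?thesis using norm_triangle_ineq4[of "?z - c2" "?z - c1"] by simp
qed

text \<open>
  The contraction step of von Neumann's construction. If the averages of the translates of \<open>f\<close>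
  have real parts spread over an interval of length \<open>r\<close> and one of them lies in the lower half, then
  averaging further over the translates by \<open>n\<^sub>1\<close> on the left and \<open>n\<^sub>2\<close> on the right, with \<open>n\<^sub>1, n\<^sub>2\<close> in
  the net \<open>N\<close>, mixes into every translate a portion of at least \<open>1 / |N|\<^sup>2\<close> of that low value, up to
  \<open>2 \<epsilon>\<close>, and shortens the interval from above.
  If none lies in the lower half, the upper half is already an admissible interval.
\<close>

lemma osc_step:
  assumes N: "finite N" "N \<subseteq> carrier G" "N \<noteq> {}" "\<And>g. g \<in> carrier G \<Longrightarrow> \<exists>n\<in>N. near f \<epsilon> g n"
    and L: "avg \<Lambda>" and e: "\<epsilon> > 0" "r \<ge> 8 * \<epsilon>"
    and R: "\<And>x y. x \<in> carrier G \<Longrightarrow> y \<in> carrier G \<Longrightarrow> Re (\<Lambda> (\<lambda>g. f (x \<otimes> g \<otimes> y))) \<in> {l..l+r}"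
  shows "\<exists>\<Lambda>' l'. avg \<Lambda>' \<and> (\<forall>x\<in>carrier G. \<forall>y\<in>carrier G.
     Re (\<Lambda>' (\<lambda>g. f (x \<otimes> g \<otimes> y))) \<in> {l'..l' + (1 - 1 / (4 * (real (card N))\<^sup>2)) * r})"
proof -
  define n where "n = card N"
  have n: "n \<ge> 1" using N by (simp add: n_def Suc_le_eq card_gt_0_iff)
  have n2: "(real n)\<^sup>2 \<ge> 1" using n by simp
  define \<theta> where "\<theta> = 1 - 1 / (4 * (real n)\<^sup>2)"
  have th: "\<theta> \<ge> 1/2" using n2 frac_le[of 1 1 4 "4 * (real n)\<^sup>2"] by (simp add: \<theta>_def)
  show ?thesis
  proof (cases "\<exists>x0\<in>carrier G. \<exists>y0\<in>carrier G. Re (\<Lambda> (\<lambda>g. f (x0 \<otimes> g \<otimes> y0))) < l + r/2")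
    case False
    have "r \<ge> 0" using e by linarith
    then have "r / 2 \<le> \<theta> * r" using th mult_right_mono[of "1/2" \<theta> r] by simp
    then have "Re (\<Lambda> (\<lambda>g. f (x \<otimes> g \<otimes> y))) \<in> {l + r/2..l + r/2 + \<theta> * r}"
      if "x \<in> carrier G" "y \<in> carrier G" for x y
      using R[OF that] False that by (auto simp: not_less)
    note range = this
    show ?thesis
      by (rule exI[of _ \<Lambda>], rule exI[of _ "l + r/2"], intro conjI ballI L)
        (rule range[unfolded \<theta>_def n_def])
  next
    case True
    then obtain x0 y0 where xy0: "x0 \<in> carrier G" "y0 \<in> carrier G" "Re (\<Lambda> (\<lambda>g. f (x0 \<otimes> g \<otimes> y0))) < l + r/2"
      by blast
    define U where "U = (\<lambda>f::'a\<Rightarrow>complex. (\<Sum>n\<in>N. f n) / of_nat (card N))"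
    have U: "avg U" unfolding U_def using N by (intro avg_uniform) auto
    define \<Lambda>' where "\<Lambda>' = (\<lambda>f. U (\<lambda>a. U (\<lambda>c. \<Lambda> (\<lambda>b. f (a \<otimes> b \<otimes> c)))))"
    have L': "avg \<Lambda>'" unfolding \<Lambda>'_def
      by (rule avg_bind[OF U], rule avg_bind[OF U], rule avg_map[OF L]) auto
    have "Re (\<Lambda>' (\<lambda>g. f (x \<otimes> g \<otimes> y))) \<in> {l..l + \<theta> * r}" if xy: "x \<in> carrier G" "y \<in> carrier G" for x y
    proof -
      define Q where "Q p = Re (\<Lambda> (\<lambda>b. f ((x \<otimes> fst p) \<otimes> b \<otimes> (snd p \<otimes> y))))" for p
      have Nc: "a \<in> carrier G" if "a \<in> N" for a using that N by blast
      have cong: "\<Lambda> (\<lambda>b. f (x \<otimes> (a \<otimes> b \<otimes> c) \<otimes> y)) = \<Lambda> (\<lambda>b. f ((x \<otimes> a) \<otimes> b \<otimes> (c \<otimes> y)))"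
        if "a \<in> N" "c \<in> N" for a c
        using that xy Nc by (intro avg_cong[OF L]) (simp add: m_assoc)
      have "\<Lambda>' (\<lambda>g. f (x \<otimes> g \<otimes> y)) = (\<Sum>a\<in>N. (\<Sum>c\<in>N. \<Lambda> (\<lambda>b. f ((x \<otimes> a) \<otimes> b \<otimes> (c \<otimes> y)))) / of_nat n) / of_nat n"
        unfolding \<Lambda>'_def U_def n_def using cong by simp
      also have "\<dots> = (\<Sum>p\<in>N\<times>N. \<Lambda> (\<lambda>b. f ((x \<otimes> fst p) \<otimes> b \<otimes> (snd p \<otimes> y)))) / of_real ((real n)\<^sup>2)"
        by (simp add: sum.cartesian_product sum_divide_distrib power2_eq_square split_beta)
      finally have eq: "Re (\<Lambda>' (\<lambda>g. f (x \<otimes> g \<otimes> y))) = (\<Sum>p\<in>N\<times>N. Q p) / (real n)\<^sup>2"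
        by (simp only: Re_divide_of_real Re_sum Q_def)
      have card: "real (card (N \<times> N)) = (real n)\<^sup>2" by (simp add: n_def power2_eq_square card_cartesian_product)
      have Qr: "l \<le> Q p" "Q p \<le> l + r" if "p \<in> N \<times> N" for p
        using R[of "x \<otimes> fst p" "snd p \<otimes> y"] that xy Nc unfolding Q_def by auto
      have lo: "(real n)\<^sup>2 * l \<le> (\<Sum>p\<in>N\<times>N. Q p)"
        using sum_bounded_below[of "N \<times> N" l Q] Qr card by simp
      obtain a0 where a0: "a0 \<in> N" "near f \<epsilon> (inv x \<otimes> x0) a0" using N(4)[of "inv x \<otimes> x0"] xy xy0 by auto
      obtain c0 where c0: "c0 \<in> N" "near f \<epsilon> (y0 \<otimes> inv y) c0" using N(4)[of "y0 \<otimes> inv y"] xy xy0 by auto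
      \<comment> \<open>\<open>a0\<close> and \<open>c0\<close> move the given translate close to the low one\<close>
      have "cmod (\<Lambda> (\<lambda>b. f ((x \<otimes> a0) \<otimes> b \<otimes> (c0 \<otimes> y))) - \<Lambda> (\<lambda>b. f (x0 \<otimes> b \<otimes> y0))) \<le> 2 * \<epsilon>"
      proof (rule avg_diff_le[OF L])
        fix b assume b: "b \<in> carrier G"
        have 1: "cmod (f (x \<otimes> (inv x \<otimes> x0) \<otimes> (b \<otimes> y0)) - f (x \<otimes> a0 \<otimes> (b \<otimes> y0))) \<le> \<epsilon>"
          using a0 xy xy0 b unfolding near_def by simp
        have 2: "cmod (f (x \<otimes> a0 \<otimes> b \<otimes> (y0 \<otimes> inv y) \<otimes> y) - f (x \<otimes> a0 \<otimes> b \<otimes> c0 \<otimes> y)) \<le> \<epsilon>"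
          using c0 xy xy0 b a0 Nc unfolding near_def by simp
        have e1: "x \<otimes> (inv x \<otimes> x0) \<otimes> (b \<otimes> y0) = x0 \<otimes> b \<otimes> y0"
          using xy xy0 b by (simp add: m_assoc inv_cancel)
        have e2: "x \<otimes> a0 \<otimes> b \<otimes> (y0 \<otimes> inv y) \<otimes> y = x \<otimes> a0 \<otimes> (b \<otimes> y0)"
          using xy xy0 b a0 Nc by (simp add: m_assoc inv_cancel)
        have e3: "x \<otimes> a0 \<otimes> b \<otimes> c0 \<otimes> y = (x \<otimes> a0) \<otimes> b \<otimes> (c0 \<otimes> y)"
          using xy xy0 b a0 c0 Nc by (simp add: m_assoc)
        show "cmod (f ((x \<otimes> a0) \<otimes> b \<otimes> (c0 \<otimes> y)) - f (x0 \<otimes> b \<otimes> y0)) \<le> 2 * \<epsilon>"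
          using 1 2 unfolding e1 e2 e3
          using norm_triangle_ineq4[of "f (x0 \<otimes> b \<otimes> y0) - f (x \<otimes> a0 \<otimes> (b \<otimes> y0))" "- (f (x \<otimes> a0 \<otimes> (b \<otimes> y0)) - f ((x \<otimes> a0) \<otimes> b \<otimes> (c0 \<otimes> y)))"]
          by (simp add: norm_minus_commute)
      qed
      then have "\<bar>Q (a0,c0) - Re (\<Lambda> (\<lambda>b. f (x0 \<otimes> b \<otimes> y0)))\<bar> \<le> 2 * \<epsilon>"
        using abs_Re_le_cmod[of "\<Lambda> (\<lambda>b. f ((x \<otimes> a0) \<otimes> b \<otimes> (c0 \<otimes> y))) - \<Lambda> (\<lambda>b. f (x0 \<otimes> b \<otimes> y0))"]
        by (simp add: Q_def)
      then have Q0: "Q (a0,c0) \<le> l + r - r / 4" using xy0 e by linarith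
      have p0: "(a0,c0) \<in> N \<times> N" using a0 c0 by simp
      have "(\<Sum>p\<in>N\<times>N. Q p) = Q (a0,c0) + (\<Sum>p\<in>N\<times>N - {(a0,c0)}. Q p)"
        using p0 N by (intro sum.remove) auto
      also have "(\<Sum>p\<in>N\<times>N - {(a0,c0)}. Q p) \<le> real (card (N\<times>N - {(a0,c0)})) * (l + r)"
        using Qr by (intro sum_bounded_above) auto
      also have "real (card (N\<times>N - {(a0,c0)})) = (real n)\<^sup>2 - 1"
      proof -
        have "card (N\<times>N) \<ge> 1" using N by (simp add: Suc_le_eq card_gt_0_iff)
        then show ?thesis using p0 N card by (simp add: card_Diff_singleton of_nat_diff)
      qed
      finally have hi: "(\<Sum>p\<in>N\<times>N. Q p) \<le> (real n)\<^sup>2 * (l + r) - r / 4"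
        using Q0 by (simp add: algebra_simps)
      have "(\<Sum>p\<in>N\<times>N. Q p) / (real n)\<^sup>2 \<le> ((real n)\<^sup>2 * (l + r) - r / 4) / (real n)\<^sup>2"
        using hi by (intro divide_right_mono) auto
      also have "\<dots> = l + \<theta> * r"
        using n by (simp add: \<theta>_def diff_divide_distrib left_diff_distrib)
      finally have "(\<Sum>p\<in>N\<times>N. Q p) / (real n)\<^sup>2 \<le> l + \<theta> * r" .
      moreover have "l \<le> (\<Sum>p\<in>N\<times>N. Q p) / (real n)\<^sup>2"
        using lo n by (simp add: field_simps)
      ultimately show ?thesis unfolding eq by simp
    qed
    note range = this
    show ?thesis
      by (rule exI[of _ \<Lambda>'], rule exI[of _ l], intro conjI ballI L')
        (rule range[unfolded \<theta>_def n_def])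
  qed
qed

end

section \<open>The invariant mean\<close>

context Group.group
begin

text \<open>
  Iterating the contraction step: the oscillation decreases geometrically until it is of the order
  of the mesh \<open>\<epsilon>\<close> of the net.
\<close>

lemma osc_small:
  assumes f: "ap f" and e: "\<epsilon> > 0"
  shows "\<exists>\<Lambda> l. avg \<Lambda> \<and> (\<forall>x\<in>carrier G. \<forall>y\<in>carrier G. Re (\<Lambda> (\<lambda>g. f (x \<otimes> g \<otimes> y))) \<in> {l..l + 8 * \<epsilon>})"
proof -
  obtain N where N: "finite N" "N \<subseteq> carrier G" "\<And>g. g \<in> carrier G \<Longrightarrow> \<exists>n\<in>N. near f \<epsilon> g n"
    using f[unfolded ap_def, rule_format, OF e] by auto
  have Nne: "N \<noteq> {}" using N(3)[OF one_closed] by blast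
  define \<theta> where "\<theta> = 1 - 1 / (4 * (real (card N))\<^sup>2)"
  have n1: "real (card N) \<ge> 1" using N Nne by (simp add: Suc_le_eq card_gt_0_iff)
  have th: "0 \<le> \<theta>" "\<theta> < 1"
  proof -
    have q: "(real (card N))\<^sup>2 \<ge> 1" using n1 by (rule one_le_power)
    then have "1 / (4 * (real (card N))\<^sup>2) \<le> 1 / 4" by (intro frac_le) auto
    moreover have "1 / (4 * (real (card N))\<^sup>2) > 0" using q by (intro divide_pos_pos) linarith+
    ultimately show "0 \<le> \<theta>" "\<theta> < 1" unfolding \<theta>_def by linarith+
  qed
  obtain C where C: "C > 0" "\<And>g. g \<in> carrier G \<Longrightarrow> cmod (f g) \<le> C" using ap_bounded f by blast
  have ex: "\<exists>\<Lambda> l. avg \<Lambda> \<and> (\<forall>x\<in>carrier G. \<forall>y\<in>carrier G.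
      Re (\<Lambda> (\<lambda>g. f (x \<otimes> g \<otimes> y))) \<in> {l..l + max (8 * \<epsilon>) (\<theta> ^ k * (2 * C))})" for k
  proof (induction k)
    case 0
    have "Re (f (x \<otimes> \<one> \<otimes> y)) \<in> {-C..-C + max (8 * \<epsilon>) (\<theta> ^ 0 * (2 * C))}"
      if "x \<in> carrier G" "y \<in> carrier G" for x y
      using C(2)[of "x \<otimes> \<one> \<otimes> y"] abs_Re_le_cmod[of "f (x \<otimes> \<one> \<otimes> y)"] that by auto
    then show ?case
      by (intro exI[of _ "\<lambda>f. f \<one>"] exI[of _ "-C"] conjI avg_point ballI) auto
  next
    case (Suc k)
    define r where "r = max (8 * \<epsilon>) (\<theta> ^ k * (2 * C))"
    obtain \<Lambda> l where L: "avg \<Lambda>" and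
      R: "\<And>x y. x \<in> carrier G \<Longrightarrow> y \<in> carrier G \<Longrightarrow> Re (\<Lambda> (\<lambda>g. f (x \<otimes> g \<otimes> y))) \<in> {l..l + r}"
      using Suc unfolding r_def by blast
    obtain \<Lambda>' l' where L': "avg \<Lambda>'" and
      R': "\<And>x y. x \<in> carrier G \<Longrightarrow> y \<in> carrier G \<Longrightarrow> Re (\<Lambda>' (\<lambda>g. f (x \<otimes> g \<otimes> y))) \<in> {l'..l' + \<theta> * r}"
      using osc_step[OF N(1,2) Nne N(3) L e _ R] unfolding \<theta>_def[symmetric] r_def by force
    have "\<theta> * r \<le> max (8 * \<epsilon>) (\<theta> ^ Suc k * (2 * C))"
    proof (cases "8 * \<epsilon> \<ge> \<theta> ^ k * (2 * C)")
      case True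
      then have "\<theta> * r \<le> 1 * (8 * \<epsilon>)" unfolding r_def using th e by (intro mult_mono) auto
      then show ?thesis by simp
    qed (auto simp: r_def)
    then show ?case using R' L'
      by (intro exI[of _ \<Lambda>'] exI[of _ l'] conjI ballI) (fastforce)+
  qed
  have "(\<lambda>k. \<theta> ^ k * (2 * C)) \<longlonglongrightarrow> 0 * (2 * C)"
    using th by (intro tendsto_mult tendsto_const LIMSEQ_power_zero) auto
  then have "\<forall>\<^sub>F k in sequentially. \<theta> ^ k * (2 * C) < 8 * \<epsilon>"
    using e by (intro order_tendstoD) auto
  then obtain k where "\<theta> ^ k * (2 * C) < 8 * \<epsilon>" by (meson eventually_happens trivial_limit_sequentially)
  then have "max (8 * \<epsilon>) (\<theta> ^ k * (2 * C)) = 8 * \<epsilon>" by simp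
  then show ?thesis using ex[of k] by simp
qed

lemma good_Re:
  assumes f: "ap f" and e: "\<epsilon> > 0"
  shows "\<exists>\<Lambda> c. avg \<Lambda> \<and> good (\<lambda>x. complex_of_real (Re (f x))) \<Lambda> c \<epsilon>"
proof -
  let ?f = "\<lambda>x. complex_of_real (Re (f x))"
  obtain \<Lambda> l where L: "avg \<Lambda>" and
    R: "\<And>x y. x \<in> carrier G \<Longrightarrow> y \<in> carrier G \<Longrightarrow> Re (\<Lambda> (\<lambda>g. ?f (x \<otimes> g \<otimes> y))) \<in> {l..l + \<epsilon>}"
    using osc_small[OF ap_Re[OF f], of "\<epsilon> / 8"] e by auto
  have "good ?f \<Lambda> (complex_of_real l) \<epsilon>"
    unfolding good_def
  proof (intro ballI)
    fix x y assume xy: "x \<in> carrier G" "y \<in> carrier G"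
    have "Im (\<Lambda> (\<lambda>g. ?f (x \<otimes> g \<otimes> y))) = 0" by (rule avg_Im0[OF L]) simp
    then have "\<Lambda> (\<lambda>g. ?f (x \<otimes> g \<otimes> y)) = complex_of_real (Re (\<Lambda> (\<lambda>g. ?f (x \<otimes> g \<otimes> y))))"
      by (simp add: complex_eq_iff)
    then have "cmod (\<Lambda> (\<lambda>g. ?f (x \<otimes> g \<otimes> y)) - complex_of_real l) = \<bar>Re (\<Lambda> (\<lambda>g. ?f (x \<otimes> g \<otimes> y))) - l\<bar>"
      by (metis norm_of_real of_real_diff)
    then show "cmod (\<Lambda> (\<lambda>g. ?f (x \<otimes> g \<otimes> y)) - complex_of_real l) \<le> \<epsilon>"
      using R[OF xy] by auto
  qed
  then show ?thesis using L by blast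
qed

lemma good_cong: "avg \<Lambda> \<Longrightarrow> good f \<Lambda> c \<epsilon> \<Longrightarrow> (\<And>x. x \<in> carrier G \<Longrightarrow> f x = f' x) \<Longrightarrow> good f' \<Lambda> c \<epsilon>"
proof -
  assume *: "avg \<Lambda>" "good f \<Lambda> c \<epsilon>" "\<And>x. x \<in> carrier G \<Longrightarrow> f x = f' x"
  have "\<Lambda> (\<lambda>g. f (x \<otimes> g \<otimes> y)) = \<Lambda> (\<lambda>g. f' (x \<otimes> g \<otimes> y))" if "x \<in> carrier G" "y \<in> carrier G" for x y
    using that by (intro avg_cong[OF *(1)]) (simp add: *(3))
  then show ?thesis using *(2) by (simp add: good_def)
qed

lemma good_add:
  assumes "avg \<Lambda>" "good f \<Lambda> c \<epsilon>" "good h \<Lambda> d \<delta>"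
  shows "good (\<lambda>x. f x + h x) \<Lambda> (c + d) (\<epsilon> + \<delta>)"
  unfolding good_def
proof (intro ballI)
  fix x y assume xy: "x \<in> carrier G" "y \<in> carrier G"
  have "cmod (\<Lambda> (\<lambda>g. f (x \<otimes> g \<otimes> y)) - c) \<le> \<epsilon>" "cmod (\<Lambda> (\<lambda>g. h (x \<otimes> g \<otimes> y)) - d) \<le> \<delta>"
    using assms xy by (auto simp: good_def)
  from norm_triangle_mono[OF this]
  show "cmod (\<Lambda> (\<lambda>g. f (x \<otimes> g \<otimes> y) + h (x \<otimes> g \<otimes> y)) - (c + d)) \<le> \<epsilon> + \<delta>"
    unfolding avg_add[OF assms(1)] by (simp add: algebra_simps)
qed

lemma good_cmult:
  assumes "avg \<Lambda>" "good f \<Lambda> c \<epsilon>"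
  shows "good (\<lambda>x. d * f x) \<Lambda> (d * c) (cmod d * \<epsilon>)"
  using assms unfolding good_def
  by (simp add: avg_cmult[OF assms(1)] norm_mult mult_left_mono flip: right_diff_distrib)

lemma good_exists:
  assumes f: "ap f" and e: "\<epsilon> > 0"
  shows "\<exists>\<Lambda> c. avg \<Lambda> \<and> good f \<Lambda> c \<epsilon>"
proof -
  obtain \<Lambda>1 c1 where 1: "avg \<Lambda>1" "good (\<lambda>x. complex_of_real (Re (f x))) \<Lambda>1 c1 (\<epsilon>/2)"
    using good_Re[OF f, of "\<epsilon>/2"] e by auto
  obtain \<Lambda>2 c2 where 2: "avg \<Lambda>2" "good (\<lambda>x. complex_of_real (Re (- \<i> * f x))) \<Lambda>2 c2 (\<epsilon>/2)"
    using good_Re[OF ap_cmult[OF f], of "\<epsilon>/2" "-\<i>"] e by auto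
  have L: "avg (conv \<Lambda>1 \<Lambda>2)" using 1 2 avg_conv by blast
  have "good (\<lambda>x. complex_of_real (Re (f x)) + \<i> * complex_of_real (Re (- \<i> * f x))) (conv \<Lambda>1 \<Lambda>2)
     (c1 + \<i> * c2) (\<epsilon>/2 + cmod \<i> * (\<epsilon>/2))"
    using 1 2 by (intro good_add[OF L] good_cmult[OF L] good_conv1 good_conv2)
  then have "good f (conv \<Lambda>1 \<Lambda>2) (c1 + \<i> * c2) \<epsilon>"
    by (intro good_cong[OF L, of _ _ _ f]) (simp_all flip: complex_eq)
  then show ?thesis using L by blast
qed

lemma good_mono: "good f \<Lambda> c \<epsilon> \<Longrightarrow> cmod (c - d) + \<epsilon> \<le> \<delta> \<Longrightarrow> good f \<Lambda> d \<delta>"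
  unfolding good_def
proof (intro ballI)
  fix x y assume *: "\<forall>x\<in>carrier G. \<forall>y\<in>carrier G. cmod (\<Lambda> (\<lambda>g. f (x \<otimes> g \<otimes> y)) - c) \<le> \<epsilon>"
    "cmod (c - d) + \<epsilon> \<le> \<delta>" "x \<in> carrier G" "y \<in> carrier G"
  have "cmod (\<Lambda> (\<lambda>g. f (x \<otimes> g \<otimes> y)) - c) \<le> \<epsilon>" using * by blast
  then show "cmod (\<Lambda> (\<lambda>g. f (x \<otimes> g \<otimes> y)) - d) \<le> \<delta>"
    using *(2) norm_triangle_ineq[of "\<Lambda> (\<lambda>g. f (x \<otimes> g \<otimes> y)) - c" "c - d"] by simp
qed

text \<open>
  The mean of an almost periodic function. On a compact group it is the Haar integral; two-sided
  invariance is built into the two-sided flattening.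
\<close>

definition has_mean :: "('a \<Rightarrow> complex) \<Rightarrow> complex \<Rightarrow> bool" where
  "has_mean f c \<longleftrightarrow> (\<forall>\<epsilon>>0. \<exists>\<Lambda>. avg \<Lambda> \<and> good f \<Lambda> c \<epsilon>)"

definition mean :: "('a \<Rightarrow> complex) \<Rightarrow> complex" where "mean f = (THE c. has_mean f c)"

text \<open>
  Two averages that flatten \<open>f\<close> to different constants are compared through their convolution,
  which flattens \<open>f\<close> to both. This gives uniqueness of the mean and the Cauchy property that yields
  its existence.
\<close>

lemma has_mean_le:
  assumes "has_mean f c" "avg \<Lambda>" "good f \<Lambda> d \<delta>" shows "cmod (c - d) \<le> \<delta>"
proof (rule field_le_epsilon)
  fix e :: real assume "e > 0"
  then obtain \<Lambda>' where "avg \<Lambda>'" "good f \<Lambda>' c e" using assms(1) unfolding has_mean_def by blast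
  then show "cmod (c - d) \<le> \<delta> + e" using good_unique[OF _ assms(2) _ assms(3)] by fastforce
qed

lemma has_mean_unique: assumes "has_mean f c" "has_mean f d" shows "c = d"
proof -
  have "cmod (c - d) \<le> 0 + e" if "e > 0" for e
    using assms has_mean_le that unfolding has_mean_def by fastforce
  then have "cmod (c - d) \<le> 0" by (rule field_le_epsilon)
  then show ?thesis by simp
qed

lemma mean_eqI: "has_mean f c \<Longrightarrow> mean f = c"
  unfolding mean_def using has_mean_unique by blast

lemma has_mean: assumes f: "ap f" shows "has_mean f (mean f)"
proof -
  have "\<forall>n. \<exists>\<Lambda> c. avg \<Lambda> \<and> good f \<Lambda> c (1 / real (Suc n))" using good_exists[OF f] by simp
  then obtain \<Lambda> c where L: "\<And>n. avg (\<Lambda> n)" "\<And>n. good f (\<Lambda> n) (c n) (1 / real (Suc n))" by metis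
  have d: "cmod (c m - c n) \<le> 1 / real (Suc m) + 1 / real (Suc n)" for m n
    by (rule good_unique[OF L(1) L(1) L(2) L(2)])
  have "Cauchy c"
  proof (rule CauchyI)
    fix e :: real assume e: "e > 0"
    then obtain N where N: "1 / real (Suc N) < e / 2" using nat_approx_posE[of "e/2"] by auto
    have "cmod (c m - c n) < e" if "m \<ge> N" "n \<ge> N" for m n
    proof -
      have "1 / real (Suc m) \<le> 1 / real (Suc N)" "1 / real (Suc n) \<le> 1 / real (Suc N)"
        using that by (auto intro!: frac_le)
      then show ?thesis using d[of m n] N by linarith
    qed
    then show "\<exists>M. \<forall>m\<ge>M. \<forall>n\<ge>M. cmod (c m - c n) < e" by blast
  qed
  then obtain z where z: "c \<longlonglongrightarrow> z" using Cauchy_convergent convergent_def by blast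
  have "has_mean f z" unfolding has_mean_def
  proof (intro allI impI)
    fix e :: real assume e: "e > 0"
    then obtain N where N: "1 / real (Suc N) < e / 2" using nat_approx_posE[of "e/2"] by auto
    obtain M where M: "\<And>n. n \<ge> M \<Longrightarrow> cmod (c n - z) < e / 2"
      using z e unfolding LIMSEQ_iff by (meson half_gt_zero)
    define n where "n = max M N"
    have "1 / real (Suc n) \<le> 1 / real (Suc N)" by (auto simp: n_def intro!: frac_le)
    then have "good f (\<Lambda> n) z e" using M[of n] N by (intro good_mono[OF L(2)]) (auto simp: n_def)
    then show "\<exists>\<Lambda>. avg \<Lambda> \<and> good f \<Lambda> z e" using L(1) by blast
  qed
  then show ?thesis using mean_eqI by simp
qed

lemma mean_approx: assumes "ap f" "\<epsilon> > 0" obtains \<Lambda> where "avg \<Lambda>" "good f \<Lambda> (mean f) \<epsilon>"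
  using has_mean[OF assms(1)] assms(2) unfolding has_mean_def by blast

lemma mean_approx2: assumes "ap f" "ap h" "\<epsilon> > 0"
  obtains \<Lambda> where "avg \<Lambda>" "good f \<Lambda> (mean f) \<epsilon>" "good h \<Lambda> (mean h) \<epsilon>"
proof -
  obtain \<Lambda>1 where 1: "avg \<Lambda>1" "good f \<Lambda>1 (mean f) \<epsilon>" using mean_approx assms by blast
  obtain \<Lambda>2 where 2: "avg \<Lambda>2" "good h \<Lambda>2 (mean h) \<epsilon>" using mean_approx assms by blast
  show ?thesis
    by (rule that[OF avg_conv[OF 1(1) 2(1)] good_conv1[OF 1(1) 2(1) 1(2)] good_conv2[OF 1(1) 2(1) 2(2)]])
qed

lemma mean_cong: assumes "\<And>x. x \<in> carrier G \<Longrightarrow> f x = h x" shows "mean f = mean h"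
proof -
  have "has_mean f = has_mean h"
    unfolding has_mean_def using good_cong assms by (intro ext) metis
  then show ?thesis by (simp add: mean_def)
qed

lemma mean_const [simp]: "mean (\<lambda>_. c) = c"
  by (rule mean_eqI) (auto simp: has_mean_def good_def avg_const intro!: exI[of _ "\<lambda>f. f \<one>"] avg_point)

lemma mean_add: assumes "ap f" "ap h" shows "mean (\<lambda>x. f x + h x) = mean f + mean h"
proof (rule mean_eqI, unfold has_mean_def, intro allI impI)
  fix \<epsilon> :: real assume "\<epsilon> > 0"
  then obtain \<Lambda> where L: "avg \<Lambda>" "good f \<Lambda> (mean f) (\<epsilon>/2)" "good h \<Lambda> (mean h) (\<epsilon>/2)"
    using mean_approx2[OF assms, of "\<epsilon>/2"] by auto
  from good_add[OF this] L(1) show "\<exists>\<Lambda>. avg \<Lambda> \<and> good (\<lambda>x. f x + h x) \<Lambda> (mean f + mean h) \<epsilon>" by auto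
qed

lemma mean_cmult: assumes "ap f" shows "mean (\<lambda>x. c * f x) = c * mean f"
proof (rule mean_eqI, unfold has_mean_def, intro allI impI)
  fix \<epsilon> :: real assume e: "\<epsilon> > 0"
  have p: "cmod c + 1 > 0" by (smt (verit) norm_ge_zero)
  then have "\<epsilon> / (cmod c + 1) > 0" using e by simp
  then obtain \<Lambda> where L: "avg \<Lambda>" "good f \<Lambda> (mean f) (\<epsilon> / (cmod c + 1))"
    using mean_approx[OF assms] by blast
  have "cmod c * (\<epsilon> / (cmod c + 1)) \<le> (cmod c + 1) * (\<epsilon> / (cmod c + 1))"
    using e by (intro mult_right_mono) auto
  also have "\<dots> = \<epsilon>" using p by simp
  finally have "good (\<lambda>x. c * f x) \<Lambda> (c * mean f) \<epsilon>"
    by (intro good_mono[OF good_cmult[OF L]]) simp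
  then show "\<exists>\<Lambda>. avg \<Lambda> \<and> good (\<lambda>x. c * f x) \<Lambda> (c * mean f) \<epsilon>" using L by blast
qed

lemma mean_sum: "finite S \<Longrightarrow> (\<And>i. i \<in> S \<Longrightarrow> ap (F i)) \<Longrightarrow> mean (\<lambda>x. \<Sum>i\<in>S. F i x) = (\<Sum>i\<in>S. mean (F i))"
  by (induction S rule: finite_induct) (simp_all add: mean_add ap_sum)

lemma mean_cnj: assumes "ap f" shows "mean (\<lambda>x. cnj (f x)) = cnj (mean f)"
proof (rule mean_eqI, unfold has_mean_def, intro allI impI)
  fix \<epsilon> :: real assume e: "\<epsilon> > 0"
  then obtain \<Lambda> where L: "avg \<Lambda>" "good f \<Lambda> (mean f) \<epsilon>" using mean_approx[OF assms] by blast
  then have "good (\<lambda>x. cnj (f x)) \<Lambda> (cnj (mean f)) \<epsilon>"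
    unfolding good_def avg_cnj[OF L(1)] by (simp flip: complex_cnj_diff)
  then show "\<exists>\<Lambda>. avg \<Lambda> \<and> good (\<lambda>x. cnj (f x)) \<Lambda> (cnj (mean f)) \<epsilon>" using L by blast
qed

lemma mean_dist_le:
  assumes "ap f" "\<And>x. x \<in> carrier G \<Longrightarrow> cmod (f x - c) \<le> C" shows "cmod (mean f - c) \<le> C"
proof (rule has_mean_le[OF has_mean[OF assms(1)] avg_point[OF one_closed]])
  show "good f (\<lambda>f. f \<one>) c C" using assms(2) by (auto simp: good_def)
qed

lemma mean_le: "ap f \<Longrightarrow> (\<And>x. x \<in> carrier G \<Longrightarrow> cmod (f x) \<le> C) \<Longrightarrow> cmod (mean f) \<le> C"
  using mean_dist_le[of f 0 C] by simp

lemma mean_diff: assumes "ap f" "ap h" shows "mean (\<lambda>x. f x - h x) = mean f - mean h"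
  using mean_add[OF assms(1) ap_cmult[OF assms(2), of "-1"]] mean_cmult[OF assms(2), of "-1"] by simp

lemma ap_diff: assumes "ap f" "ap h" shows "ap (\<lambda>x. f x - h x)"
  using ap_add[OF assms(1) ap_cmult[OF assms(2), of "-1"]] by simp

lemma mean_diff_le:
  assumes "ap f" "ap h" "\<And>x. x \<in> carrier G \<Longrightarrow> cmod (f x - h x) \<le> C"
  shows "cmod (mean f - mean h) \<le> C"
  using mean_le[OF ap_diff[OF assms(1,2)] assms(3)] mean_diff[OF assms(1,2)] by simp

text \<open>
  Translating \<open>f\<close> only permutes the two-sided translates that a flattening average is tested on.
\<close>

lemma mean_translate:
  assumes "ap f" "u \<in> carrier G" "v \<in> carrier G" shows "mean (\<lambda>x. f (u \<otimes> x \<otimes> v)) = mean f"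
proof (rule mean_eqI, unfold has_mean_def, intro allI impI)
  fix \<epsilon> :: real assume e: "\<epsilon> > 0"
  then obtain \<Lambda> where L: "avg \<Lambda>" "good f \<Lambda> (mean f) \<epsilon>" using mean_approx[OF assms(1)] by blast
  have "good (\<lambda>x. f (u \<otimes> x \<otimes> v)) \<Lambda> (mean f) \<epsilon>" unfolding good_def
  proof (intro ballI)
    fix x y assume xy: "x \<in> carrier G" "y \<in> carrier G"
    have "\<Lambda> (\<lambda>g. f (u \<otimes> (x \<otimes> g \<otimes> y) \<otimes> v)) = \<Lambda> (\<lambda>g. f ((u \<otimes> x) \<otimes> g \<otimes> (y \<otimes> v)))"
      using xy assms by (intro avg_cong[OF L(1)]) (simp add: m_assoc)
    then show "cmod (\<Lambda> (\<lambda>g. f (u \<otimes> (x \<otimes> g \<otimes> y) \<otimes> v)) - mean f) \<le> \<epsilon>"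
      using L(2) xy assms by (simp add: good_def)
  qed
  then show "\<exists>\<Lambda>. avg \<Lambda> \<and> good (\<lambda>x. f (u \<otimes> x \<otimes> v)) \<Lambda> (mean f) \<epsilon>" using L by blast
qed

lemma mean_ltrans: assumes "ap f" "u \<in> carrier G" shows "mean (\<lambda>x. f (u \<otimes> x)) = mean f"
  using mean_translate[OF assms one_closed] mean_cong[of "\<lambda>x. f (u \<otimes> x \<otimes> \<one>)" "\<lambda>x. f (u \<otimes> x)"] assms by simp

lemma mean_inv: assumes "ap f" shows "mean (\<lambda>x. f (inv x)) = mean f"
proof (rule mean_eqI, unfold has_mean_def, intro allI impI)
  fix \<epsilon> :: real assume e: "\<epsilon> > 0"
  then obtain \<Lambda> where L: "avg \<Lambda>" "good f \<Lambda> (mean f) \<epsilon>" using mean_approx[OF assms(1)] by blast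
  define \<Lambda>' where "\<Lambda>' = (\<lambda>f. \<Lambda> (\<lambda>g. f (inv g)))"
  have L': "avg \<Lambda>'" unfolding \<Lambda>'_def by (rule avg_map[OF L(1)]) simp
  have "good (\<lambda>x. f (inv x)) \<Lambda>' (mean f) \<epsilon>" unfolding good_def
  proof (intro ballI)
    fix x y assume xy: "x \<in> carrier G" "y \<in> carrier G"
    have "\<Lambda>' (\<lambda>g. f (inv (x \<otimes> g \<otimes> y))) = \<Lambda> (\<lambda>g. f (inv y \<otimes> g \<otimes> inv x))"
      unfolding \<Lambda>'_def using xy by (intro avg_cong[OF L(1)]) (simp add: inv_triple)
    then show "cmod (\<Lambda>' (\<lambda>g. f (inv (x \<otimes> g \<otimes> y))) - mean f) \<le> \<epsilon>"
      using L(2) xy assms by (simp add: good_def)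
  qed
  then show "\<exists>\<Lambda>. avg \<Lambda> \<and> good (\<lambda>x. f (inv x)) \<Lambda> (mean f) \<epsilon>" using L' by blast
qed

lemma mean_Re_ge0: assumes "ap f" "\<And>x. x \<in> carrier G \<Longrightarrow> 0 \<le> Re (f x)" shows "0 \<le> Re (mean f)"
proof -
  have "0 \<le> Re (mean f) + e" if e: "e > 0" for e
  proof -
    obtain \<Lambda> where L: "avg \<Lambda>" "good f \<Lambda> (mean f) e" using mean_approx[OF assms(1) e] by blast
    let ?z = "\<Lambda> (\<lambda>g. f (\<one> \<otimes> g \<otimes> \<one>))"
    have "Re (- ?z) \<le> 0"
      using avg_Re_le[OF L(1), of "\<lambda>g. - 1 * f (\<one> \<otimes> g \<otimes> \<one>)" 0] assms(2) avg_cmult[OF L(1), of "-1"] by simp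
    moreover have "cmod (?z - mean f) \<le> e" using L(2) by (auto simp: good_def)
    ultimately show ?thesis using abs_Re_le_cmod[of "?z - mean f"] by simp
  qed
  then show ?thesis by (rule field_le_epsilon)
qed

lemma mean_Im0: assumes "ap f" "\<And>x. x \<in> carrier G \<Longrightarrow> Im (f x) = 0" shows "Im (mean f) = 0"
proof -
  have "mean (\<lambda>x. cnj (f x)) = mean f" using assms by (intro mean_cong) (simp add: complex_eq_iff)
  then show ?thesis using mean_cnj[OF assms(1)] by (simp add: complex_eq_iff)
qed

text \<open>
  Strict positivity: finitely many left translates of \<open>f\<close> add up to a function bounded below by a
  positive constant, and all of them have the same mean.
\<close>

lemma mean_Re_pos:
  assumes f: "ap f" "\<And>x. x \<in> carrier G \<Longrightarrow> 0 \<le> Re (f x)" and x0: "x0 \<in> carrier G" "Re (f x0) > 0"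
  shows "Re (mean f) > 0"
proof -
  define \<epsilon> where "\<epsilon> = Re (f x0) / 2"
  have e: "\<epsilon> > 0" using x0 by (simp add: \<epsilon>_def)
  obtain N where N: "finite N" "N \<subseteq> carrier G" "\<And>g. g \<in> carrier G \<Longrightarrow> \<exists>n\<in>N. near f \<epsilon> g n"
    using f(1)[unfolded ap_def, rule_format, OF e] by auto
  have apN: "ap (\<lambda>x. f (n \<otimes> x))" if "n \<in> N" for n using that N(2) by (intro ap_ltrans[OF f(1)]) auto
  define h where "h x = (\<Sum>n\<in>N. f (n \<otimes> x))" for x
  have aph: "ap h" unfolding h_def using ap_sum[OF N(1), of "\<lambda>n x. f (n \<otimes> x)"] apN by simp
  have "\<epsilon> \<le> Re (h x)" if x: "x \<in> carrier G" for x
  proof -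
    obtain n where n: "n \<in> N" "near f \<epsilon> (x0 \<otimes> inv x) n" using N(3)[OF m_closed[OF x0(1) inv_closed[OF x]]] by blast
    have nc: "n \<in> carrier G" using n N(2) by blast
    have "cmod (f (\<one> \<otimes> (x0 \<otimes> inv x) \<otimes> x) - f (\<one> \<otimes> n \<otimes> x)) \<le> \<epsilon>"
      by (rule nearD[OF n(2) one_closed x])
    moreover have "\<one> \<otimes> (x0 \<otimes> inv x) \<otimes> x = x0" using x x0 by (simp add: m_assoc)
    ultimately have "\<epsilon> \<le> Re (f (n \<otimes> x))"
      using abs_Re_le_cmod[of "f x0 - f (n \<otimes> x)"] nc by (simp add: \<epsilon>_def)
    also have "\<dots> \<le> (\<Sum>n\<in>N. Re (f (n \<otimes> x)))"
    proof (rule member_le_sum[OF n(1) _ N(1)])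
      fix m assume "m \<in> N - {n}"
      then show "0 \<le> Re (f (m \<otimes> x))" using N(2) x by (intro f(2)) auto
    qed
    finally show ?thesis by (simp add: h_def)
  qed
  then have "0 \<le> Re (mean (\<lambda>x. h x - of_real \<epsilon>))"
    by (intro mean_Re_ge0 ap_diff[OF aph ap_const]) simp
  also have "mean (\<lambda>x. h x - of_real \<epsilon>) = mean h - of_real \<epsilon>"
    using mean_diff[OF aph ap_const] by simp
  also have "mean h = (\<Sum>n\<in>N. mean (\<lambda>x. f (n \<otimes> x)))"
    unfolding h_def using mean_sum[OF N(1), of "\<lambda>n x. f (n \<otimes> x)"] apN by simp
  also have "\<dots> = (\<Sum>n\<in>N. mean f)"
    using N(2) by (intro sum.cong refl mean_ltrans[OF f(1)]) auto
  finally have "\<epsilon> \<le> real (card N) * Re (mean f)" by simp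
  then have "0 < real (card N) * Re (mean f)" using e by linarith
  then show ?thesis by (simp add: zero_less_mult_iff)
qed

end

section \<open>Means of families, the inner product, and invariant spaces\<close>

context Group.group
begin

lemma good_point: assumes "avg \<Lambda>" "good f \<Lambda> c \<epsilon>" shows "cmod (\<Lambda> f - c) \<le> \<epsilon>"
proof -
  have "\<Lambda> f = \<Lambda> (\<lambda>g. f (\<one> \<otimes> g \<otimes> \<one>))" by (rule avg_cong[OF assms(1)]) simp
  then show ?thesis using assms(2) by (simp add: good_def)
qed

lemma ap_limit:
  assumes "\<And>\<epsilon>. \<epsilon> > 0 \<Longrightarrow> \<exists>h. ap h \<and> (\<forall>x\<in>carrier G. cmod (f x - h x) \<le> \<epsilon>)"
  shows "ap f"
  unfolding ap_def
proof (intro allI impI)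
  fix \<epsilon> :: real assume e: "\<epsilon> > 0"
  then have e3: "\<epsilon> / 3 > 0" by simp
  from assms[OF e3] obtain h where h: "ap h" "\<And>x. x \<in> carrier G \<Longrightarrow> cmod (f x - h x) \<le> \<epsilon> / 3" by blast
  obtain N where N: "finite N" "N \<subseteq> carrier G" "\<And>g. g \<in> carrier G \<Longrightarrow> \<exists>n\<in>N. near h (\<epsilon>/3) g n"
    using h(1)[unfolded ap_def, rule_format, OF e3] by auto
  have "near f \<epsilon> g n" if "near h (\<epsilon>/3) g n" "g \<in> carrier G" "n \<in> carrier G" for g n
    unfolding near_def
  proof (intro ballI)
    fix u v assume uv: "u \<in> carrier G" "v \<in> carrier G"
    let ?x = "u \<otimes> g \<otimes> v" and ?y = "u \<otimes> n \<otimes> v"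
    have "cmod (f ?x - h ?x) \<le> \<epsilon> / 3" "cmod (f ?y - h ?y) \<le> \<epsilon> / 3" using h uv that by auto
    moreover have "cmod (h ?x - h ?y) \<le> \<epsilon> / 3" using that uv by (auto simp: near_def)
    moreover have "cmod (f ?x - f ?y) = cmod ((f ?x - h ?x) + (h ?x - h ?y) - (f ?y - h ?y))" by simp
    ultimately show "cmod (f ?x - f ?y) \<le> \<epsilon>"
      using norm_triangle_ineq4[of "(f ?x - h ?x) + (h ?x - h ?y)" "f ?y - h ?y"]
        norm_triangle_ineq[of "f ?x - h ?x" "h ?x - h ?y"] by linarith
  qed
  then have "\<exists>n\<in>N. near f \<epsilon> g n" if "g \<in> carrier G" for g
    using N(3)[OF that] N(2) that by blast
  then show "\<exists>N. finite N \<and> N \<subseteq> carrier G \<and> (\<forall>g\<in>carrier G. \<exists>n\<in>N. near f \<epsilon> g n)"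
    using N(1,2) by (intro exI[of _ N]) simp
qed

text \<open>
  Families of almost periodic functions that are totally bounded for the uniform norm: one average
  approximates all their means at once. This replaces integration under the integral sign and
  Fubini's theorem by computations with finite averages.
\<close>

definition apfam :: "'i set \<Rightarrow> ('i \<Rightarrow> 'a \<Rightarrow> complex) \<Rightarrow> bool" where
  "apfam S F \<longleftrightarrow> (\<forall>i\<in>S. ap (F i)) \<and>
     (\<forall>\<epsilon>>0. \<exists>N. finite N \<and> N \<subseteq> S \<and> (\<forall>i\<in>S. \<exists>n\<in>N. \<forall>g\<in>carrier G. cmod (F i g - F n g) \<le> \<epsilon>))"

lemma mean_approx_finite:
  assumes "finite N" "\<And>i. i \<in> N \<Longrightarrow> ap (F i)" "\<epsilon> > 0"
  shows "\<exists>\<Lambda>. avg \<Lambda> \<and> (\<forall>i\<in>N. good (F i) \<Lambda> (mean (F i)) \<epsilon>)"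
  using assms(1,2)
proof (induction N rule: finite_induct)
  case empty
  show ?case using avg_point[OF one_closed] by blast
next
  case (insert i N)
  then obtain \<Lambda>1 where 1: "avg \<Lambda>1" "\<And>j. j \<in> N \<Longrightarrow> good (F j) \<Lambda>1 (mean (F j)) \<epsilon>" by auto
  obtain \<Lambda>2 where 2: "avg \<Lambda>2" "good (F i) \<Lambda>2 (mean (F i)) \<epsilon>"
    using mean_approx[OF insert.prems assms(3)] by blast
  have "good (F j) (conv \<Lambda>1 \<Lambda>2) (mean (F j)) \<epsilon>" if "j \<in> insert i N" for j
    using that 1 2 good_conv1[OF 1(1) 2(1)] good_conv2[OF 1(1) 2(1)] by auto
  then show ?case using avg_conv[OF 1(1) 2(1)] by blast
qed

lemma mean_approx_family:
  assumes F: "apfam S F" and h: "ap h" and e: "\<epsilon> > 0"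
  obtains \<Lambda> where "avg \<Lambda>" "\<And>i. i \<in> S \<Longrightarrow> good (F i) \<Lambda> (mean (F i)) \<epsilon>" "good h \<Lambda> (mean h) \<epsilon>"
proof -
  have e3: "\<epsilon> / 3 > 0" using e by simp
  obtain N where N: "finite N" "N \<subseteq> S" "\<And>i. i \<in> S \<Longrightarrow> \<exists>n\<in>N. \<forall>g\<in>carrier G. cmod (F i g - F n g) \<le> \<epsilon> / 3"
    using F e3 unfolding apfam_def by (elim conjE allE[of _ "\<epsilon>/3"]) auto
  have ap: "ap (F i)" if "i \<in> S" for i using F that unfolding apfam_def by blast
  obtain \<Lambda>1 where 1: "avg \<Lambda>1" "\<And>i. i \<in> N \<Longrightarrow> good (F i) \<Lambda>1 (mean (F i)) (\<epsilon>/3)"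
  proof -
    have "\<exists>\<Lambda>. avg \<Lambda> \<and> (\<forall>i\<in>N. good (F i) \<Lambda> (mean (F i)) (\<epsilon>/3))"
      by (rule mean_approx_finite[OF N(1) _ e3]) (use ap N(2) in auto)
    then show ?thesis using that by blast
  qed
  have fam: "good (F i) \<Lambda>1 (mean (F i)) \<epsilon>" if i: "i \<in> S" for i
    unfolding good_def
  proof (intro ballI)
    fix x y assume xy: "x \<in> carrier G" "y \<in> carrier G"
    obtain n where n: "n \<in> N" "\<And>g. g \<in> carrier G \<Longrightarrow> cmod (F i g - F n g) \<le> \<epsilon> / 3" using N(3)[OF i] by blast
    have "cmod (\<Lambda>1 (\<lambda>g. F i (x \<otimes> g \<otimes> y)) - \<Lambda>1 (\<lambda>g. F n (x \<otimes> g \<otimes> y))) \<le> \<epsilon> / 3"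
      using xy n by (intro avg_diff_le[OF 1(1)]) simp
    moreover have "cmod (\<Lambda>1 (\<lambda>g. F n (x \<otimes> g \<otimes> y)) - mean (F n)) \<le> \<epsilon> / 3"
      using 1(2)[OF n(1)] xy by (simp add: good_def)
    moreover have "cmod (mean (F i) - mean (F n)) \<le> \<epsilon> / 3"
      using n N(2) i by (intro mean_diff_le ap) auto
    ultimately show "cmod (\<Lambda>1 (\<lambda>g. F i (x \<otimes> g \<otimes> y)) - mean (F i)) \<le> \<epsilon>"
      using norm_triangle_ineq4[of "\<Lambda>1 (\<lambda>g. F i (x \<otimes> g \<otimes> y)) - mean (F n)" "mean (F i) - mean (F n)"]
        norm_triangle_ineq[of "\<Lambda>1 (\<lambda>g. F i (x \<otimes> g \<otimes> y)) - \<Lambda>1 (\<lambda>g. F n (x \<otimes> g \<otimes> y))" "\<Lambda>1 (\<lambda>g. F n (x \<otimes> g \<otimes> y)) - mean (F n)"]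
      by simp
  qed
  obtain \<Lambda>2 where 2: "avg \<Lambda>2" "good h \<Lambda>2 (mean h) \<epsilon>" using mean_approx[OF h e] by blast
  show ?thesis
    by (rule that[OF avg_conv[OF 1(1) 2(1)] good_conv1[OF 1(1) 2(1) fam] good_conv2[OF 1(1) 2(1) 2(2)]])
qed

text \<open>
  The phase of \<open>mean f\<close> is rotated away, so that only positivity of the mean is needed.
\<close>

lemma mean_dominated:
  assumes f: "ap f" and h: "ap h" and le: "\<And>x. x \<in> carrier G \<Longrightarrow> cmod (f x) \<le> Re (h x)"
  shows "cmod (mean f) \<le> Re (mean h)"
proof -
  define u where "u = cnj (sgn (mean f))"
  have u: "cmod u \<le> 1" by (simp add: u_def norm_sgn)
  have "mean f * cnj (mean f) = complex_of_real ((cmod (mean f))\<^sup>2)" by (simp only: complex_norm_square)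
  then have um: "u * mean f = complex_of_real (cmod (mean f))"
    by (cases "mean f = 0") (auto simp: u_def sgn_eq power2_eq_square mult.commute)
  have "0 \<le> Re (mean (\<lambda>x. h x - u * f x))"
  proof (rule mean_Re_ge0)
    show "ap (\<lambda>x. h x - u * f x)" by (intro ap_diff ap_cmult f h)
    fix x assume x: "x \<in> carrier G"
    have "Re (u * f x) \<le> cmod u * cmod (f x)" by (metis complex_Re_le_cmod norm_mult)
    also have "\<dots> \<le> 1 * cmod (f x)" using u by (intro mult_right_mono) auto
    finally show "0 \<le> Re (h x - u * f x)" using le[OF x] by simp
  qed
  then show ?thesis using um by (simp add: mean_diff mean_cmult f h ap_cmult)
qed

definition ip :: "('a \<Rightarrow> complex) \<Rightarrow> ('a \<Rightarrow> complex) \<Rightarrow> complex" where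
  "ip f h = mean (\<lambda>x. f x * cnj (h x))"

definition l2 :: "('a \<Rightarrow> complex) \<Rightarrow> real" where "l2 f = sqrt (Re (ip f f))"

definition L :: "'a \<Rightarrow> ('a \<Rightarrow> complex) \<Rightarrow> 'a \<Rightarrow> complex" where "L g f = (\<lambda>x. f (inv g \<otimes> x))"

lemma ap_ip: "ap f \<Longrightarrow> ap h \<Longrightarrow> ap (\<lambda>x. f x * cnj (h x))"
  by (intro ap_mult ap_cnj)

lemma ap_L: "ap f \<Longrightarrow> g \<in> carrier G \<Longrightarrow> ap (L g f)"
  unfolding L_def by (intro ap_ltrans) auto

lemma ip_add: "ap f \<Longrightarrow> ap f' \<Longrightarrow> ap h \<Longrightarrow> ip (\<lambda>x. f x + f' x) h = ip f h + ip f' h"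
  unfolding ip_def by (simp add: distrib_right mean_add ap_ip)

lemma ip_cmult: "ap f \<Longrightarrow> ap h \<Longrightarrow> ip (\<lambda>x. c * f x) h = c * ip f h"
  unfolding ip_def by (simp add: mult.assoc mean_cmult ap_ip)

lemma ip_cnj: "ap f \<Longrightarrow> ap h \<Longrightarrow> ip h f = cnj (ip f h)"
  unfolding ip_def by (subst mean_cnj[symmetric]) (auto simp: ap_ip mult.commute)

lemma ip_diff: "ap f \<Longrightarrow> ap f' \<Longrightarrow> ap h \<Longrightarrow> ip (\<lambda>x. f x - f' x) h = ip f h - ip f' h"
  using ip_add[of f "\<lambda>x. (-1) * f' x" h] ip_cmult[of f' h "-1"] ap_cmult[of f' "-1"] by simp

lemma ip_sum: "finite S \<Longrightarrow> (\<And>i. i \<in> S \<Longrightarrow> ap (F i)) \<Longrightarrow> ap h \<Longrightarrow> ip (\<lambda>x. \<Sum>i\<in>S. F i x) h = (\<Sum>i\<in>S. ip (F i) h)"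
  unfolding ip_def by (simp add: sum_distrib_right mean_sum ap_ip)

lemma ip_cong: "(\<And>x. x \<in> carrier G \<Longrightarrow> f x = f' x) \<Longrightarrow> (\<And>x. x \<in> carrier G \<Longrightarrow> h x = h' x) \<Longrightarrow> ip f h = ip f' h'"
  unfolding ip_def by (rule mean_cong) simp

lemma ip_cmult_right: "ap f \<Longrightarrow> ap h \<Longrightarrow> ip f (\<lambda>x. c * h x) = cnj c * ip f h"
  by (subst (1 2) ip_cnj) (auto simp: ip_cmult ap_cmult)

lemma ip_diff_right: "ap f \<Longrightarrow> ap h \<Longrightarrow> ap h' \<Longrightarrow> ip f (\<lambda>x. h x - h' x) = ip f h - ip f h'"
  by (subst (1 2 3) ip_cnj) (auto simp: ip_diff ap_diff)

lemma ip_sum_right: "finite S \<Longrightarrow> (\<And>i. i \<in> S \<Longrightarrow> ap (F i)) \<Longrightarrow> ap h \<Longrightarrow> ip h (\<lambda>x. \<Sum>i\<in>S. F i x) = (\<Sum>i\<in>S. ip h (F i))"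
  unfolding ip_def by (simp add: sum_distrib_left mean_sum ap_ip)

lemma ip_L: "ap f \<Longrightarrow> ap h \<Longrightarrow> g \<in> carrier G \<Longrightarrow> ip (L g f) (L g h) = ip f h"
  unfolding ip_def L_def using mean_ltrans[OF ap_ip, of f h "inv g"] by simp

lemma Re_ip_ge0: "ap f \<Longrightarrow> 0 \<le> Re (ip f f)"
  unfolding ip_def by (rule mean_Re_ge0) (auto simp: ap_ip)

lemma ip_self: assumes "ap f" shows "ip f f = complex_of_real ((l2 f)\<^sup>2)"
proof -
  have "Im (ip f f) = 0" unfolding ip_def by (rule mean_Im0) (auto simp: ap_ip assms)
  then show ?thesis using Re_ip_ge0[OF assms] by (simp add: l2_def complex_eq_iff)
qed

lemma l2_ge0: "ap f \<Longrightarrow> l2 f \<ge> 0"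
  by (simp add: l2_def Re_ip_ge0)

lemma l2_zeroD:
  assumes "ap f" "l2 f = 0" "x \<in> carrier G" shows "f x = 0"
proof (rule ccontr)
  assume "f x \<noteq> 0"
  then have "Re (f x * cnj (f x)) > 0" by (simp add: sum_power2_gt_zero_iff complex_eq_iff power2_eq_square[symmetric])
  then have "Re (mean (\<lambda>x. f x * cnj (f x))) > 0"
    by (intro mean_Re_pos[OF ap_ip[OF assms(1,1)] _ assms(3)]) simp_all
  then show False using assms(2) by (simp add: l2_def ip_def)
qed

lemma mult_cnj_cmod: "z * cnj z = (complex_of_real (cmod z))\<^sup>2"
  by (metis complex_norm_square of_real_power)

lemma Cauchy_Schwarz: assumes f: "ap f" and h: "ap h" shows "cmod (ip f h) \<le> l2 f * l2 h"
proof (cases "l2 h = 0")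
  case True
  have "ip f h = ip f (\<lambda>_. 0)" using l2_zeroD[OF h True] by (intro ip_cong) auto
  also have "\<dots> = 0" by (simp add: ip_def)
  finally show ?thesis using True by simp
next
  case False
  then have p: "l2 h > 0" using l2_ge0[OF h] by simp
  define c where "c = ip f h / (l2 h)\<^sup>2"
  define q where "q = (\<lambda>x. f x - c * h x)"
  have q: "ap q" unfolding q_def by (intro ap_diff ap_cmult f h)
  have ch: "ap (\<lambda>x. c * h x)" by (intro ap_cmult h)
  have "c * complex_of_real ((l2 h)\<^sup>2) = ip f h" using p by (simp add: c_def)
  then have "ip q h = 0"
    unfolding q_def using ip_diff[OF f ch h] ip_cmult[OF h h, of c] ip_self[OF h] by simp
  then have "ip q q = ip q f"
    unfolding q_def using f h ch q by (simp add: ip_diff_right ip_cmult_right q_def)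
  also have "\<dots> = ip f f - c * ip h f" unfolding q_def using f h ch by (simp add: ip_diff ip_cmult)
  also have "\<dots> = of_real ((l2 f)\<^sup>2 - (cmod (ip f h))\<^sup>2 / (l2 h)\<^sup>2)"
    unfolding ip_self[OF f] ip_cnj[OF f h] c_def by (simp add: mult_cnj_cmod)
  finally have "0 \<le> (l2 f)\<^sup>2 - (cmod (ip f h))\<^sup>2 / (l2 h)\<^sup>2" using Re_ip_ge0[OF q] by simp
  then have "(cmod (ip f h))\<^sup>2 / (l2 h)\<^sup>2 \<le> (l2 f)\<^sup>2" by simp
  then have "(cmod (ip f h))\<^sup>2 \<le> (l2 f * l2 h)\<^sup>2" using p by (simp add: pos_divide_le_eq power_mult_distrib)
  then show ?thesis by (rule power2_le_imp_le) (intro mult_nonneg_nonneg l2_ge0 f h)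
qed

lemma l2_le: assumes "ap f" "\<And>x. x \<in> carrier G \<Longrightarrow> cmod (f x) \<le> C" shows "l2 f \<le> C"
proof -
  have C: "0 \<le> C" by (rule order_trans[OF norm_ge_zero assms(2)[OF one_closed]])
  have "cmod (ip f f) \<le> C\<^sup>2" unfolding ip_def
  proof (rule mean_le)
    show "ap (\<lambda>x. f x * cnj (f x))" using assms by (simp add: ap_ip)
    fix x assume "x \<in> carrier G"
    then show "cmod (f x * cnj (f x)) \<le> C\<^sup>2"
      using assms(2) C by (simp add: norm_mult power2_eq_square mult_mono)
  qed
  then have "(l2 f)\<^sup>2 \<le> C\<^sup>2" unfolding ip_self[OF assms(1)] by (simp add: norm_power)
  then show ?thesis using C by (rule power2_le_imp_le)
qed

lemma l2_cmult: "ap f \<Longrightarrow> l2 (\<lambda>x. c * f x) = cmod c * l2 f"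
proof -
  assume f: "ap f"
  have "ip (\<lambda>x. c * f x) (\<lambda>x. c * f x) = of_real ((cmod c * l2 f)\<^sup>2)"
    using f by (simp add: ip_cmult ip_cmult_right ap_cmult ip_self mult_cnj_cmod power_mult_distrib)
  then show ?thesis using l2_ge0[OF f] by (simp add: l2_def)
qed

text \<open>
  Spaces are closed under changing functions off the carrier, so that equality of such spaces is
  meaningful although only values on the carrier matter.
\<close>

definition inv_space :: "('a \<Rightarrow> complex) set \<Rightarrow> bool" where
  "inv_space A \<longleftrightarrow> (\<forall>f\<in>A. ap f) \<and> (\<lambda>_. 0) \<in> A \<and> (\<forall>f\<in>A. \<forall>h\<in>A. (\<lambda>x. f x + h x) \<in> A) \<and>
     (\<forall>c. \<forall>f\<in>A. (\<lambda>x. c * f x) \<in> A) \<and> (\<forall>g\<in>carrier G. \<forall>f\<in>A. L g f \<in> A) \<and>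
     (\<forall>f\<in>A. \<forall>f'. (\<forall>x\<in>carrier G. f' x = f x) \<longrightarrow> f' \<in> A)"

definition uclosed :: "('a \<Rightarrow> complex) set \<Rightarrow> bool" where
  "uclosed A \<longleftrightarrow> (\<forall>f. (\<forall>\<epsilon>>0. \<exists>h\<in>A. \<forall>x\<in>carrier G. cmod (f x - h x) \<le> \<epsilon>) \<longrightarrow> f \<in> A)"

lemma inv_spaceD:
  assumes "inv_space A"
  shows inv_space_ap: "f \<in> A \<Longrightarrow> ap f"
    and inv_space_0: "(\<lambda>_. 0) \<in> A"
    and inv_space_add: "f \<in> A \<Longrightarrow> h \<in> A \<Longrightarrow> (\<lambda>x. f x + h x) \<in> A"
    and inv_space_cmult: "f \<in> A \<Longrightarrow> (\<lambda>x. c * f x) \<in> A"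
    and inv_space_L: "f \<in> A \<Longrightarrow> g \<in> carrier G \<Longrightarrow> L g f \<in> A"
    and inv_space_cong: "f \<in> A \<Longrightarrow> (\<And>x. x \<in> carrier G \<Longrightarrow> f' x = f x) \<Longrightarrow> f' \<in> A"
  using assms unfolding inv_space_def by blast+

lemma inv_space_diff: "inv_space A \<Longrightarrow> f \<in> A \<Longrightarrow> h \<in> A \<Longrightarrow> (\<lambda>x. f x - h x) \<in> A"
  using inv_space_add[of A f "\<lambda>x. (-1) * h x"] inv_space_cmult[of A h "-1"] by simp

lemma inv_space_sum:
  assumes "inv_space A" shows "finite S \<Longrightarrow> (\<And>i. i \<in> S \<Longrightarrow> F i \<in> A) \<Longrightarrow> (\<lambda>x. \<Sum>i\<in>S. F i x) \<in> A"
  by (induction S rule: finite_induct) (simp_all add: inv_spaceD[OF assms])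

lemma uclosedD: "uclosed A \<Longrightarrow> (\<And>\<epsilon>. \<epsilon> > 0 \<Longrightarrow> \<exists>h\<in>A. \<forall>x\<in>carrier G. cmod (f x - h x) \<le> \<epsilon>) \<Longrightarrow> f \<in> A"
  unfolding uclosed_def by blast

lemma inv_space_AP: "inv_space {f. ap f}"
  unfolding inv_space_def by (auto simp: ap_L intro: ap_add ap_cmult ap_cong)

lemma uclosed_AP: "uclosed {f. ap f}"
  unfolding uclosed_def by (auto intro!: ap_limit)

section \<open>Convolution with central kernels\<close>

definition cv :: "('a \<Rightarrow> complex) \<Rightarrow> ('a \<Rightarrow> complex) \<Rightarrow> 'a \<Rightarrow> complex" where
  "cv k f x = mean (\<lambda>g. k g * f (inv g \<otimes> x))"

lemma ap_cv_integrand: assumes "ap k" "ap f" "x \<in> carrier G" shows "ap (\<lambda>g. k g * f (inv g \<otimes> x))"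
  using ap_inv[OF ap_rtrans[OF assms(2,3)]] by (intro ap_mult assms)

lemma apfam_cv: assumes k: "ap k" and f: "ap f" shows "apfam (carrier G) (\<lambda>x g. k g * f (inv g \<otimes> x))"
  unfolding apfam_def
proof (intro conjI ballI allI impI)
  fix x assume "x \<in> carrier G"
  then show "ap (\<lambda>g. k g * f (inv g \<otimes> x))" by (rule ap_cv_integrand[OF k f])
next
  fix \<epsilon> :: real assume e: "\<epsilon> > 0"
  obtain C where C: "C > 0" "\<And>g. g \<in> carrier G \<Longrightarrow> cmod (k g) \<le> C" using ap_bounded[OF k] by blast
  have eC: "\<epsilon> / C > 0" using e C by simp
  obtain N where N: "finite N" "N \<subseteq> carrier G" "\<And>g. g \<in> carrier G \<Longrightarrow> \<exists>n\<in>N. near f (\<epsilon>/C) g n"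
    using f[unfolded ap_def, rule_format, OF eC] by auto
  have *: "\<forall>g\<in>carrier G. cmod (k g * f (inv g \<otimes> x) - k g * f (inv g \<otimes> n)) \<le> \<epsilon>"
    if x: "x \<in> carrier G" and n: "n \<in> carrier G" "near f (\<epsilon>/C) x n" for x n
  proof
    fix g assume g: "g \<in> carrier G"
    have "cmod (f (inv g \<otimes> x \<otimes> \<one>) - f (inv g \<otimes> n \<otimes> \<one>)) \<le> \<epsilon> / C"
      using g by (intro nearD[OF n(2)]) auto
    then have "cmod (f (inv g \<otimes> x) - f (inv g \<otimes> n)) \<le> \<epsilon> / C" using g x n by simp
    then have "cmod (k g) * cmod (f (inv g \<otimes> x) - f (inv g \<otimes> n)) \<le> C * (\<epsilon> / C)"
      using C g by (intro mult_mono) auto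
    then show "cmod (k g * f (inv g \<otimes> x) - k g * f (inv g \<otimes> n)) \<le> \<epsilon>"
      using C by (simp flip: right_diff_distrib add: norm_mult)
  qed
  have "\<exists>n\<in>N. \<forall>g\<in>carrier G. cmod (k g * f (inv g \<otimes> x) - k g * f (inv g \<otimes> n)) \<le> \<epsilon>"
    if x: "x \<in> carrier G" for x
    using N(3)[OF x] N(2) *[OF x] by blast
  then show "\<exists>N. finite N \<and> N \<subseteq> carrier G \<and>
      (\<forall>x\<in>carrier G. \<exists>n\<in>N. \<forall>g\<in>carrier G. cmod (k g * f (inv g \<otimes> x) - k g * f (inv g \<otimes> n)) \<le> \<epsilon>)"
    using N(1,2) by (intro exI[of _ N]) simp
qed

text \<open>
  Since an invariant space is stable under weighted finite averages of left translates, passing to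
  the uniform limit makes a uniformly closed one stable under convolution.
\<close>

lemma avg_in:
  assumes "avg \<Lambda>" and A: "inv_space A" "f \<in> A"
  shows "(\<lambda>x. \<Lambda> (\<lambda>g. k g * f (inv g \<otimes> x))) \<in> A"
  using assms(1)
proof (induction rule: avg.induct)
  case (avg_point g)
  then show ?case using inv_space_cmult[OF A(1) inv_space_L[OF A avg_point], of "k g"] by (simp add: L_def)
next
  case (avg_mix \<Lambda>1 \<Lambda>2 t)
  then show ?case by (intro inv_space_add[OF A(1)] inv_space_cmult[OF A(1)])
qed

lemma cv_in:
  assumes A: "inv_space A" "uclosed A" and f: "f \<in> A" and k: "ap k" shows "cv k f \<in> A"
proof (rule uclosedD[OF A(2)])
  fix \<epsilon> :: real assume e: "\<epsilon> > 0"
  obtain \<Lambda> where L: "avg \<Lambda>"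
    "\<And>x. x \<in> carrier G \<Longrightarrow> good (\<lambda>g. k g * f (inv g \<otimes> x)) \<Lambda> (mean (\<lambda>g. k g * f (inv g \<otimes> x))) \<epsilon>"
    using mean_approx_family[OF apfam_cv[OF k inv_space_ap[OF A(1) f]] k e] by blast
  show "\<exists>h\<in>A. \<forall>x\<in>carrier G. cmod (cv k f x - h x) \<le> \<epsilon>"
    using good_point[OF L(1) L(2)]
    by (intro bexI[OF _ avg_in[OF L(1) A(1) f, of k]]) (simp add: cv_def norm_minus_commute)
qed

lemma ap_cv: "ap k \<Longrightarrow> ap f \<Longrightarrow> ap (cv k f)"
  using cv_in[OF inv_space_AP uclosed_AP] by blast

lemma cv_add: "ap k \<Longrightarrow> ap f \<Longrightarrow> ap h \<Longrightarrow> x \<in> carrier G \<Longrightarrow> cv k (\<lambda>x. f x + h x) x = cv k f x + cv k h x"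
  unfolding cv_def by (simp add: distrib_left mean_add ap_cv_integrand)

lemma cv_cmult: "ap k \<Longrightarrow> ap f \<Longrightarrow> x \<in> carrier G \<Longrightarrow> cv k (\<lambda>x. c * f x) x = c * cv k f x"
  unfolding cv_def using mean_cmult[OF ap_cv_integrand, of k f x c] by (simp add: mult.left_commute)

lemma cv_diff: "ap k \<Longrightarrow> ap f \<Longrightarrow> ap h \<Longrightarrow> x \<in> carrier G \<Longrightarrow> cv k (\<lambda>x. f x - h x) x = cv k f x - cv k h x"
  unfolding cv_def by (simp add: right_diff_distrib mean_diff ap_cv_integrand)

lemma cv_sum: "finite S \<Longrightarrow> (\<And>i. i \<in> S \<Longrightarrow> ap (F i)) \<Longrightarrow> ap k \<Longrightarrow> x \<in> carrier G \<Longrightarrow>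
   cv k (\<lambda>x. \<Sum>i\<in>S. F i x) x = (\<Sum>i\<in>S. cv k (F i) x)"
  unfolding cv_def by (simp add: sum_distrib_left mean_sum ap_cv_integrand)

lemma cv_cong: "(\<And>x. x \<in> carrier G \<Longrightarrow> f x = f' x) \<Longrightarrow> x \<in> carrier G \<Longrightarrow> cv k f x = cv k f' x"
  unfolding cv_def by (rule mean_cong) simp

text \<open>
  Positivity and mean \<open>1\<close> make convolution an averaging operator, symmetry makes it self-adjoint,
  and being a class function makes it commute with left translations.
\<close>

definition conv_kernel :: "('a \<Rightarrow> complex) \<Rightarrow> bool" where
  "conv_kernel k \<longleftrightarrow> ap k \<and> (\<forall>x\<in>carrier G. k x = complex_of_real (Re (k x)) \<and> 0 \<le> Re (k x)) \<and>
     (\<forall>x\<in>carrier G. k (inv x) = k x) \<and> (\<forall>u\<in>carrier G. \<forall>x\<in>carrier G. k (u \<otimes> x \<otimes> inv u) = k x) \<and> mean k = 1"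

lemma kernelD: assumes "conv_kernel k"
  shows kernel_ap: "ap k" and kernel_real: "x \<in> carrier G \<Longrightarrow> k x = complex_of_real (Re (k x))"
    and kernel_ge0: "x \<in> carrier G \<Longrightarrow> 0 \<le> Re (k x)"
    and kernel_inv: "x \<in> carrier G \<Longrightarrow> k (inv x) = k x"
    and kernel_class: "u \<in> carrier G \<Longrightarrow> x \<in> carrier G \<Longrightarrow> k (u \<otimes> x \<otimes> inv u) = k x"
    and kernel_mean: "mean k = 1"
  using assms unfolding conv_kernel_def by blast+

lemma kernel_cmod: "conv_kernel k \<Longrightarrow> x \<in> carrier G \<Longrightarrow> cmod (k x) = Re (k x)"
  using kernel_real kernel_ge0 by (metis abs_of_nonneg norm_of_real)

lemma kernel_cnj: "conv_kernel k \<Longrightarrow> x \<in> carrier G \<Longrightarrow> cnj (k x) = k x"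
  using kernel_real by (metis complex_cnj_complex_of_real)

lemma cv_L:
  assumes k: "conv_kernel k" and f: "ap f" and h: "h \<in> carrier G" and x: "x \<in> carrier G"
  shows "cv k (L h f) x = L h (cv k f) x"
proof -
  define \<phi> where "\<phi> = (\<lambda>g. k g * f (inv g \<otimes> (inv h \<otimes> x)))"
  have "ap \<phi>" unfolding \<phi>_def using h x by (intro ap_cv_integrand kernel_ap[OF k] f) auto
  then have "mean (\<lambda>g. \<phi> (inv h \<otimes> g \<otimes> h)) = mean \<phi>" using h by (intro mean_translate) auto
  moreover have "mean (\<lambda>g. \<phi> (inv h \<otimes> g \<otimes> h)) = cv k (L h f) x"
    unfolding cv_def
  proof (rule mean_cong)
    fix g assume g: "g \<in> carrier G"
    have "k (inv h \<otimes> g \<otimes> h) = k g" using kernel_class[OF k, of "inv h" g] g h by simp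
    moreover have "inv (inv h \<otimes> g \<otimes> h) \<otimes> (inv h \<otimes> x) = inv h \<otimes> (inv g \<otimes> x)"
    proof -
      have "inv (inv h \<otimes> g \<otimes> h) = inv h \<otimes> inv g \<otimes> h" using g h by (simp add: inv_triple)
      then show ?thesis using g h x by (simp add: m_assoc inv_cancel)
    qed
    ultimately show "\<phi> (inv h \<otimes> g \<otimes> h) = k g * L h f (inv g \<otimes> x)" by (simp add: \<phi>_def L_def)
  qed
  ultimately show ?thesis by (simp add: L_def cv_def \<phi>_def)
qed

text \<open>
  The substitution \<open>g \<mapsto> x g\<^sup>-\<^sup>1\<close> moves the dependence on \<open>x\<close> to the kernel. Together with the
  Cauchy-Schwarz inequality it shows that convolution maps the unit ball of the mean square norm to
  a uniformly bounded and uniformly equicontinuous set.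
\<close>

lemma cv_alt:
  assumes k: "ap k" and f: "ap f" and x: "x \<in> carrier G"
  shows "cv k f x = mean (\<lambda>g. k (x \<otimes> inv g) * f g)"
proof -
  define \<phi> where "\<phi> = (\<lambda>g. k g * f (inv g \<otimes> x))"
  have a: "ap \<phi>" unfolding \<phi>_def by (rule ap_cv_integrand[OF assms])
  have "mean \<phi> = mean (\<lambda>g. \<phi> (x \<otimes> inv g))"
    using mean_inv[OF ap_ltrans[OF a x]] mean_ltrans[OF a x] by simp
  also have "\<dots> = mean (\<lambda>g. k (x \<otimes> inv g) * f g)"
    using x by (intro mean_cong) (simp add: \<phi>_def inv_mult_group m_assoc)
  finally show ?thesis by (simp add: cv_def \<phi>_def)
qed

lemma cv_sup_le:
  assumes k: "ap k" and f: "ap f" and C: "\<And>g. g \<in> carrier G \<Longrightarrow> cmod (k g) \<le> C" and x: "x \<in> carrier G"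
  shows "cmod (cv k f x) \<le> C * l2 f"
proof -
  have C': "ap (\<lambda>g. k (x \<otimes> inv g))" using ap_inv[OF ap_ltrans[OF k x]] .
  have "cv k f x = ip (\<lambda>g. k (x \<otimes> inv g)) (\<lambda>g. cnj (f g))"
    unfolding cv_alt[OF k f x] ip_def by simp
  then have "cmod (cv k f x) \<le> l2 (\<lambda>g. k (x \<otimes> inv g)) * l2 (\<lambda>g. cnj (f g))"
    using Cauchy_Schwarz[OF C' ap_cnj[OF f]] by simp
  also have "l2 (\<lambda>g. cnj (f g)) = l2 f" by (simp add: l2_def ip_def mult.commute)
  also have "l2 (\<lambda>g. k (x \<otimes> inv g)) * l2 f \<le> C * l2 f"
    using x C l2_ge0[OF f] by (intro mult_right_mono l2_le C') auto
  finally show ?thesis .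
qed

lemma cv_equi:
  assumes k: "ap k" and f: "ap f" and n: "near k \<epsilon> x y" and x: "x \<in> carrier G" "y \<in> carrier G"
  shows "cmod (cv k f x - cv k f y) \<le> \<epsilon> * l2 f"
proof -
  let ?d = "\<lambda>g. k (x \<otimes> inv g) - k (y \<otimes> inv g)"
  have a: "ap (\<lambda>g. k (x \<otimes> inv g))" "ap (\<lambda>g. k (y \<otimes> inv g))"
    using ap_inv[OF ap_ltrans[OF k]] x by auto
  have d: "ap ?d" by (intro ap_diff a)
  have "cv k f x - cv k f y = mean (\<lambda>g. k (x \<otimes> inv g) * f g - k (y \<otimes> inv g) * f g)"
    using x by (simp add: cv_alt[OF k f] mean_diff ap_mult a f)
  also have "\<dots> = ip ?d (\<lambda>g. cnj (f g))" unfolding ip_def by (simp add: left_diff_distrib)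
  finally have "cmod (cv k f x - cv k f y) \<le> l2 ?d * l2 (\<lambda>g. cnj (f g))"
    using Cauchy_Schwarz[OF d ap_cnj[OF f]] by simp
  also have "l2 (\<lambda>g. cnj (f g)) = l2 f" by (simp add: l2_def ip_def mult.commute)
  also have "l2 ?d \<le> \<epsilon>"
  proof (rule l2_le[OF d])
    fix g assume g: "g \<in> carrier G"
    have "cmod (k (\<one> \<otimes> x \<otimes> inv g) - k (\<one> \<otimes> y \<otimes> inv g)) \<le> \<epsilon>" using g by (intro nearD[OF n]) auto
    then show "cmod (?d g) \<le> \<epsilon>" using x g by simp
  qed
  finally show ?thesis using l2_ge0[OF f] by (simp add: mult_right_mono)
qed

lemma ap_matrix_coeff: assumes f: "ap f" and h: "ap h" shows "ap (\<lambda>g. ip (L g f) h)"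
proof (rule ap_of_near[OF ap_inv[OF f] ap_inv[OF f]])
  fix \<epsilon> :: real assume e: "\<epsilon> > 0"
  obtain C where C: "C > 0" "\<And>g. g \<in> carrier G \<Longrightarrow> cmod (h g) \<le> C" using ap_bounded[OF h] by blast
  have "near (\<lambda>g. ip (L g f) h) \<epsilon> g n" if g: "g \<in> carrier G" and n: "n \<in> carrier G"
    and nr: "near (\<lambda>x. f (inv x)) (\<epsilon>/C) g n" for g n
    unfolding near_def
  proof (intro ballI)
    fix u v assume uv: "u \<in> carrier G" "v \<in> carrier G"
    have c: "u \<otimes> g \<otimes> v \<in> carrier G" "u \<otimes> n \<otimes> v \<in> carrier G" using g n uv by auto
    show "cmod (ip (L (u \<otimes> g \<otimes> v) f) h - ip (L (u \<otimes> n \<otimes> v) f) h) \<le> \<epsilon>"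
      unfolding ip_def
    proof (rule mean_diff_le)
      fix x assume x: "x \<in> carrier G"
      have "cmod (f (inv (inv x \<otimes> u \<otimes> g \<otimes> v)) - f (inv (inv x \<otimes> u \<otimes> n \<otimes> v))) \<le> \<epsilon> / C"
        using nearD[OF nr, of "inv x \<otimes> u" v] x uv by simp
      moreover have "inv (inv x \<otimes> u \<otimes> y \<otimes> v) = inv (u \<otimes> y \<otimes> v) \<otimes> x" if "y \<in> carrier G" for y
        using x uv that by (simp add: inv_mult_group m_assoc)
      ultimately have "cmod (L (u \<otimes> g \<otimes> v) f x - L (u \<otimes> n \<otimes> v) f x) \<le> \<epsilon> / C"
        using g n by (simp add: L_def)
      then have "cmod (L (u \<otimes> g \<otimes> v) f x - L (u \<otimes> n \<otimes> v) f x) * cmod (h x) \<le> \<epsilon> / C * C"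
        using C x e by (intro mult_mono) auto
      then show "cmod (L (u \<otimes> g \<otimes> v) f x * cnj (h x) - L (u \<otimes> n \<otimes> v) f x * cnj (h x)) \<le> \<epsilon>"
        using C by (simp flip: left_diff_distrib add: norm_mult)
    qed (intro ap_ip ap_L f h c)+
  qed
  then show "\<exists>\<delta>>0. \<forall>g\<in>carrier G. \<forall>n\<in>carrier G. near (\<lambda>x. f (inv x)) \<delta> g n \<longrightarrow>
     near (\<lambda>x. f (inv x)) \<delta> g n \<longrightarrow> near (\<lambda>g. ip (L g f) h) \<epsilon> g n"
    using e C by (intro exI[of _ "\<epsilon>/C"]) auto
qed

text \<open>
  An instance of Fubini's theorem: the average that approximates the convolution uniformly in \<open>x\<close>
  commutes with the mean in \<open>x\<close> by linearity.
\<close>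

lemma ip_cv:
  assumes k: "ap k" and f: "ap f" and h: "ap h"
  shows "ip (cv k f) h = mean (\<lambda>g. k g * ip (L g f) h)"
proof -
  let ?\<phi> = "\<lambda>g. k g * ip (L g f) h"
  have ph: "ap ?\<phi>" by (intro ap_mult k ap_matrix_coeff f h)
  obtain C where C: "C > 0" "\<And>g. g \<in> carrier G \<Longrightarrow> cmod (h g) \<le> C" using ap_bounded[OF h] by blast
  have "cmod (ip (cv k f) h - mean ?\<phi>) \<le> 0 + e" if e: "e > 0" for e
  proof -
    define \<epsilon> where "\<epsilon> = e / (C + 1)"
    have "\<epsilon> > 0" "(C + 1) * \<epsilon> = e" using C(1) e by (simp_all add: \<epsilon>_def)
    then have ep: "\<epsilon> > 0" "C * \<epsilon> + \<epsilon> = e" by (simp_all add: distrib_right)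
    obtain \<Lambda> where L: "avg \<Lambda>"
      "\<And>x. x \<in> carrier G \<Longrightarrow> good (\<lambda>g. k g * f (inv g \<otimes> x)) \<Lambda> (mean (\<lambda>g. k g * f (inv g \<otimes> x))) \<epsilon>"
      "good ?\<phi> \<Lambda> (mean ?\<phi>) \<epsilon>"
      using mean_approx_family[OF apfam_cv[OF k f] ph ep(1)] by blast
    define q where "q = (\<lambda>x. \<Lambda> (\<lambda>g. k g * f (inv g \<otimes> x)))"
    have q: "ap q" unfolding q_def using avg_in[OF L(1) inv_space_AP] f by simp
    have 1: "cmod (ip (cv k f) h - ip q h) \<le> C * \<epsilon>"
      unfolding ip_def
    proof (rule mean_diff_le)
      fix x assume x: "x \<in> carrier G"
      have "cmod (cv k f x - q x) \<le> \<epsilon>"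
        using good_point[OF L(1) L(2)[OF x]] by (simp add: cv_def q_def norm_minus_commute)
      then have "cmod (cv k f x - q x) * cmod (h x) \<le> \<epsilon> * C" using C x ep(1) by (intro mult_mono) auto
      then show "cmod (cv k f x * cnj (h x) - q x * cnj (h x)) \<le> C * \<epsilon>"
        by (simp flip: left_diff_distrib add: norm_mult mult.commute[of C])
    qed (intro ap_ip ap_cv k f h q)+
    have "ip q h = \<Lambda> ?\<phi>"
      unfolding q_def using L(1)
    proof (induction rule: avg.induct)
      case (avg_point g)
      then show ?case using ip_cmult[OF ap_L[OF f avg_point] h, of "k g"] by (simp add: L_def)
    next
      case (avg_mix \<Lambda>1 \<Lambda>2 t)
      have a: "ap (\<lambda>x. \<Lambda>1 (\<lambda>g. k g * f (inv g \<otimes> x)))" "ap (\<lambda>x. \<Lambda>2 (\<lambda>g. k g * f (inv g \<otimes> x)))"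
        using avg_in[OF _ inv_space_AP] f avg_mix by auto
      show ?case using avg_mix.IH h a by (simp add: ip_add ip_cmult ap_cmult)
    qed
    then have "cmod (ip q h - mean ?\<phi>) \<le> \<epsilon>" using good_point[OF L(1) L(3)] by simp
    then show ?thesis using 1 ep norm_triangle_ineq[of "ip (cv k f) h - ip q h" "ip q h - mean ?\<phi>"] by simp
  qed
  then have "cmod (ip (cv k f) h - mean ?\<phi>) \<le> 0" by (rule field_le_epsilon)
  then show ?thesis by simp
qed

lemma cv_selfadjoint:
  assumes k: "conv_kernel k" and f: "ap f" and h: "ap h"
  shows "ip (cv k f) h = ip f (cv k h)"
proof -
  have ka: "ap k" using kernel_ap[OF k] .
  have "ip (cv k f) h = mean (\<lambda>g. k (inv g) * ip (L (inv g) f) h)"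
    unfolding ip_cv[OF ka f h] using mean_inv[OF ap_mult[OF ka ap_matrix_coeff[OF f h]]] by simp
  also have "\<dots> = mean (\<lambda>g. cnj (k g * ip (L g h) f))"
  proof (rule mean_cong)
    fix g assume g: "g \<in> carrier G"
    have "ip (L (inv g) f) h = ip (L g (L (inv g) f)) (L g h)"
      using ip_L[OF ap_L[OF f] h g, of "inv g"] g by simp
    also have "\<dots> = ip f (L g h)"
      using g by (intro ip_cong) (simp_all add: L_def inv_cancel)
    also have "\<dots> = cnj (ip (L g h) f)" by (intro ip_cnj ap_L h f g)
    finally show "k (inv g) * ip (L (inv g) f) h = cnj (k g * ip (L g h) f)"
      using g by (simp add: kernel_inv[OF k] kernel_cnj[OF k])
  qed
  also have "\<dots> = cnj (ip (cv k h) f)"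
    unfolding ip_cv[OF ka h f] by (rule mean_cnj) (intro ap_mult ka ap_matrix_coeff h f)
  also have "\<dots> = ip f (cv k h)" using ip_cnj[OF ap_cv[OF ka h] f] by simp
  finally show ?thesis .
qed

lemma cv_near_id:
  assumes k: "conv_kernel k" and f: "ap f" and x: "x \<in> carrier G"
    and le: "\<And>g. g \<in> carrier G \<Longrightarrow> k g \<noteq> 0 \<Longrightarrow> cmod (f (inv g \<otimes> x) - c) \<le> \<epsilon>"
  shows "cmod (cv k f x - c) \<le> \<epsilon>"
proof -
  have ka: "ap k" using kernel_ap[OF k] .
  have i: "ap (\<lambda>g. f (inv g \<otimes> x))" using ap_inv[OF ap_rtrans[OF f x]] .
  have "cv k f x - c = mean (\<lambda>g. k g * f (inv g \<otimes> x)) - mean (\<lambda>g. c * k g)"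
    using mean_cmult[OF ka] kernel_mean[OF k] by (simp add: cv_def)
  also have "\<dots> = mean (\<lambda>g. k g * f (inv g \<otimes> x) - c * k g)"
    by (intro mean_diff[symmetric] ap_mult ap_cmult ka i)
  also have "cmod \<dots> \<le> Re (mean (\<lambda>g. complex_of_real \<epsilon> * k g))"
  proof (rule mean_dominated)
    fix g assume g: "g \<in> carrier G"
    have eq: "k g * f (inv g \<otimes> x) - c * k g = k g * (f (inv g \<otimes> x) - c)" by (simp add: algebra_simps)
    have "cmod (k g) * cmod (f (inv g \<otimes> x) - c) \<le> cmod (k g) * \<epsilon>"
      using le[OF g] by (cases "k g = 0") (auto intro: mult_left_mono)
    then show "cmod (k g * f (inv g \<otimes> x) - c * k g) \<le> Re (complex_of_real \<epsilon> * k g)"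
      unfolding eq using kernel_cmod[OF k g] by (simp add: norm_mult mult.commute)
  qed (intro ap_diff ap_mult ap_cmult ka i ap_const)+
  also have "\<dots> = \<epsilon>" using mean_cmult[OF ka] kernel_mean[OF k] by simp
  finally show ?thesis .
qed

text \<open>
  An approximate unit adapted to one function \<open>a\<close>. The supremum \<open>\<delta> g\<close> of \<open>|a (h g z) - a (h z)|\<close>
  over all \<open>h, z\<close> is a class function of \<open>g\<close>, symmetric under \<open>g \<mapsto> g\<^sup>-\<^sup>1\<close>, and almost periodic
  because \<open>a\<close> is. The normalised truncation of \<open>\<epsilon> - \<delta>\<close> at zero lives where \<open>a\<close> moves by at most \<open>\<epsilon>\<close>.
\<close>

lemma kernel_exists:
  assumes a: "ap a" and e: "\<epsilon> > 0"
  shows "\<exists>k. conv_kernel k \<and> (\<forall>g\<in>carrier G. k g \<noteq> 0 \<longrightarrow> (\<forall>x\<in>carrier G. cmod (a (inv g \<otimes> x) - a x) \<le> \<epsilon>))"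
proof -
  obtain C where C: "C > 0" "\<And>g. g \<in> carrier G \<Longrightarrow> cmod (a g) \<le> C" using ap_bounded[OF a] by blast
  define D where "D g = (\<lambda>(h,z). cmod (a (h \<otimes> g \<otimes> z) - a (h \<otimes> z))) ` (carrier G \<times> carrier G)" for g
  define \<delta> where "\<delta> g = Sup (D g)" for g
  have ne: "D g \<noteq> {}" for g using one_closed by (auto simp: D_def)
  have bdd: "bdd_above (D g)" if g: "g \<in> carrier G" for g
  proof (rule bdd_aboveI[of _ "2 * C"])
    fix t assume "t \<in> D g"
    then obtain h z where hz: "h \<in> carrier G" "z \<in> carrier G" "t = cmod (a (h \<otimes> g \<otimes> z) - a (h \<otimes> z))"
      by (auto simp: D_def)
    show "t \<le> 2 * C"
      using norm_triangle_ineq4[of "a (h \<otimes> g \<otimes> z)" "a (h \<otimes> z)"] C(2)[of "h \<otimes> g \<otimes> z"] C(2)[of "h \<otimes> z"] hz g by simp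
  qed
  have le: "cmod (a (h \<otimes> g \<otimes> z) - a (h \<otimes> z)) \<le> \<delta> g" if "g \<in> carrier G" "h \<in> carrier G" "z \<in> carrier G" for g h z
    unfolding \<delta>_def using that by (intro cSup_upper bdd) (auto simp: D_def)
  have lub: "\<delta> g \<le> B" if "\<And>h z. h \<in> carrier G \<Longrightarrow> z \<in> carrier G \<Longrightarrow> cmod (a (h \<otimes> g \<otimes> z) - a (h \<otimes> z)) \<le> B" for g B
    unfolding \<delta>_def using that by (intro cSup_least ne) (auto simp: D_def)
  have inv: "\<delta> (inv g) \<le> \<delta> g" if g: "g \<in> carrier G" for g
  proof (rule lub)
    fix h z assume hz: "h \<in> carrier G" "z \<in> carrier G"
    show "cmod (a (h \<otimes> inv g \<otimes> z) - a (h \<otimes> z)) \<le> \<delta> g"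
    proof -
      have e: "h \<otimes> inv g \<otimes> g = h" using hz g by (simp add: m_assoc)
      have "cmod (a (h \<otimes> inv g \<otimes> g \<otimes> z) - a (h \<otimes> inv g \<otimes> z)) \<le> \<delta> g"
        using hz g by (intro le) auto
      then show ?thesis unfolding e by (subst norm_minus_commute)
    qed
  qed
  have conj: "\<delta> (u \<otimes> g \<otimes> inv u) \<le> \<delta> g" if g: "g \<in> carrier G" "u \<in> carrier G" for g u
  proof (rule lub)
    fix h z assume hz: "h \<in> carrier G" "z \<in> carrier G"
    show "cmod (a (h \<otimes> (u \<otimes> g \<otimes> inv u) \<otimes> z) - a (h \<otimes> z)) \<le> \<delta> g"
    proof -
      have e: "h \<otimes> u \<otimes> (inv u \<otimes> z) = h \<otimes> z" "h \<otimes> u \<otimes> g \<otimes> (inv u \<otimes> z) = h \<otimes> (u \<otimes> g \<otimes> inv u) \<otimes> z"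
        using hz g by (simp_all add: m_assoc inv_cancel)
      show ?thesis using le[OF g(1), of "h \<otimes> u" "inv u \<otimes> z"] hz g unfolding e by simp
    qed
  qed
  have conj': "\<delta> (u \<otimes> g \<otimes> inv u) = \<delta> g" if g: "g \<in> carrier G" "u \<in> carrier G" for g u
    using conj[OF g] conj[of "u \<otimes> g \<otimes> inv u" "inv u"] g by (simp add: m_assoc inv_cancel)
  have inv': "\<delta> (inv g) = \<delta> g" if g: "g \<in> carrier G" for g
    using inv[OF g] inv[of "inv g"] g by simp
  have nr: "near (\<lambda>g. complex_of_real (\<delta> g)) t g n" if gn: "g \<in> carrier G" "n \<in> carrier G" "near a t g n" for g n t
  proof -
    have half: "\<delta> (u \<otimes> g \<otimes> v) \<le> \<delta> (u \<otimes> n \<otimes> v) + t"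
      if uv: "u \<in> carrier G" "v \<in> carrier G" and gn: "g \<in> carrier G" "n \<in> carrier G"
      and near: "\<And>h z. h \<in> carrier G \<Longrightarrow> z \<in> carrier G \<Longrightarrow> cmod (a (h \<otimes> g \<otimes> z) - a (h \<otimes> n \<otimes> z)) \<le> t" for u v g n
    proof (rule lub)
      fix h z assume hz: "h \<in> carrier G" "z \<in> carrier G"
      have 1: "cmod (a (h \<otimes> (u \<otimes> n \<otimes> v) \<otimes> z) - a (h \<otimes> z)) \<le> \<delta> (u \<otimes> n \<otimes> v)" using hz uv gn by (intro le) auto
      have 2: "cmod (a (h \<otimes> (u \<otimes> g \<otimes> v) \<otimes> z) - a (h \<otimes> (u \<otimes> n \<otimes> v) \<otimes> z)) \<le> t"
        using near[of "h \<otimes> u" "v \<otimes> z"] hz uv gn by (simp add: m_assoc)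
      show "cmod (a (h \<otimes> (u \<otimes> g \<otimes> v) \<otimes> z) - a (h \<otimes> z)) \<le> \<delta> (u \<otimes> n \<otimes> v) + t"
        using norm_triangle_mono[OF 1 2] by (simp add: algebra_simps)
    qed
    have "\<bar>\<delta> (u \<otimes> g \<otimes> v) - \<delta> (u \<otimes> n \<otimes> v)\<bar> \<le> t" if uv: "u \<in> carrier G" "v \<in> carrier G" for u v
    proof -
      have "cmod (a (h \<otimes> n \<otimes> z) - a (h \<otimes> g \<otimes> z)) \<le> t" if "h \<in> carrier G" "z \<in> carrier G" for h z
        using nearD[OF gn(3) that] by (subst norm_minus_commute)
      then have "\<delta> (u \<otimes> n \<otimes> v) \<le> \<delta> (u \<otimes> g \<otimes> v) + t" by (rule half[OF uv gn(2,1)])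
      moreover have "\<delta> (u \<otimes> g \<otimes> v) \<le> \<delta> (u \<otimes> n \<otimes> v) + t" by (rule half[OF uv gn(1,2) nearD[OF gn(3)]])
      ultimately show ?thesis by linarith
    qed
    then show ?thesis unfolding near_def by (simp flip: of_real_diff)
  qed
  have apd: "ap (\<lambda>g. complex_of_real (\<delta> g))"
  proof (rule ap_of_near[OF a a])
    fix t :: real assume "t > 0"
    then show "\<exists>\<delta>'>0. \<forall>g\<in>carrier G. \<forall>n\<in>carrier G. near a \<delta>' g n \<longrightarrow> near a \<delta>' g n \<longrightarrow>
        near (\<lambda>g. complex_of_real (\<delta> g)) t g n"
      by (intro exI[of _ t] conjI ballI impI nr)
  qed
  define k0 where "k0 g = complex_of_real (max 0 (\<epsilon> - \<delta> g))" for g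
  have ap0: "ap k0"
  proof (rule ap_pointwise[OF apd apd])
    fix t :: real assume t: "t > 0"
    have *: "cmod (k0 x - k0 y) \<le> cmod (complex_of_real (\<delta> x) - complex_of_real (\<delta> y))" for x y
      unfolding k0_def by (simp flip: of_real_diff)
    show "\<exists>\<delta>'>0. \<forall>x\<in>carrier G. \<forall>y\<in>carrier G. cmod (complex_of_real (\<delta> x) - complex_of_real (\<delta> y)) \<le> \<delta>' \<longrightarrow>
        cmod (complex_of_real (\<delta> x) - complex_of_real (\<delta> y)) \<le> \<delta>' \<longrightarrow> cmod (k0 x - k0 y) \<le> t"
      using t by (intro exI[of _ t] conjI ballI impI order_trans[OF *])
  qed
  have d1: "\<delta> \<one> \<le> 0" by (rule lub) simp
  define m where "m = Re (mean k0)"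
  have k01: "0 < Re (k0 \<one>)" unfolding k0_def Re_complex_of_real less_max_iff_disj using d1 e by linarith
  have k0ge: "0 \<le> Re (k0 g)" for g unfolding k0_def by simp
  have m: "m > 0" unfolding m_def by (rule mean_Re_pos[OF ap0 k0ge one_closed k01])
  have "Im (mean k0) = 0" by (rule mean_Im0[OF ap0]) (simp add: k0_def)
  then have mm: "mean k0 = complex_of_real m" by (simp add: m_def complex_eq_iff)
  define k where "k = (\<lambda>g. complex_of_real (1/m) * k0 g)"
  have "conv_kernel k"
    unfolding conv_kernel_def
  proof (intro conjI ballI)
    show "ap k" unfolding k_def by (intro ap_cmult ap0)
    show "mean k = 1" unfolding k_def mean_cmult[OF ap0] mm using m by simp
    show "k x = complex_of_real (Re (k x))" for x by (simp add: k_def k0_def)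
    show "0 \<le> Re (k x)" for x using k0ge[of x] m by (simp add: k_def)
    show "k (inv x) = k x" if "x \<in> carrier G" for x unfolding k_def k0_def inv'[OF that] ..
    show "k (u \<otimes> x \<otimes> inv u) = k x" if "u \<in> carrier G" "x \<in> carrier G" for u x
      unfolding k_def k0_def conj'[OF that(2,1)] ..
  qed
  moreover have "cmod (a (inv g \<otimes> x) - a x) \<le> \<epsilon>" if "g \<in> carrier G" "k g \<noteq> 0" "x \<in> carrier G" for g x
  proof -
    have "\<delta> g \<le> \<epsilon>"
    proof (rule ccontr)
      assume "\<not> \<delta> g \<le> \<epsilon>"
      then have "max 0 (\<epsilon> - \<delta> g) = 0" by simp
      then show False using that(2) by (simp add: k_def k0_def)
    qed
    then show ?thesis using le[OF inv_closed[OF that(1)] one_closed that(3)] inv'[OF that(1)] that by simp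
  qed
  ultimately show ?thesis by blast
qed

end

section \<open>Orthonormal families and irreducible spaces\<close>

context Group.group
begin

definition onf :: "nat \<Rightarrow> (nat \<Rightarrow> 'a \<Rightarrow> complex) \<Rightarrow> bool" where
  "onf d e \<longleftrightarrow> (\<forall>i<d. ap (e i)) \<and> (\<forall>i<d. \<forall>j<d. ip (e i) (e j) = (if i = j then 1 else 0))"

definition proj :: "nat \<Rightarrow> (nat \<Rightarrow> 'a \<Rightarrow> complex) \<Rightarrow> ('a \<Rightarrow> complex) \<Rightarrow> 'a \<Rightarrow> complex" where
  "proj d e f = (\<lambda>x. \<Sum>i<d. ip f (e i) * e i x)"

lemma onfD: assumes "onf d e"
  shows onf_ap: "i < d \<Longrightarrow> ap (e i)" and onf_ip: "i < d \<Longrightarrow> j < d \<Longrightarrow> ip (e i) (e j) = (if i = j then 1 else 0)"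
  using assms unfolding onf_def by blast+

lemma ap_comb: "onf d e \<Longrightarrow> ap (\<lambda>x. \<Sum>i<d. c i * e i x)"
  by (intro ap_sum ap_cmult) (auto intro: onf_ap)

lemma ip_comb: assumes e: "onf d e" and j: "j < d" shows "ip (\<lambda>x. \<Sum>i<d. c i * e i x) (e j) = c j"
proof -
  have "ip (\<lambda>x. \<Sum>i<d. c i * e i x) (e j) = (\<Sum>i<d. ip (\<lambda>x. c i * e i x) (e j))"
    using e j by (intro ip_sum ap_cmult) (auto intro: onf_ap)
  also have "\<dots> = (\<Sum>i<d. if i = j then c j else 0)"
    using onf_ap[OF e] onf_ip[OF e] j by (intro sum.cong refl) (simp add: ip_cmult)
  also have "\<dots> = c j" using j by simp
  finally show ?thesis .
qed

lemma ip_comb_self: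
  assumes e: "onf d e" shows "ip (\<lambda>x. \<Sum>i<d. c i * e i x) (\<lambda>x. \<Sum>i<d. c i * e i x) = (\<Sum>i<d. c i * cnj (c i))"
proof -
  let ?f = "\<lambda>x. \<Sum>i<d. c i * e i x"
  have f: "ap ?f" by (rule ap_comb[OF e])
  have "ip ?f ?f = (\<Sum>i<d. ip ?f (\<lambda>x. c i * e i x))"
    using e f by (intro ip_sum_right ap_cmult) (auto intro: onf_ap)
  also have "\<dots> = (\<Sum>i<d. c i * cnj (c i))"
    using onf_ap[OF e] ip_comb[OF e] f by (intro sum.cong refl) (simp add: ip_cmult_right)
  finally show ?thesis .
qed

lemma ap_proj: "onf d e \<Longrightarrow> ap (proj d e f)"
  unfolding proj_def by (rule ap_comb)

lemma ip_residue: assumes e: "onf d e" and f: "ap f" and j: "j < d" shows "ip (\<lambda>x. f x - proj d e f x) (e j) = 0"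
  using ip_diff[OF f ap_proj[OF e] onf_ap[OF e j]] ip_comb[OF e j] by (simp add: proj_def)

lemma ip_orth_comb:
  assumes e: "onf d e" and q: "ap q" and o: "\<And>j. j < d \<Longrightarrow> ip q (e j) = 0"
  shows "ip q (\<lambda>x. \<Sum>i<d. c i * e i x) = 0"
proof -
  have "ip q (\<lambda>x. \<Sum>i<d. c i * e i x) = (\<Sum>i<d. ip q (\<lambda>x. c i * e i x))"
    using e q by (intro ip_sum_right ap_cmult) (auto intro: onf_ap)
  also have "\<dots> = 0" using o onf_ap[OF e] q by (simp add: ip_cmult_right)
  finally show ?thesis .
qed

lemma l2_residue: assumes e: "onf d e" and f: "ap f" shows "l2 (\<lambda>x. f x - proj d e f x) \<le> l2 f"
proof -
  define q where "q = (\<lambda>x. f x - proj d e f x)"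
  have q: "ap q" unfolding q_def by (intro ap_diff f ap_proj e)
  have "ip q (proj d e f) = 0" unfolding proj_def
    by (rule ip_orth_comb[OF e q]) (use ip_residue[OF e f] in \<open>simp add: q_def\<close>)
  then have "ip q q = ip q f"
    using ip_diff_right[OF q f ap_proj[OF e]] by (simp add: q_def)
  then have "cmod (ip q q) \<le> l2 q * l2 f" using Cauchy_Schwarz[OF q f] by simp
  then have le: "(l2 q)\<^sup>2 \<le> l2 q * l2 f" unfolding ip_self[OF q] by (simp add: norm_power)
  show ?thesis
  proof (cases "l2 q = 0")
    case True
    then show ?thesis using l2_ge0[OF f] by (simp add: q_def)
  next
    case False
    then have "l2 q > 0" using l2_ge0[OF q] by simp
    then show ?thesis using le by (simp add: power2_eq_square q_def)
  qed
qed

lemma l2_pos: assumes "ap q" "x \<in> carrier G" "q x \<noteq> 0" shows "l2 q > 0"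
  using l2_zeroD[OF assms(1) _ assms(2)] assms(3) l2_ge0[OF assms(1)] by (cases "l2 q = 0") auto

lemma onf_extend:
  assumes e: "onf d e" and q: "ap q" and o: "\<And>j. j < d \<Longrightarrow> ip q (e j) = 0" and x: "x \<in> carrier G" "q x \<noteq> 0"
  shows "onf (Suc d) (e(d := (\<lambda>x. complex_of_real (1 / l2 q) * q x)))" (is "onf _ (e(d := ?q))")
proof -
  have p: "l2 q > 0" by (rule l2_pos[OF q x])
  have qa: "ap ?q" by (intro ap_cmult q)
  have qq: "ip ?q ?q = 1"
  proof -
    have "ip ?q ?q = complex_of_real (1 / l2 q) * (cnj (complex_of_real (1 / l2 q)) * ip q q)"
      using ip_cmult[OF q qa, of "complex_of_real (1 / l2 q)"] ip_cmult_right[OF q q, of "complex_of_real (1 / l2 q)"] by simp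
    also have "\<dots> = 1" unfolding ip_self[OF q] using p by (simp add: power2_eq_square)
    finally show ?thesis .
  qed
  have qe: "ip ?q (e j) = 0" if "j < d" for j
    unfolding ip_cmult[OF q onf_ap[OF e that]] o[OF that] by simp
  have eq: "ip (e j) ?q = 0" if "j < d" for j
    using ip_cnj[OF qa onf_ap[OF e that]] qe[OF that] by simp
  show ?thesis
    unfolding onf_def
  proof (intro conjI allI impI)
    fix i assume "i < Suc d"
    then show "ap ((e(d := ?q)) i)" using qa onf_ap[OF e, of i] by (cases "i = d") auto
  next
    fix i j assume i: "i < Suc d" and j: "j < Suc d"
    have "i = d \<or> i < d" "j = d \<or> j < d" using i j by auto
    then show "ip ((e(d := ?q)) i) ((e(d := ?q)) j) = (if i = j then 1 else 0)"
      using qq qe eq onf_ip[OF e] by (elim disjE) simp_all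
  qed
qed

definition basis :: "('a \<Rightarrow> complex) set \<Rightarrow> nat \<Rightarrow> (nat \<Rightarrow> 'a \<Rightarrow> complex) \<Rightarrow> bool" where
  "basis V d e \<longleftrightarrow> onf d e \<and> (\<forall>i<d. e i \<in> V) \<and> (\<forall>f\<in>V. \<forall>x\<in>carrier G. f x = proj d e f x)"

text \<open>
  Finite dimension, in the only form in which it is used: orthonormal families in \<open>V\<close> have bounded
  length. The maximal length \<open>mdim V\<close> takes the part of the dimension, and a family of that length
  spans \<open>V\<close>.
\<close>

definition onf_bounded :: "('a \<Rightarrow> complex) set \<Rightarrow> nat \<Rightarrow> bool" where
  "onf_bounded V B \<longleftrightarrow> (\<forall>d e. onf d e \<longrightarrow> (\<forall>i<d. e i \<in> V) \<longrightarrow> d \<le> B)"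

lemma onf_0: "onf 0 e" by (simp add: onf_def)

lemma proj_in: "inv_space V \<Longrightarrow> (\<And>i. i < d \<Longrightarrow> e i \<in> V) \<Longrightarrow> proj d e f \<in> V"
  unfolding proj_def by (rule inv_space_sum) (auto intro: inv_space_cmult)

lemma onf_extend_in:
  assumes V: "inv_space V" and e: "onf d e" "\<And>i. i < d \<Longrightarrow> e i \<in> V"
    and f: "f \<in> V" and x: "x \<in> carrier G" "f x \<noteq> proj d e f x"
  shows "\<exists>e'. onf (Suc d) e' \<and> (\<forall>i<Suc d. e' i \<in> V)"
proof -
  define q where "q = (\<lambda>x. f x - proj d e f x)"
  let ?e = "e(d := (\<lambda>x. complex_of_real (1 / l2 q) * q x))"
  have qV: "q \<in> V" unfolding q_def using V f proj_in[OF V e(2)] by (intro inv_space_diff)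
  have "onf (Suc d) ?e"
    using x by (intro onf_extend[OF e(1) inv_space_ap[OF V qV] _ x(1)])
      (auto simp: q_def ip_residue[OF e(1) inv_space_ap[OF V f]])
  moreover have "?e i \<in> V" if "i < Suc d" for i
    using e(2)[of i] inv_space_cmult[OF V qV, of "complex_of_real (1 / l2 q)"] that by (cases "i = d") auto
  ultimately show ?thesis by (intro exI[of _ ?e]) simp
qed

lemma maximal_onf_basis:
  assumes V: "inv_space V" and e: "onf d e" "\<And>i. i < d \<Longrightarrow> e i \<in> V"
    and max: "\<And>e'. onf (Suc d) e' \<Longrightarrow> \<exists>i<Suc d. e' i \<notin> V"
  shows "basis V d e"
  unfolding basis_def
proof (intro conjI e(1) allI impI ballI)
  show "e i \<in> V" if "i < d" for i using e(2)[OF that] .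
  fix f x assume f: "f \<in> V" and x: "x \<in> carrier G"
  show "f x = proj d e f x"
    using onf_extend_in[OF V e f x] max by blast
qed

definition mdim :: "('a \<Rightarrow> complex) set \<Rightarrow> nat" where
  "mdim V = (GREATEST d. \<exists>e. onf d e \<and> (\<forall>i<d. e i \<in> V))"

lemma mdim_ex: assumes "onf_bounded V B" shows "\<exists>e. onf (mdim V) e \<and> (\<forall>i<mdim V. e i \<in> V)"
  unfolding mdim_def
proof (rule GreatestI_nat[where b = B])
  show "\<exists>e. onf 0 e \<and> (\<forall>i<0. e i \<in> V)" by (simp add: onf_0)
  show "\<And>y. \<exists>e. onf y e \<and> (\<forall>i<y. e i \<in> V) \<Longrightarrow> y \<le> B" using assms unfolding onf_bounded_def by blast
qed

lemma mdim_le: assumes "onf_bounded V B" "onf d e" "\<And>i. i < d \<Longrightarrow> e i \<in> V" shows "d \<le> mdim V"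
  unfolding mdim_def
proof (rule Greatest_le_nat[where b = B])
  show "\<exists>e. onf d e \<and> (\<forall>i<d. e i \<in> V)" using assms by blast
  show "\<And>y. \<exists>e. onf y e \<and> (\<forall>i<y. e i \<in> V) \<Longrightarrow> y \<le> B" using assms(1) unfolding onf_bounded_def by blast
qed

lemma basis_exists: assumes V: "inv_space V" "onf_bounded V B" shows "\<exists>e. basis V (mdim V) e"
proof -
  obtain e where e: "onf (mdim V) e" "\<And>i. i < mdim V \<Longrightarrow> e i \<in> V" using mdim_ex[OF V(2)] by blast
  have "\<exists>i<Suc (mdim V). e' i \<notin> V" if "onf (Suc (mdim V)) e'" for e'
    using mdim_le[OF V(2) that] by force
  then show ?thesis using maximal_onf_basis[OF V(1) e] by blast
qed

lemma basis_inD: assumes V: "inv_space V" "basis V d e" and x: "\<And>x. x \<in> carrier G \<Longrightarrow> f x = proj d e f x"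
  shows "f \<in> V"
  using inv_space_cong[OF V(1) proj_in[OF V(1)], of d e f f] V(2) x unfolding basis_def by blast

lemma mdim_less:
  assumes V: "inv_space V" "onf_bounded V B" and W: "inv_space W" "W \<subseteq> V" "W \<noteq> V"
  shows "mdim W < mdim V"
proof -
  have bW: "onf_bounded W B" using V(2) W(2) unfolding onf_bounded_def by blast
  obtain e where e: "basis W (mdim W) e" using basis_exists[OF W(1) bW] by blast
  define d where "d = mdim W"
  have eo: "onf d e" "\<And>i. i < d \<Longrightarrow> e i \<in> W" using e unfolding basis_def d_def by blast+
  obtain v where v: "v \<in> V" "v \<notin> W" using W by blast
  then obtain x where x: "x \<in> carrier G" "v x \<noteq> proj d e v x"
    using basis_inD[OF W(1) e] d_def by blast
  have eV: "e i \<in> V" if "i < d" for i using eo(2)[OF that] W(2) by blast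
  obtain e' where "onf (Suc d) e'" "\<forall>i<Suc d. e' i \<in> V"
  proof -
    have "\<exists>e'. onf (Suc d) e' \<and> (\<forall>i<Suc d. e' i \<in> V)"
      by (rule onf_extend_in[OF V(1) eo(1) _ v(1) x]) (rule eV)
    then show ?thesis using that by (elim exE conjE)
  qed
  then have "Suc d \<le> mdim V" by (intro mdim_le[OF V(2), of _ e']) auto
  then show ?thesis by (simp add: d_def)
qed

definition orth :: "('a \<Rightarrow> complex) set \<Rightarrow> ('a \<Rightarrow> complex) set \<Rightarrow> ('a \<Rightarrow> complex) set" where
  "orth V W = {f \<in> V. \<forall>w\<in>W. ip f w = 0}"

lemma ip_L_move: assumes "ap f" "ap h" "g \<in> carrier G" shows "ip (L g f) h = ip f (L (inv g) h)"
proof -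
  have "ip (L (inv g) (L g f)) (L (inv g) h) = ip (L g f) h"
    using assms by (intro ip_L ap_L) auto
  moreover have "ip (L (inv g) (L g f)) (L (inv g) h) = ip f (L (inv g) h)"
    using assms by (intro ip_cong) (simp_all add: L_def inv_cancel)
  ultimately show ?thesis by simp
qed

lemma inv_space_orth: assumes V: "inv_space V" and W: "inv_space W" shows "inv_space (orth V W)"
  unfolding inv_space_def
proof (intro conjI ballI allI impI)
  note ap = inv_space_ap[OF V] inv_space_ap[OF W]
  show "ap f" if "f \<in> orth V W" for f using that ap by (auto simp: orth_def)
  show "(\<lambda>_. 0) \<in> orth V W" using inv_space_0[OF V] by (auto simp: orth_def ip_def)
  show "(\<lambda>x. f x + h x) \<in> orth V W" if "f \<in> orth V W" "h \<in> orth V W" for f h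
    using that inv_space_add[OF V] ap by (auto simp: orth_def ip_add)
  show "(\<lambda>x. c * f x) \<in> orth V W" if "f \<in> orth V W" for f c
    using that inv_space_cmult[OF V] ap by (auto simp: orth_def ip_cmult)
  show "L g f \<in> orth V W" if "g \<in> carrier G" "f \<in> orth V W" for f g
    using that inv_space_L[OF V] inv_space_L[OF W] ap by (auto simp: orth_def ip_L_move)
  show "f' \<in> orth V W" if "f \<in> orth V W" "\<forall>x\<in>carrier G. f' x = f x" for f f'
    using that inv_space_cong[OF V, of f f'] ip_cong[of f' f] by (auto simp: orth_def)
qed

lemma uclosed_orth:
  assumes V: "inv_space V" "uclosed V" and W: "\<And>w. w \<in> W \<Longrightarrow> ap w" shows "uclosed (orth V W)"
  unfolding uclosed_def
proof (intro allI impI)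
  fix f assume f: "\<forall>\<epsilon>>0. \<exists>h\<in>orth V W. \<forall>x\<in>carrier G. cmod (f x - h x) \<le> \<epsilon>"
  have fV: "f \<in> V"
  proof (rule uclosedD[OF V(2)])
    fix \<epsilon> :: real assume "\<epsilon> > 0"
    then show "\<exists>h\<in>V. \<forall>x\<in>carrier G. cmod (f x - h x) \<le> \<epsilon>" using f unfolding orth_def by blast
  qed
  have fa: "ap f" using inv_space_ap[OF V(1) fV] .
  have "ip f w = 0" if w: "w \<in> W" for w
  proof -
    have wa: "ap w" by (rule W[OF w])
    have "cmod (ip f w) \<le> 0 + e" if e: "e > 0" for e
    proof -
      define \<epsilon> where "\<epsilon> = e / (l2 w + 1)"
      have p: "l2 w + 1 > 0" using l2_ge0[OF wa] by simp
      then have "\<epsilon> > 0" using e by (simp add: \<epsilon>_def)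
      then obtain h where h: "h \<in> orth V W" "\<And>x. x \<in> carrier G \<Longrightarrow> cmod (f x - h x) \<le> \<epsilon>" using f by blast
      have ha: "ap h" using h(1) inv_space_ap[OF V(1)] by (simp add: orth_def)
      have "ip f w = ip (\<lambda>x. f x - h x) w" using h(1) w by (simp add: ip_diff fa ha wa orth_def)
      then have "cmod (ip f w) \<le> l2 (\<lambda>x. f x - h x) * l2 w" using Cauchy_Schwarz[OF ap_diff[OF fa ha] wa] by simp
      also have "\<dots> \<le> \<epsilon> * (l2 w + 1)"
        using l2_ge0[OF wa] \<open>\<epsilon> > 0\<close> by (intro mult_mono l2_le[OF ap_diff[OF fa ha] h(2)]) auto
      also have "\<dots> = e" using p by (simp add: \<epsilon>_def)
      finally show ?thesis by simp
    qed
    then have "cmod (ip f w) \<le> 0" by (rule field_le_epsilon)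
    then show ?thesis by simp
  qed
  then show "f \<in> orth V W" using fV by (simp add: orth_def)
qed

definition zero_space :: "('a \<Rightarrow> complex) set \<Rightarrow> bool" where
  "zero_space V \<longleftrightarrow> (\<forall>f\<in>V. \<forall>x\<in>carrier G. f x = 0)"

text \<open>
  \<open>W = V\<close> may be demanded as an equality of sets of functions because invariant spaces are closed
  under changes off the carrier.
\<close>

definition irr :: "('a \<Rightarrow> complex) set \<Rightarrow> bool" where
  "irr V \<longleftrightarrow> inv_space V \<and> \<not> zero_space V \<and> (\<forall>W. inv_space W \<longrightarrow> W \<subseteq> V \<longrightarrow> zero_space W \<or> W = V)"

text \<open>
  An invariant subspace \<open>V\<close> of \<open>E\<close> that is minimal in dimension among those not contained in \<open>P\<close>
  is irreducible: a proper invariant subspace and its orthogonal complement in \<open>V\<close> would both be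
  smaller, hence contained in \<open>P\<close>, and so would their sum \<open>V\<close>.
\<close>

lemma irr_subspace:
  assumes E: "inv_space E" "onf_bounded E B" and P: "inv_space P" and EP: "\<not> E \<subseteq> P"
  shows "\<exists>V d e. irr V \<and> V \<subseteq> E \<and> \<not> V \<subseteq> P \<and> basis V d e"
proof -
  define Q where "Q n \<longleftrightarrow> (\<exists>V. inv_space V \<and> V \<subseteq> E \<and> \<not> V \<subseteq> P \<and> mdim V = n)" for n
  have "Q (mdim E)" unfolding Q_def using E EP by blast
  then have LQ: "Q (LEAST n. Q n)" by (rule LeastI)
  obtain V where V: "inv_space V" "V \<subseteq> E" "\<not> V \<subseteq> P" "mdim V = (LEAST n. Q n)" using LQ unfolding Q_def by blast
  have min: "W \<subseteq> P" if "inv_space W" "W \<subseteq> E" "mdim W < mdim V" for W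
    using not_less_Least[of "mdim W" Q] that V(4) unfolding Q_def by auto
  have bV: "onf_bounded V B" using E(2) V(2) unfolding onf_bounded_def by blast
  have "zero_space W \<or> W = V" if W: "inv_space W" "W \<subseteq> V" for W
  proof (rule ccontr)
    assume n: "\<not> (zero_space W \<or> W = V)"
    have WP: "W \<subseteq> P" using min[OF W(1)] mdim_less[OF V(1) bV W] W(2) V(2) n by blast
    define W' where "W' = orth V W"
    have W': "inv_space W'" "W' \<subseteq> V" unfolding W'_def using inv_space_orth[OF V(1) W(1)] by (auto simp: orth_def)
    have "W' \<noteq> V"
    proof
      assume eq: "W' = V"
      have "f x = 0" if f: "f \<in> W" and x: "x \<in> carrier G" for f x
      proof -
        have "ip f f = 0" using f eq W(2) unfolding W'_def orth_def by blast
        then have "l2 f = 0" by (simp add: l2_def)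
        then show ?thesis using l2_zeroD[OF inv_space_ap[OF W(1) f]] x by blast
      qed
      then show False using n unfolding zero_space_def by blast
    qed
    then have W'P: "W' \<subseteq> P" using min[OF W'(1)] mdim_less[OF V(1) bV W'] W'(2) V(2) by blast
    have bW: "onf_bounded W B" using bV W(2) unfolding onf_bounded_def by blast
    obtain e where e: "basis W (mdim W) e" using basis_exists[OF W(1) bW] by blast
    define d where "d = mdim W"
    have eo: "onf d e" "\<And>i. i < d \<Longrightarrow> e i \<in> W" using e unfolding basis_def d_def by blast+
    have "v \<in> P" if v: "v \<in> V" for v
    proof -
      have va: "ap v" using inv_space_ap[OF V(1) v] .
      define q where "q = (\<lambda>x. v x - proj d e v x)"
      have pW: "proj d e v \<in> W" by (intro proj_in[OF W(1)] eo)
      have qV: "q \<in> V" unfolding q_def using pW W(2) v by (intro inv_space_diff[OF V(1)]) auto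
      have qa: "ap q" using inv_space_ap[OF V(1) qV] .
      have "ip q w = 0" if w: "w \<in> W" for w
      proof -
        have "ip q w = ip q (\<lambda>x. \<Sum>i<d. ip w (e i) * e i x)"
          using e w unfolding basis_def d_def proj_def by (intro ip_cong) auto
        also have "\<dots> = 0"
          by (rule ip_orth_comb[OF eo(1) qa]) (simp add: q_def ip_residue[OF eo(1) va])
        finally show ?thesis .
      qed
      then have "q \<in> W'" using qV by (simp add: W'_def orth_def)
      then have "(\<lambda>x. q x + proj d e v x) \<in> P" using W'P WP pW by (intro inv_space_add[OF P]) auto
      then show "v \<in> P" by (simp add: q_def)
    qed
    then show False using V(3) by blast
  qed
  moreover have "\<not> zero_space V"
  proof
    assume z: "zero_space V"
    have "V \<subseteq> P"
    proof
      fix f assume "f \<in> V"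
      then show "f \<in> P" using z inv_space_cong[OF P inv_space_0[OF P], of f] by (simp add: zero_space_def)
    qed
    then show False using V(3) by blast
  qed
  ultimately have "irr V" using V(1) unfolding irr_def by blast
  moreover obtain e where "basis V (mdim V) e" using basis_exists[OF V(1) bV] by blast
  ultimately show ?thesis using V by blast
qed

section \<open>Eigenfunctions of convolution and the Peter-Weyl theorem\<close>

text \<open>
  Eigenvalues bounded away from zero have finite total multiplicity. For fixed \<open>x\<close> the uniform
  bound of convolution is applied to \<open>\<Sum>\<^sub>i \<mu>\<^sub>i cnj (e\<^sub>i x) e\<^sub>i\<close>, the combination for which it is
  sharpest; this bounds \<open>\<Sum>\<^sub>i |e\<^sub>i x|\<^sup>2\<close>, and the mean of that sum is the number of functions.
\<close>

lemma eigen_bessel: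
  assumes k: "ap k" and C: "C > 0" "\<And>g. g \<in> carrier G \<Longrightarrow> cmod (k g) \<le> C"
    and e: "onf d e" and eig: "\<And>i x. i < d \<Longrightarrow> x \<in> carrier G \<Longrightarrow> cv k (e i) x = complex_of_real (\<mu> i) * e i x"
    and lam: "\<And>i. i < d \<Longrightarrow> \<epsilon> \<le> \<bar>\<mu> i\<bar>" and eps: "\<epsilon> > 0"
  shows "real d \<le> C\<^sup>2 / \<epsilon>\<^sup>2"
proof -
  have pt: "(\<Sum>i<d. (cmod (e i x))\<^sup>2) \<le> C\<^sup>2 / \<epsilon>\<^sup>2" if x: "x \<in> carrier G" for x
  proof -
    define c where "c i = complex_of_real (\<mu> i) * cnj (e i x)" for i
    define s where "s = (\<Sum>i<d. (\<mu> i)\<^sup>2 * (cmod (e i x))\<^sup>2)"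
    let ?f = "\<lambda>y. \<Sum>i<d. c i * e i y"
    have s0: "s \<ge> 0" unfolding s_def by (intro sum_nonneg) simp
    have "cv k ?f x = (\<Sum>i<d. cv k (\<lambda>y. c i * e i y) x)"
      by (intro cv_sum k x ap_cmult) (auto intro: onf_ap[OF e])
    also have "\<dots> = (\<Sum>i<d. c i * (complex_of_real (\<mu> i) * e i x))"
      using x onf_ap[OF e] eig by (intro sum.cong refl) (simp add: cv_cmult k)
    also have "\<dots> = complex_of_real s"
      unfolding s_def of_real_sum
    proof (intro sum.cong refl)
      fix i
      have "c i * (complex_of_real (\<mu> i) * e i x) = (complex_of_real (\<mu> i))\<^sup>2 * (e i x * cnj (e i x))"
        by (simp add: c_def power2_eq_square)
      then show "c i * (complex_of_real (\<mu> i) * e i x) = complex_of_real ((\<mu> i)\<^sup>2 * (cmod (e i x))\<^sup>2)"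
        by (simp add: mult_cnj_cmod)
    qed
    finally have cvx: "cmod (cv k ?f x) = s" using s0 by simp
    have "ip ?f ?f = complex_of_real s"
      unfolding ip_comb_self[OF e] s_def of_real_sum
    proof (intro sum.cong refl)
      fix i
      have "c i * cnj (c i) = (complex_of_real (\<mu> i))\<^sup>2 * (e i x * cnj (e i x))"
        by (simp add: c_def power2_eq_square)
      then show "c i * cnj (c i) = complex_of_real ((\<mu> i)\<^sup>2 * (cmod (e i x))\<^sup>2)" by (simp add: mult_cnj_cmod)
    qed
    then have "l2 ?f = sqrt s" by (simp add: l2_def)
    then have "s \<le> C * sqrt s" using cv_sup_le[OF k ap_comb[OF e] C(2) x, of c] cvx by simp
    then have "sqrt s * sqrt s \<le> C * sqrt s" using s0 by simp
    then have "sqrt s \<le> C"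
    proof (cases "s = 0")
      case False
      then have "sqrt s > 0" using s0 by simp
      then show ?thesis using \<open>sqrt s * sqrt s \<le> C * sqrt s\<close> by (rule mult_right_le_imp_le[rotated])
    qed (use C(1) in simp)
    then have "s \<le> C\<^sup>2" using s0 by (metis real_sqrt_pow2 power_mono real_sqrt_ge_zero)
    moreover have "\<epsilon>\<^sup>2 * (\<Sum>i<d. (cmod (e i x))\<^sup>2) \<le> s"
      unfolding s_def sum_distrib_left
    proof (intro sum_mono mult_right_mono)
      fix i assume "i \<in> {..<d}"
      then have "\<bar>\<epsilon>\<bar> \<le> \<bar>\<mu> i\<bar>" using lam[of i] eps by simp
      then show "\<epsilon>\<^sup>2 \<le> (\<mu> i)\<^sup>2" by (simp add: abs_le_square_iff)
    qed simp
    ultimately have "(\<Sum>i<d. (cmod (e i x))\<^sup>2) * \<epsilon>\<^sup>2 \<le> C\<^sup>2" by (simp add: mult.commute)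
    then show ?thesis using eps by (simp add: pos_le_divide_eq)
  qed
  have apee: "ap (\<lambda>x. e i x * cnj (e i x))" if "i < d" for i using onf_ap[OF e that] by (intro ap_ip)
  have "mean (\<lambda>x. \<Sum>i<d. e i x * cnj (e i x)) = (\<Sum>i<d. ip (e i) (e i))"
    unfolding ip_def using apee by (intro mean_sum) auto
  also have "\<dots> = of_nat d" using onf_ip[OF e] by simp
  finally have "cmod (of_nat d) \<le> C\<^sup>2 / \<epsilon>\<^sup>2"
  proof -
    assume eq: "mean (\<lambda>x. \<Sum>i<d. e i x * cnj (e i x)) = of_nat d"
    have "cmod (mean (\<lambda>x. \<Sum>i<d. e i x * cnj (e i x))) \<le> C\<^sup>2 / \<epsilon>\<^sup>2"
    proof (rule mean_le)
      show "ap (\<lambda>x. \<Sum>i<d. e i x * cnj (e i x))" using apee by (intro ap_sum) auto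
      fix x assume x: "x \<in> carrier G"
      have "(\<Sum>i<d. e i x * cnj (e i x)) = complex_of_real (\<Sum>i<d. (cmod (e i x))\<^sup>2)"
        by (simp add: mult_cnj_cmod)
      also have "cmod \<dots> = (\<Sum>i<d. (cmod (e i x))\<^sup>2)" by (simp only: norm_of_real) (simp add: sum_nonneg)
      finally show "cmod (\<Sum>i<d. e i x * cnj (e i x)) \<le> C\<^sup>2 / \<epsilon>\<^sup>2" using pt[OF x] by simp
    qed
    then show ?thesis by (simp only: eq)
  qed
  then show ?thesis by simp
qed

text \<open>
  The Arzela-Ascoli argument: a subsequence converging on the countable union of all nets of \<open>k\<close>
  converges uniformly, by equicontinuity.
\<close>

lemma uniform_subsequence:
  fixes F :: "nat \<Rightarrow> 'a \<Rightarrow> complex"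
  assumes k: "ap k" and F: "\<And>n. ap (F n)" "\<And>n. l2 (F n) \<le> 1"
  shows "\<exists>(r :: nat \<Rightarrow> nat) h. strict_mono r \<and> (\<forall>\<epsilon>>0. \<exists>N. \<forall>n\<ge>N. \<forall>x\<in>carrier G. cmod (cv k (F (r n)) x - h x) \<le> \<epsilon>)"
proof -
  obtain C where C: "C > 0" "\<And>g. g \<in> carrier G \<Longrightarrow> cmod (k g) \<le> C" using ap_bounded[OF k] by blast
  define u where "u n = cv k (F n)" for n
  have "\<forall>j. \<exists>N. finite N \<and> N \<subseteq> carrier G \<and> (\<forall>g\<in>carrier G. \<exists>n\<in>N. near k (1 / real (Suc j)) g n)"
    using k unfolding ap_def by simp
  then obtain D where D: "\<And>j. finite (D j)" "\<And>j. D j \<subseteq> carrier G"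
    "\<And>j g. g \<in> carrier G \<Longrightarrow> \<exists>n\<in>D j. near k (1 / real (Suc j)) g n" by metis
  define S where "S = (\<Union>j. D j)"
  have S: "countable S" "S \<subseteq> carrier G" unfolding S_def using D(1,2) by (auto intro: countable_finite)
  have bd: "norm (u n x) \<le> C" if "x \<in> S" for n x
  proof -
    have "cmod (u n x) \<le> C * l2 (F n)" unfolding u_def using that S(2) by (intro cv_sup_le k F C) auto
    also have "\<dots> \<le> C * 1" using C F(2) by (intro mult_left_mono) auto
    finally show ?thesis by simp
  qed
  obtain r where r: "strict_mono (r :: nat \<Rightarrow> nat)" "\<And>x. x \<in> S \<Longrightarrow> \<exists>l. (\<lambda>n. u (r n) x) \<longlonglongrightarrow> l"
    using function_convergent_subsequence[OF S(1), of u C] bd by blast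
  have cau: "\<exists>N. \<forall>m\<ge>N. \<forall>n\<ge>N. \<forall>x\<in>carrier G. cmod (u (r m) x - u (r n) x) \<le> \<epsilon>" if e: "\<epsilon> > 0" for \<epsilon>
  proof -
    obtain j where j: "1 / real (Suc j) < \<epsilon> / 3" using nat_approx_posE[of "\<epsilon>/3"] e by auto
    have "\<exists>N. \<forall>m\<ge>N. \<forall>n\<ge>N. cmod (u (r m) x - u (r n) x) \<le> \<epsilon> / 3" if "x \<in> D j" for x
    proof -
      have "Cauchy (\<lambda>n. u (r n) x)" using r(2)[of x] that convergent_def by (intro convergent_Cauchy) (auto simp: S_def convergent_def)
      then obtain N where "\<And>m n. m \<ge> N \<Longrightarrow> n \<ge> N \<Longrightarrow> cmod (u (r m) x - u (r n) x) < \<epsilon> / 3"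
        using e unfolding Cauchy_iff by (meson divide_pos_pos zero_less_numeral)
      then show ?thesis by (meson less_imp_le)
    qed
    then obtain M where M: "\<And>x m n. x \<in> D j \<Longrightarrow> m \<ge> M x \<Longrightarrow> n \<ge> M x \<Longrightarrow> cmod (u (r m) x - u (r n) x) \<le> \<epsilon> / 3"
      by metis
    define N where "N = Max (insert 0 (M ` D j))"
    have N: "M x \<le> N" if "x \<in> D j" for x unfolding N_def using that D(1) by (intro Max_ge) auto
    have "cmod (u (r m) x - u (r n) x) \<le> \<epsilon>" if mn: "m \<ge> N" "n \<ge> N" and x: "x \<in> carrier G" for m n x
    proof -
      obtain y where y: "y \<in> D j" "near k (1 / real (Suc j)) x y" using D(3)[OF x] by blast
      have yc: "y \<in> carrier G" using y D(2) by blast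
      have close: "cmod (u i x - u i y) \<le> \<epsilon> / 3" for i
      proof -
        have "cmod (u i x - u i y) \<le> 1 / real (Suc j) * l2 (F i)" unfolding u_def by (rule cv_equi[OF k F(1) y(2) x yc])
        also have "\<dots> \<le> 1 / real (Suc j) * 1" using F(2) by (intro mult_left_mono) auto
        finally show ?thesis using j by simp
      qed
      have a: "cmod (u (r m) x - u (r m) y) \<le> \<epsilon> / 3" by (rule close)
      have b: "cmod (u (r n) x - u (r n) y) \<le> \<epsilon> / 3" by (rule close)
      have c: "cmod (u (r m) y - u (r n) y) \<le> \<epsilon> / 3"
        using M[OF y(1) order_trans[OF N[OF y(1)] mn(1)] order_trans[OF N[OF y(1)] mn(2)]] .
      have "cmod (u (r m) x - u (r n) x) = cmod ((u (r m) x - u (r m) y) + (u (r m) y - u (r n) y) - (u (r n) x - u (r n) y))"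
        by simp
      also have "\<dots> \<le> \<epsilon> / 3 + \<epsilon> / 3 + \<epsilon> / 3"
        using norm_triangle_mono[OF norm_triangle_mono[OF a c], of "- (u (r n) x - u (r n) y)" "\<epsilon>/3"] b
        by (simp add: norm_minus_commute)
      finally show ?thesis by simp
    qed
    then show ?thesis by blast
  qed
  define h where "h x = lim (\<lambda>n. u (r n) x)" for x
  have lim: "(\<lambda>n. u (r n) x) \<longlonglongrightarrow> h x" if x: "x \<in> carrier G" for x
  proof -
    have "Cauchy (\<lambda>n. u (r n) x)"
    proof (rule CauchyI)
      fix e :: real assume e: "e > 0"
      obtain N where "\<forall>m\<ge>N. \<forall>n\<ge>N. \<forall>x\<in>carrier G. cmod (u (r m) x - u (r n) x) \<le> e / 2" using cau[of "e/2"] e by auto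
      then have "\<forall>m\<ge>N. \<forall>n\<ge>N. cmod (u (r m) x - u (r n) x) < e" using x e by fastforce
      then show "\<exists>M. \<forall>m\<ge>M. \<forall>n\<ge>M. cmod (u (r m) x - u (r n) x) < e" by blast
    qed
    then show ?thesis unfolding h_def using Cauchy_convergent convergent_LIMSEQ_iff by blast
  qed
  have "\<exists>N. \<forall>n\<ge>N. \<forall>x\<in>carrier G. cmod (u (r n) x - h x) \<le> \<epsilon>" if e: "\<epsilon> > 0" for \<epsilon>
  proof -
    obtain N where N: "\<And>m n x. m \<ge> N \<Longrightarrow> n \<ge> N \<Longrightarrow> x \<in> carrier G \<Longrightarrow> cmod (u (r n) x - u (r m) x) \<le> \<epsilon>" using cau[OF e] by blast
    have "cmod (u (r n) x - h x) \<le> \<epsilon>" if n: "n \<ge> N" and x: "x \<in> carrier G" for n x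
    proof (rule LIMSEQ_le_const2)
      show "(\<lambda>m. cmod (u (r n) x - u (r m) x)) \<longlonglongrightarrow> cmod (u (r n) x - h x)"
        by (intro tendsto_intros lim x)
      show "\<exists>M. \<forall>m\<ge>M. cmod (u (r n) x - u (r m) x) \<le> \<epsilon>" using N n x by blast
    qed
    then show ?thesis by blast
  qed
  note lim_u = this[unfolded u_def]
  show ?thesis by (intro exI[of _ r] exI[of _ h] conjI r(1) allI impI) (rule lim_u)
qed

lemma cv_l2_le:
  assumes k: "ap k" and C: "\<And>g. g \<in> carrier G \<Longrightarrow> cmod (k g) \<le> C" and f: "ap f"
  shows "l2 (cv k f) \<le> C * l2 f"
  by (rule l2_le[OF ap_cv[OF k f] cv_sup_le[OF k f C]])

lemma ip_diff_cmult_self: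
  assumes "ap f" "ap h"
  shows "ip (\<lambda>x. f x - c * h x) (\<lambda>x. f x - c * h x) =
     ip f f - cnj c * ip f h - c * ip h f + c * cnj c * ip h h"
proof -
  have c: "ap (\<lambda>x. c * h x)" by (intro ap_cmult assms)
  show ?thesis
    using assms c ap_diff[OF assms(1) c] by (simp add: ip_diff ip_diff_right ip_cmult ip_cmult_right algebra_simps)
qed

lemma l2_cv_homogeneous:
  assumes k: "ap k" and f: "ap f"
    and ub: "\<And>c. l2 (\<lambda>x. c * f x) \<le> 1 \<Longrightarrow> l2 (cv k (\<lambda>x. c * f x)) \<le> s"
  shows "l2 (cv k f) \<le> s * l2 f"
proof (cases "l2 f = 0")
  case True
  have "cv k f x = cv k (\<lambda>_. 0) x" if "x \<in> carrier G" for x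
    using l2_zeroD[OF f True] by (intro cv_cong that)
  then have "l2 (cv k f) \<le> 0" by (intro l2_le ap_cv k f) (simp add: cv_def)
  then show ?thesis using True by simp
next
  case False
  then have p: "l2 f > 0" using l2_ge0[OF f] by simp
  define c where "c = complex_of_real (1 / l2 f)"
  have cm: "cmod c = 1 / l2 f" using p by (simp add: c_def norm_divide)
  have "l2 (\<lambda>x. c * f x) \<le> 1" using p by (simp add: l2_cmult f cm)
  then have "l2 (cv k (\<lambda>x. c * f x)) \<le> s" by (rule ub)
  moreover have "l2 (cv k (\<lambda>x. c * f x)) = l2 (\<lambda>x. c * cv k f x)"
    unfolding l2_def using cv_cmult[OF k f]
    by (intro arg_cong[where f = sqrt] arg_cong[where f = Re] ip_cong) auto
  moreover have "\<dots> = l2 (cv k f) / l2 f" by (simp add: l2_cmult ap_cv k f cm)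
  ultimately show ?thesis using p by (simp add: pos_divide_le_eq)
qed

text \<open>
  On a uniformly closed subspace \<open>R\<close> that is stable under the convolution operator \<open>K\<close>, the norm \<open>s\<close>
  of \<open>K\<close> for the mean square norm, if nonzero, is attained at an eigenvalue \<open>s\<close> or \<open>- s\<close>. For a
  maximizing sequence \<open>F\<^sub>n\<close> the identity
  \<open>\<parallel>K\<^sup>2 F - s\<^sup>2 F\<parallel>\<^sup>2 = \<parallel>K\<^sup>2 F\<parallel>\<^sup>2 - 2 s\<^sup>2 \<parallel>K F\<parallel>\<^sup>2 + s\<^sup>4 \<parallel>F\<parallel>\<^sup>2\<close> shows
  \<open>K\<^sup>2 F\<^sub>n - s\<^sup>2 F\<^sub>n \<rightarrow> 0\<close> in mean square. A uniform limit \<open>h\<close> of \<open>K F\<^sub>n\<close> is thus a fixed vector of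
  \<open>s\<^sup>-\<^sup>2 K\<^sup>2\<close>, and \<open>K h + s h\<close> or \<open>h\<close> itself is the eigenvector. The limit is taken in the
  uniform norm, which keeps \<open>h\<close> in \<open>R\<close>.
\<close>

lemma spectral_gap:
  fixes f0 :: "'a \<Rightarrow> complex"
  assumes k: "conv_kernel k"
    and Rap: "\<And>f. f \<in> R \<Longrightarrow> ap f" and Radd: "\<And>f h. f \<in> R \<Longrightarrow> h \<in> R \<Longrightarrow> (\<lambda>x. f x + h x) \<in> R"
    and Rcm: "\<And>f c. f \<in> R \<Longrightarrow> (\<lambda>x. c * f x) \<in> R" and Rcl: "uclosed R"
    and Rcv: "\<And>f. f \<in> R \<Longrightarrow> cv k f \<in> R"
    and f0: "f0 \<in> R" "l2 f0 \<le> 1" "l2 (cv k f0) > \<epsilon>" and eps: "\<epsilon> > 0"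
  shows "\<exists>h \<mu>. h \<in> R \<and> (\<exists>x\<in>carrier G. h x \<noteq> 0) \<and> \<epsilon> \<le> \<bar>\<mu>\<bar> \<and>
           (\<forall>x\<in>carrier G. cv k h x = complex_of_real \<mu> * h x)"
proof -
  have ka: "ap k" using kernel_ap[OF k] .
  obtain C where C: "C > 0" "\<And>g. g \<in> carrier G \<Longrightarrow> cmod (k g) \<le> C" using ap_bounded[OF ka] by blast
  define D where "D = {l2 (cv k f) |f. f \<in> R \<and> l2 f \<le> 1}"
  define s where "s = Sup D"
  have le1: "l2 (cv k f) \<le> C" if "f \<in> R" "l2 f \<le> 1" for f
  proof -
    have "l2 (cv k f) \<le> C * l2 f" by (rule cv_l2_le[OF ka C(2) Rap[OF that(1)]])
    also have "\<dots> \<le> C * 1" using that C(1) by (intro mult_left_mono) auto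
    finally show ?thesis by simp
  qed
  have bdd: "bdd_above D" by (rule bdd_aboveI[of _ C]) (use le1 in \<open>auto simp: D_def\<close>)
  have ub: "l2 (cv k f) \<le> s" if "f \<in> R" "l2 f \<le> 1" for f
    unfolding s_def using that by (intro cSup_upper bdd) (auto simp: D_def)
  have s: "s > \<epsilon>" using ub[OF f0(1,2)] f0(3) by simp
  have hom: "l2 (cv k f) \<le> s * l2 f" if f: "f \<in> R" for f
    by (rule l2_cv_homogeneous[OF ka Rap[OF f] ub[OF Rcm[OF f]]])
  have "\<exists>f. f \<in> R \<and> l2 f \<le> 1 \<and> s - 1 / real (Suc n) < l2 (cv k f)" for n
  proof -
    have "s - 1 / real (Suc n) < Sup D" unfolding s_def by simp
    then obtain t where "t \<in> D" "s - 1 / real (Suc n) < t" using f0 bdd less_cSup_iff[of D] by (auto simp: D_def)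
    then show ?thesis by (auto simp: D_def)
  qed
  then obtain F :: "nat \<Rightarrow> 'a \<Rightarrow> complex" where F: "\<And>n. F n \<in> R" "\<And>n. l2 (F n) \<le> 1" "\<And>n. s - 1 / real (Suc n) < l2 (cv k (F n))" by metis
  define u where "u n = cv k (F n)" for n
  have uR: "u n \<in> R" for n unfolding u_def by (intro Rcv F)
  have Fap: "ap (F n)" and uap: "ap (u n)" for n using Rap F(1) uR by auto
  obtain r :: "nat \<Rightarrow> nat" and h where r: "strict_mono r" and
    h: "\<And>\<epsilon>. \<epsilon> > 0 \<Longrightarrow> \<exists>N. \<forall>n\<ge>N. \<forall>x\<in>carrier G. cmod (u (r n) x - h x) \<le> \<epsilon>"
  proof -
    obtain r :: "nat \<Rightarrow> nat" and h where "strict_mono r"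
      "\<forall>\<epsilon>>0. \<exists>N. \<forall>n\<ge>N. \<forall>x\<in>carrier G. cmod (cv k (F (r n)) x - h x) \<le> \<epsilon>"
      using uniform_subsequence[of k F, OF ka Fap F(2)] by (elim exE conjE)
    then show ?thesis by (intro that[of r h]) (simp_all add: u_def)
  qed
  have hR: "h \<in> R"
  proof (rule uclosedD[OF Rcl])
    fix e :: real assume "e > 0"
    then obtain N where "\<forall>x\<in>carrier G. cmod (u (r N) x - h x) \<le> e" using h by blast
    then show "\<exists>g\<in>R. \<forall>x\<in>carrier G. cmod (h x - g x) \<le> e"
      using uR by (intro bexI[of _ "u (r N)"]) (simp_all add: norm_minus_commute)
  qed
  have ha: "ap h" using Rap[OF hR] .
  define w where "w n = (\<lambda>x. cv k (u n) x - complex_of_real (s\<^sup>2) * F n x)" for n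
  have wap: "ap (w n)" for n unfolding w_def by (intro ap_diff ap_cv ap_cmult ka uap Fap)
  have unF: "l2 (u n) \<le> s" for n unfolding u_def by (rule ub[OF F(1,2)])
  have w_le: "(l2 (w n))\<^sup>2 \<le> s\<^sup>2 * (s\<^sup>2 - (l2 (u n))\<^sup>2)" for n
  proof -
    let ?K = "cv k (u n)" and ?c = "complex_of_real (s\<^sup>2)"
    have Ka: "ap ?K" by (intro ap_cv ka uap)
    have cF: "ap (\<lambda>x. ?c * F n x)" by (intro ap_cmult Fap)
    have KF: "ip ?K (F n) = complex_of_real ((l2 (u n))\<^sup>2)"
      using cv_selfadjoint[OF k uap Fap, of n n] ip_self[OF uap, of n] by (simp add: u_def)
    have FK: "ip (F n) ?K = complex_of_real ((l2 (u n))\<^sup>2)"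
      using ip_cnj[OF Ka Fap, of n] KF by simp
    have "ip (w n) (w n) = complex_of_real ((l2 ?K)\<^sup>2 - 2 * s\<^sup>2 * (l2 (u n))\<^sup>2 + s\<^sup>2 * s\<^sup>2 * (l2 (F n))\<^sup>2)"
      unfolding w_def ip_diff_cmult_self[OF Ka Fap] KF FK ip_self[OF Ka] ip_self[OF Fap]
      by (simp add: algebra_simps)
    then have "(l2 (w n))\<^sup>2 = (l2 ?K)\<^sup>2 - 2 * s\<^sup>2 * (l2 (u n))\<^sup>2 + s\<^sup>2 * s\<^sup>2 * (l2 (F n))\<^sup>2"
      unfolding ip_self[OF wap] of_real_eq_iff .
    moreover have "(l2 ?K)\<^sup>2 \<le> s\<^sup>2 * (l2 (u n))\<^sup>2"
      using power_mono[OF hom[OF uR] l2_ge0[OF Ka], of 2] by (simp add: power_mult_distrib)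
    moreover have "s\<^sup>2 * s\<^sup>2 * (l2 (F n))\<^sup>2 \<le> s\<^sup>2 * s\<^sup>2 * 1"
      using F(2) l2_ge0[OF Fap] by (intro mult_left_mono) (auto simp: power_le_one)
    ultimately show ?thesis by (simp add: algebra_simps)
  qed
  have w_lim: "(\<lambda>n. l2 (w (r n))) \<longlonglongrightarrow> 0"
  proof -
    have inv0: "(\<lambda>n. 1 / real (Suc n)) \<longlonglongrightarrow> 0" by (rule LIMSEQ_Suc[OF lim_1_over_n])
    have "(\<lambda>n. l2 (u n)) \<longlonglongrightarrow> s"
    proof (rule tendsto_sandwich[of "\<lambda>n. s - 1 / real (Suc n)" _ _ "\<lambda>n. s"])
      show "(\<lambda>n. s - 1 / real (Suc n)) \<longlonglongrightarrow> s" using tendsto_diff[OF tendsto_const inv0, of s] by simp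
    qed (use F(3) unF in \<open>auto simp: u_def intro!: always_eventually less_imp_le\<close>)
    then have "(\<lambda>n. s\<^sup>2 * (s\<^sup>2 - (l2 (u n))\<^sup>2)) \<longlonglongrightarrow> s\<^sup>2 * (s\<^sup>2 - s\<^sup>2)" by (intro tendsto_intros)
    then have "(\<lambda>n. (l2 (w n))\<^sup>2) \<longlonglongrightarrow> 0"
      by (intro tendsto_sandwich[of "\<lambda>n. 0" "\<lambda>n. (l2 (w n))\<^sup>2" sequentially "\<lambda>n. s\<^sup>2 * (s\<^sup>2 - (l2 (u n))\<^sup>2)" 0])
        (use w_le in \<open>auto intro!: always_eventually\<close>)
    from tendsto_real_sqrt[OF this] have "(\<lambda>n. l2 (w n)) \<longlonglongrightarrow> 0" using l2_ge0[OF wap] by simp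
    then show ?thesis using LIMSEQ_subseq_LIMSEQ[OF _ r] by (simp add: o_def)
  qed
  have hlim: "(\<lambda>n. u (r n) x) \<longlonglongrightarrow> h x" if x: "x \<in> carrier G" for x
    unfolding LIMSEQ_iff
  proof (intro allI impI)
    fix e :: real assume e: "e > 0"
    then obtain N where "\<forall>n\<ge>N. \<forall>x\<in>carrier G. cmod (u (r n) x - h x) \<le> e / 2" using h[of "e/2"] by auto
    then have "cmod (u (r n) x - h x) < e" if "n \<ge> N" for n using that x e by fastforce
    then show "\<exists>N. \<forall>n\<ge>N. cmod (u (r n) x - h x) < e" by blast
  qed
  have eig2: "cv k (cv k h) x = complex_of_real (s\<^sup>2) * h x" if x: "x \<in> carrier G" for x
  proof (rule LIMSEQ_unique)
    show "(\<lambda>n. cv k (cv k (u (r n))) x) \<longlonglongrightarrow> cv k (cv k h) x"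
      unfolding LIMSEQ_iff
    proof (intro allI impI)
      fix e :: real assume e: "e > 0"
      define e' where "e' = e / (2 * C * C)"
      have e': "e' > 0" "C * (C * e') = e / 2" using e C(1) by (simp_all add: e'_def)
      obtain N where N: "\<And>n x. n \<ge> N \<Longrightarrow> x \<in> carrier G \<Longrightarrow> cmod (u (r n) x - h x) \<le> e'" using h[OF e'(1)] by blast
      have "cmod (cv k (cv k (u (r n))) x - cv k (cv k h) x) < e" if n: "n \<ge> N" for n
      proof -
        let ?d = "\<lambda>y. u (r n) y - h y"
        have d: "ap ?d" by (intro ap_diff uap ha)
        have "cv k (cv k (u (r n))) x - cv k (cv k h) x = cv k (\<lambda>y. cv k (u (r n)) y - cv k h y) x"
          by (simp add: cv_diff ka ap_cv uap ha x)
        also have "\<dots> = cv k (cv k ?d) x"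
          by (rule cv_cong[OF _ x]) (simp add: cv_diff ka uap ha)
        also have "cmod \<dots> \<le> C * l2 (cv k ?d)" by (rule cv_sup_le[OF ka ap_cv[OF ka d] C(2) x])
        also have "\<dots> \<le> C * (C * l2 ?d)" using C(1) by (intro mult_left_mono cv_l2_le[OF ka C(2) d]) auto
        also have "\<dots> \<le> C * (C * e')" using C(1) by (intro mult_left_mono l2_le[OF d N[OF n]]) auto
        finally show ?thesis using e' e by simp
      qed
      then show "\<exists>N. \<forall>n\<ge>N. cmod (cv k (cv k (u (r n))) x - cv k (cv k h) x) < e" by blast
    qed
    have "(\<lambda>n. C * l2 (w (r n))) \<longlonglongrightarrow> C * 0" by (intro tendsto_intros w_lim)
    then have "(\<lambda>n. cv k (w (r n)) x) \<longlonglongrightarrow> 0"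
      by (intro Lim_null_comparison[of "\<lambda>n. cv k (w (r n)) x" "\<lambda>n. C * l2 (w (r n))"])
        (auto intro!: always_eventually cv_sup_le ka wap C x)
    moreover have "cv k (w n) x = cv k (cv k (u n)) x - complex_of_real (s\<^sup>2) * u n x" for n
    proof -
      have "cv k (w n) x = cv k (cv k (u n)) x - cv k (\<lambda>x. complex_of_real (s\<^sup>2) * F n x) x"
        unfolding w_def by (intro cv_diff ka ap_cv uap ap_cmult Fap x)
      then show ?thesis unfolding cv_cmult[OF ka Fap x] u_def .
    qed
    ultimately have "(\<lambda>n. cv k (cv k (u (r n))) x - complex_of_real (s\<^sup>2) * u (r n) x) \<longlonglongrightarrow> 0" by simp
    from tendsto_add[OF this tendsto_mult[OF tendsto_const[of "complex_of_real (s\<^sup>2)"] hlim[OF x]]]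
    show "(\<lambda>n. cv k (cv k (u (r n))) x) \<longlonglongrightarrow> complex_of_real (s\<^sup>2) * h x" by simp
  qed
  have hne: "\<exists>x\<in>carrier G. h x \<noteq> 0"
  proof (rule ccontr)
    assume z: "\<not> (\<exists>x\<in>carrier G. h x \<noteq> 0)"
    have e2: "\<epsilon> / 2 > 0" using eps by simp
    obtain N where N: "\<forall>n\<ge>N. \<forall>x\<in>carrier G. cmod (u (r n) x - h x) \<le> \<epsilon> / 2" using h[OF e2] by blast
    obtain M where M: "1 / real (Suc M) < s - \<epsilon> / 2" using nat_approx_posE[of "s - \<epsilon>/2"] s eps by auto
    define n where "n = max N M"
    have "l2 (u (r n)) \<le> \<epsilon> / 2" using N z by (intro l2_le uap) (auto simp: n_def)
    moreover have "s - 1 / real (Suc (r n)) < l2 (u (r n))" using F(3) by (simp add: u_def)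
    moreover have "1 / real (Suc (r n)) \<le> 1 / real (Suc M)"
      using seq_suble[OF r, of n] by (intro frac_le) (auto simp: n_def)
    ultimately show False using M by linarith
  qed
  \<comment> \<open>\<open>(K - s) (K + s) h = 0\<close>\<close>
  define v where "v = (\<lambda>x. cv k h x + complex_of_real s * h x)"
  have vR: "v \<in> R" unfolding v_def by (intro Radd Rcv Rcm hR)
  show ?thesis
  proof (cases "\<exists>x\<in>carrier G. v x \<noteq> 0")
    case True
    have "cv k v x = complex_of_real s * v x" if x: "x \<in> carrier G" for x
    proof -
      have "cv k v x = cv k (cv k h) x + cv k (\<lambda>x. complex_of_real s * h x) x"
        unfolding v_def by (intro cv_add ka ap_cv ap_cmult ha x)
      also have "\<dots> = complex_of_real s * v x"
        unfolding cv_cmult[OF ka ha x] eig2[OF x] by (simp add: v_def power2_eq_square algebra_simps)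
      finally show ?thesis .
    qed
    then show ?thesis using True vR s eps by (intro exI[of _ v] exI[of _ s]) auto
  next
    case False
    then have "cv k h x = complex_of_real (- s) * h x" if "x \<in> carrier G" for x
      using that by (simp add: v_def add_eq_0_iff)
    then show ?thesis using hne hR s eps by (intro exI[of _ h] exI[of _ "- s"]) auto
  qed
qed

definition eigenspace :: "('a \<Rightarrow> complex) set \<Rightarrow> ('a \<Rightarrow> complex) \<Rightarrow> real \<Rightarrow> ('a \<Rightarrow> complex) set" where
  "eigenspace A k \<mu> = {f \<in> A. \<forall>x\<in>carrier G. cv k f x = complex_of_real \<mu> * f x}"

lemma inv_space_eigenspace:
  assumes k: "conv_kernel k" and A: "inv_space A" shows "inv_space (eigenspace A k \<mu>)"
  unfolding inv_space_def
proof (intro conjI ballI allI impI)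
  note ap = inv_space_ap[OF A] and ka = kernel_ap[OF k]
  show "ap f" if "f \<in> eigenspace A k \<mu>" for f using that ap by (auto simp: eigenspace_def)
  show "(\<lambda>_. 0) \<in> eigenspace A k \<mu>" using inv_space_0[OF A] by (auto simp: eigenspace_def cv_def)
  show "(\<lambda>x. f x + h x) \<in> eigenspace A k \<mu>" if "f \<in> eigenspace A k \<mu>" "h \<in> eigenspace A k \<mu>" for f h
    using that inv_space_add[OF A] ap ka by (auto simp: eigenspace_def cv_add distrib_left)
  show "(\<lambda>x. c * f x) \<in> eigenspace A k \<mu>" if "f \<in> eigenspace A k \<mu>" for f c
    using that inv_space_cmult[OF A] ap ka by (auto simp: eigenspace_def cv_cmult)
  show "L g f \<in> eigenspace A k \<mu>" if "g \<in> carrier G" "f \<in> eigenspace A k \<mu>" for f g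
    using that inv_space_L[OF A] ap cv_L[OF k] by (auto simp: eigenspace_def L_def)
  show "f' \<in> eigenspace A k \<mu>" if "f \<in> eigenspace A k \<mu>" "\<forall>x\<in>carrier G. f' x = f x" for f f'
    using that inv_space_cong[OF A, of f f'] cv_cong[of f' f] by (auto simp: eigenspace_def)
qed

lemma eigenspace_bounded:
  assumes k: "conv_kernel k" and m: "\<mu> \<noteq> 0" shows "\<exists>B. onf_bounded (eigenspace A k \<mu>) B"
proof -
  have ka: "ap k" using kernel_ap[OF k] .
  obtain C where C: "C > 0" "\<And>g. g \<in> carrier G \<Longrightarrow> cmod (k g) \<le> C" using ap_bounded[OF ka] by blast
  have "d \<le> nat \<lceil>C\<^sup>2 / \<bar>\<mu>\<bar>\<^sup>2\<rceil>" if e: "onf d e" "\<forall>i<d. e i \<in> eigenspace A k \<mu>" for d e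
  proof -
    have "real d \<le> C\<^sup>2 / \<bar>\<mu>\<bar>\<^sup>2"
      using e m by (intro eigen_bessel[OF ka C e(1), of "\<lambda>_. \<mu>"]) (auto simp: eigenspace_def)
    then show ?thesis by linarith
  qed
  then show ?thesis unfolding onf_bounded_def by blast
qed

text \<open>
  Density of the finite-dimensional invariant spaces, in the form in which it separates \<open>A\<close> from a
  smaller uniformly closed invariant space \<open>P\<close>.
  For \<open>a \<in> A - P\<close> a central kernel is chosen whose twofold convolution hardly changes \<open>a\<close>. If all
  eigenspaces to nonzero eigenvalues were contained in \<open>P\<close>, one could remove from \<open>a\<close> its components
  along a maximal orthonormal family of eigenvectors with eigenvalues of modulus at least \<open>\<delta>\<close>; on the remainder
  convolution is small, so \<open>a\<close> would be close to \<open>P\<close>. Hence some eigenspace is not contained in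
  \<open>P\<close>; it is invariant and finite-dimensional.
\<close>

lemma Peter_Weyl:
  assumes A: "inv_space A" "uclosed A" and P: "inv_space P" "uclosed P" and PA: "P \<subseteq> A" "P \<noteq> A"
  shows "\<exists>V d e. irr V \<and> V \<subseteq> A \<and> \<not> V \<subseteq> P \<and> basis V d e"
proof -
  obtain a where a: "a \<in> A" "a \<notin> P" using PA by blast
  have aa: "ap a" using inv_space_ap[OF A(1) a(1)] .
  obtain \<epsilon> where eps: "\<epsilon> > 0" "\<And>h. h \<in> P \<Longrightarrow> \<exists>x\<in>carrier G. cmod (a x - h x) > \<epsilon>"
    using a(2) uclosedD[OF P(2), of a] by (meson not_le)
  have e3: "\<epsilon> / 3 > 0" using eps(1) by simp
  obtain k where k: "conv_kernel k" and
    knear: "\<And>g x. g \<in> carrier G \<Longrightarrow> k g \<noteq> 0 \<Longrightarrow> x \<in> carrier G \<Longrightarrow> cmod (a (inv g \<otimes> x) - a x) \<le> \<epsilon> / 3"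
    using kernel_exists[OF aa e3] by blast
  have ka: "ap k" using kernel_ap[OF k] .
  have K1: "cmod (cv k a x - a x) \<le> \<epsilon> / 3" if "x \<in> carrier G" for x
    using knear that by (intro cv_near_id[OF k aa that])
  have K2: "cmod (cv k (cv k a) x - a x) \<le> 2 * \<epsilon> / 3" if x: "x \<in> carrier G" for x
  proof (rule cv_near_id[OF k ap_cv[OF ka aa] x])
    fix g assume g: "g \<in> carrier G" "k g \<noteq> 0"
    have 1: "cmod (cv k a (inv g \<otimes> x) - a (inv g \<otimes> x)) \<le> \<epsilon> / 3" using g x by (intro K1) auto
    from norm_triangle_mono[OF 1 knear[OF g x]]
    show "cmod (cv k a (inv g \<otimes> x) - a x) \<le> 2 * \<epsilon> / 3" by simp
  qed
  obtain C where C: "C > 0" "\<And>g. g \<in> carrier G \<Longrightarrow> cmod (k g) \<le> C" using ap_bounded[OF ka] by blast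
  have "\<exists>\<mu>. \<mu> \<noteq> 0 \<and> \<not> eigenspace A k \<mu> \<subseteq> P"
  proof (rule ccontr)
    assume "\<not> ?thesis"
    then have EP: "f \<in> P" if "\<mu> \<noteq> 0" "f \<in> eigenspace A k \<mu>" for f \<mu> using that by blast
    \<comment> \<open>small enough that two convolutions of the remainder of \<open>a\<close> contribute at most \<open>\<epsilon> / 3\<close>\<close>
    define \<delta> where "\<delta> = \<epsilon> / (3 * C * (l2 a + 1))"
    have l1: "l2 a + 1 > 0" using l2_ge0[OF aa] by simp
    have dl: "\<delta> > 0" "C * (\<delta> * (l2 a + 1)) = \<epsilon> / 3" using eps(1) C(1) l1 by (simp_all add: \<delta>_def)
    define Q where "Q d \<longleftrightarrow> (\<exists>e \<mu>. onf d e \<and> (\<forall>i<d. \<delta> \<le> \<bar>\<mu> i\<bar> \<and> e i \<in> eigenspace A k (\<mu> i)))" for d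
    have Qb: "d \<le> nat \<lceil>C\<^sup>2 / \<delta>\<^sup>2\<rceil>" if qd: "Q d" for d
    proof -
      obtain e \<mu> where e: "onf d e" "\<forall>i<d. \<delta> \<le> \<bar>\<mu> i\<bar> \<and> e i \<in> eigenspace A k (\<mu> i)" using qd unfolding Q_def by blast
      have "real d \<le> C\<^sup>2 / \<delta>\<^sup>2"
        using e(2) dl(1) by (intro eigen_bessel[OF ka C e(1), of \<mu>]) (auto simp: eigenspace_def)
      then show ?thesis by linarith
    qed
    have Q0: "Q 0" by (simp add: Q_def onf_0)
    define d where "d = (GREATEST d. Q d)"
    have Qd: "Q d" unfolding d_def using Q0 Qb by (rule GreatestI_nat)
    have nQ: "\<not> Q (Suc d)"
    proof
      assume "Q (Suc d)"
      then have "Suc d \<le> d" unfolding d_def using Qb by (rule Greatest_le_nat)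
      then show False by simp
    qed
    obtain e \<mu> where e: "onf d e" and m: "\<And>i. i < d \<Longrightarrow> \<delta> \<le> \<bar>\<mu> i\<bar>" and
      eE: "\<And>i. i < d \<Longrightarrow> e i \<in> eigenspace A k (\<mu> i)" using Qd unfolding Q_def by blast
    have eA: "e i \<in> A" if "i < d" for i using eE[OF that] by (simp add: eigenspace_def)
    have eig: "cv k (e i) x = complex_of_real (\<mu> i) * e i x" if "i < d" "x \<in> carrier G" for i x
      using eE[OF that(1)] that(2) by (simp add: eigenspace_def)
    define R where "R = orth A (e ` {..<d})"
    have RA: "f \<in> A" and Ro: "i < d \<Longrightarrow> ip f (e i) = 0" if "f \<in> R" for f i
      using that by (auto simp: R_def orth_def)
    have Rap: "ap f" if "f \<in> R" for f using inv_space_ap[OF A(1) RA[OF that]] .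
    have Radd: "(\<lambda>x. f x + h x) \<in> R" if "f \<in> R" "h \<in> R" for f h
      using that inv_space_add[OF A(1)] onf_ap[OF e] Rap by (auto simp: R_def orth_def ip_add)
    have Rcm: "(\<lambda>x. c * f x) \<in> R" if "f \<in> R" for f c
      using that inv_space_cmult[OF A(1)] onf_ap[OF e] Rap by (auto simp: R_def orth_def ip_cmult)
    have Rcv: "cv k f \<in> R" if f: "f \<in> R" for f
    proof -
      have "ip (cv k f) (e i) = 0" if i: "i < d" for i
      proof -
        have "ip (cv k f) (e i) = ip f (cv k (e i))" by (rule cv_selfadjoint[OF k Rap[OF f] onf_ap[OF e i]])
        also have "\<dots> = ip f (\<lambda>x. complex_of_real (\<mu> i) * e i x)" using eig[OF i] by (intro ip_cong) auto
        also have "\<dots> = 0" using Ro[OF f i] by (simp add: ip_cmult_right Rap[OF f] onf_ap[OF e i])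
        finally show ?thesis .
      qed
      then show ?thesis using cv_in[OF A RA[OF f] ka] by (simp add: R_def orth_def)
    qed
    have Rcl: "uclosed R" unfolding R_def using onf_ap[OF e] by (intro uclosed_orth A) auto
    have gap: "l2 (cv k f) \<le> \<delta>" if f: "f \<in> R" "l2 f \<le> 1" for f
    proof (rule ccontr)
      assume "\<not> l2 (cv k f) \<le> \<delta>"
      then have "l2 (cv k f) > \<delta>" by simp
      from spectral_gap[of k R f \<delta>, OF k Rap Radd Rcm Rcl Rcv f this dl(1)]
      obtain h \<nu> y where h: "h \<in> R" "y \<in> carrier G" "h y \<noteq> 0" "\<delta> \<le> \<bar>\<nu>\<bar>"
        "\<And>x. x \<in> carrier G \<Longrightarrow> cv k h x = complex_of_real \<nu> * h x" by blast
      define q where "q = (\<lambda>x. complex_of_real (1 / l2 h) * h x)"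
      have on: "onf (Suc d) (e(d := q))"
        unfolding q_def by (rule onf_extend[OF e Rap[OF h(1)] Ro[OF h(1)] h(2,3)])
      have "h \<in> eigenspace A k \<nu>" using RA[OF h(1)] h(5) by (simp add: eigenspace_def)
      then have qE: "q \<in> eigenspace A k \<nu>"
        unfolding q_def by (rule inv_space_cmult[OF inv_space_eigenspace[OF k A(1)]])
      have "Q (Suc d)" unfolding Q_def
        by (intro exI[of _ "e(d := q)"] exI[of _ "\<mu>(d := \<nu>)"] conjI on) (use qE h(4) m eE in \<open>auto simp: less_Suc_eq\<close>)
      then show False using nQ by simp
    qed
    define a' where "a' = (\<lambda>x. a x - proj d e a x)"
    have pA: "proj d e a \<in> A" by (rule proj_in[OF A(1) eA])
    have a'R: "a' \<in> R"
      unfolding R_def orth_def a'_def using inv_space_diff[OF A(1) a(1) pA] ip_residue[OF e aa] by simp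
    have l2a': "l2 a' \<le> l2 a" unfolding a'_def by (rule l2_residue[OF e aa])
    have a'a: "ap a'" using Rap[OF a'R] .
    have "l2 (cv k a') \<le> \<delta> * l2 a'" by (rule l2_cv_homogeneous[OF ka a'a gap[OF Rcm[OF a'R]]])
    also have "\<dots> \<le> \<delta> * (l2 a + 1)" using l2a' dl(1) by (intro mult_left_mono) auto
    finally have l2K: "l2 (cv k a') \<le> \<delta> * (l2 a + 1)" .
    define b where "b = (\<lambda>x. \<Sum>i<d. (ip a (e i) * (complex_of_real (\<mu> i))\<^sup>2) * e i x)"
    have bP: "b \<in> P" unfolding b_def
    proof (intro inv_space_sum[OF P(1)] inv_space_cmult[OF P(1)])
      fix i assume "i \<in> {..<d}"
      then show "e i \<in> P" using EP[of "\<mu> i" "e i"] m[of i] eE[of i] dl(1) by auto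
    qed simp
    have "cmod (a x - b x) \<le> \<epsilon>" if x: "x \<in> carrier G" for x
    proof -
      have KKp: "cv k (cv k (proj d e a)) x = b x"
      proof -
        have 1: "cv k (\<lambda>x. \<Sum>i<d. c i * e i x) y = (\<Sum>i<d. (c i * complex_of_real (\<mu> i)) * e i y)"
          if y: "y \<in> carrier G" for c y
        proof -
          have "cv k (\<lambda>x. \<Sum>i<d. c i * e i x) y = (\<Sum>i<d. cv k (\<lambda>x. c i * e i x) y)"
            by (intro cv_sum ka y ap_cmult) (auto intro: onf_ap[OF e])
          also have "\<dots> = (\<Sum>i<d. (c i * complex_of_real (\<mu> i)) * e i y)"
            using y onf_ap[OF e] eig by (intro sum.cong refl) (simp add: cv_cmult ka)
          finally show ?thesis .
        qed
        have "cv k (cv k (proj d e a)) x = cv k (\<lambda>x. \<Sum>i<d. (ip a (e i) * complex_of_real (\<mu> i)) * e i x) x"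
          by (rule cv_cong[OF _ x]) (simp only: proj_def 1)
        also have "\<dots> = b x" unfolding 1[OF x] b_def by (simp add: power2_eq_square mult.assoc)
        finally show ?thesis .
      qed
      have "cv k (cv k a') x = cv k (cv k a) x - cv k (cv k (proj d e a)) x"
      proof -
        have "cv k (cv k a') x = cv k (\<lambda>y. cv k a y - cv k (proj d e a) y) x"
          unfolding a'_def by (rule cv_cong[OF _ x]) (intro cv_diff ka aa ap_proj e)
        also have "\<dots> = cv k (cv k a) x - cv k (cv k (proj d e a)) x"
          by (intro cv_diff ka aa ap_proj e ap_cv x)
        finally show ?thesis .
      qed
      then have eq: "cv k (cv k a) x - b x = cv k (cv k a') x" using KKp by simp
      have "cmod (cv k (cv k a') x) \<le> C * l2 (cv k a')" by (rule cv_sup_le[OF ka ap_cv[OF ka a'a] C(2) x])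
      also have "\<dots> \<le> \<epsilon> / 3" using l2K C(1) dl(2)[symmetric] by (simp add: mult_left_mono)
      finally have 2: "cmod (cv k (cv k a) x - b x) \<le> \<epsilon> / 3" using eq by simp
      have 3: "cmod (a x - cv k (cv k a) x) \<le> 2 * \<epsilon> / 3" using K2[OF x] by (simp add: norm_minus_commute)
      from norm_triangle_mono[OF 3 2] show ?thesis by simp
    qed
    then show False using eps(2)[OF bP] by (meson not_le)
  qed
  then obtain \<mu> where m: "\<mu> \<noteq> 0" "\<not> eigenspace A k \<mu> \<subseteq> P" by blast
  obtain B where B: "onf_bounded (eigenspace A k \<mu>) B" using eigenspace_bounded[OF k m(1)] by blast
  have EA: "eigenspace A k \<mu> \<subseteq> A" by (auto simp: eigenspace_def)
  obtain V d e where V: "irr V" "V \<subseteq> eigenspace A k \<mu>" "\<not> V \<subseteq> P" "basis V d e"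
    using irr_subspace[OF inv_space_eigenspace[OF k A(1)] B P(1) m(2)] by blast
  have "V \<subseteq> A" using V(2) EA by (rule order_trans)
  then show ?thesis using V(1,3,4) by blast
qed

end

section \<open>Inverses, conjugate spaces, and equivariant projections\<close>

context Group.group
begin

text \<open>
  The Neumann series of \<open>1 / p\<close> around the upper bound \<open>C\<close> of \<open>p\<close> converges uniformly, as \<open>p\<close>
  takes its values in \<open>[\<delta>, C]\<close>.
\<close>

lemma inverse_in:
  assumes A: "inv_space A" "uclosed A" and mult: "\<And>f h. f \<in> A \<Longrightarrow> h \<in> A \<Longrightarrow> (\<lambda>x. f x * h x) \<in> A"
    and one: "(\<lambda>_. 1) \<in> A" and p: "p \<in> A" and d: "\<delta> > 0"
    and pos: "\<And>x. x \<in> carrier G \<Longrightarrow> Im (p x) = 0" "\<And>x. x \<in> carrier G \<Longrightarrow> \<delta> \<le> Re (p x)"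
  shows "(\<lambda>x. 1 / p x) \<in> A"
proof (rule uclosedD[OF A(2)])
  fix \<epsilon> :: real assume e: "\<epsilon> > 0"
  obtain C where C: "C > 0" "\<And>g. g \<in> carrier G \<Longrightarrow> cmod (p g) \<le> C" using ap_bounded[OF inv_space_ap[OF A(1) p]] by blast
  define r where "r = (\<lambda>x. 1 - complex_of_real (1/C) * p x)"
  define \<theta> where "\<theta> = 1 - \<delta> / C"
  have rA: "r \<in> A" unfolding r_def by (intro inv_space_diff[OF A(1)] inv_space_cmult[OF A(1)] one p)
  have powA: "(\<lambda>x. r x ^ j) \<in> A" for j
  proof (induction j)
    case (Suc j)
    then show ?case using mult[OF rA Suc] by simp
  qed (simp add: one)
  define S where "S m = (\<lambda>x. complex_of_real (1/C) * (\<Sum>j<m. r x ^ j))" for m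
  have SA: "S m \<in> A" for m unfolding S_def
    by (intro inv_space_cmult[OF A(1)] inv_space_sum[OF A(1)] powA) simp
  have preal: "p x = complex_of_real (Re (p x))" if "x \<in> carrier G" for x
    using pos(1)[OF that] by (simp add: complex_eq_iff)
  have le: "\<delta> \<le> C" using pos(2)[OF one_closed] C(2)[OF one_closed] complex_Re_le_cmod[of "p \<one>"] by linarith
  have th: "0 \<le> \<theta>" "\<theta> < 1" using le d C(1) by (auto simp: \<theta>_def pos_divide_le_eq)
  have bound: "cmod (1 / p x - S m x) \<le> \<theta> ^ m / \<delta>" if x: "x \<in> carrier G" for m x
  proof -
    define t where "t = Re (p x)"
    have t: "\<delta> \<le> t" "t \<le> C" "t > 0" "p x = complex_of_real t"
      using pos(2)[OF x] C(2)[OF x] complex_Re_le_cmod[of "p x"] d preal[OF x] unfolding t_def by linarith+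
    have rx: "r x = complex_of_real (1 - t / C)" unfolding r_def t(4) by simp
    have "1 - r x = p x * complex_of_real (1/C)" by (simp add: r_def)
    then have "p x * S m x = (1 - r x) * (\<Sum>j<m. r x ^ j)" by (simp add: S_def)
    also have "\<dots> = 1 - r x ^ m" by (rule one_diff_power_eq[symmetric])
    finally have "1 / p x - S m x = r x ^ m / p x" using t(3,4) by (simp add: field_simps)
    then have "cmod (1 / p x - S m x) = cmod (r x) ^ m / t" using t(3,4) by (simp add: norm_divide norm_power)
    also have "cmod (r x) = 1 - t / C" unfolding rx norm_of_real using t C(1) by (simp add: pos_divide_le_eq)
    also have "(1 - t / C) ^ m / t \<le> \<theta> ^ m / \<delta>"
      using t C(1) d by (intro frac_le power_mono) (auto simp: \<theta>_def divide_right_mono pos_divide_le_eq)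
    finally show ?thesis .
  qed
  have "(\<lambda>m. \<theta> ^ m / \<delta>) \<longlonglongrightarrow> 0 / \<delta>" using th by (intro tendsto_divide LIMSEQ_power_zero tendsto_const) (use d in auto)
  then have "\<forall>\<^sub>F m in sequentially. \<theta> ^ m / \<delta> < \<epsilon>" using e by (intro order_tendstoD) auto
  then obtain m where m: "\<theta> ^ m / \<delta> < \<epsilon>" by (meson eventually_happens trivial_limit_sequentially)
  show "\<exists>h\<in>A. \<forall>x\<in>carrier G. cmod (1 / p x - h x) \<le> \<epsilon>"
    by (rule bexI[OF _ SA[of m]]) (use bound[of _ m] m in force)
qed

lemma inv_space_Int: assumes V: "inv_space V" and W: "inv_space W" shows "inv_space (V \<inter> W)"
  unfolding inv_space_def
proof (intro conjI ballI allI impI)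
  show "ap f" if "f \<in> V \<inter> W" for f using that inv_space_ap[OF V] by simp
  show "(\<lambda>_. 0) \<in> V \<inter> W" using inv_space_0[OF V] inv_space_0[OF W] by simp
  show "(\<lambda>x. f x + h x) \<in> V \<inter> W" if "f \<in> V \<inter> W" "h \<in> V \<inter> W" for f h
    using that inv_space_add[OF V] inv_space_add[OF W] by simp
  show "(\<lambda>x. c * f x) \<in> V \<inter> W" if "f \<in> V \<inter> W" for f c
    using that inv_space_cmult[OF V] inv_space_cmult[OF W] by simp
  show "L g f \<in> V \<inter> W" if "g \<in> carrier G" "f \<in> V \<inter> W" for f g
    using that inv_space_L[OF V] inv_space_L[OF W] by simp
  show "f' \<in> V \<inter> W" if "f \<in> V \<inter> W" "\<forall>x\<in>carrier G. f' x = f x" for f f'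
    using that inv_space_cong[OF V, of f f'] inv_space_cong[OF W, of f f'] by simp
qed

lemma uclosed_Int: assumes V: "uclosed V" and W: "uclosed W" shows "uclosed (V \<inter> W)"
  unfolding uclosed_def
proof (intro allI impI IntI)
  fix f assume f: "\<forall>\<epsilon>>0. \<exists>h\<in>V \<inter> W. \<forall>x\<in>carrier G. cmod (f x - h x) \<le> \<epsilon>"
  show "f \<in> V" by (rule uclosedD[OF V]) (use f in blast)
  show "f \<in> W" by (rule uclosedD[OF W]) (use f in blast)
qed

definition cnj_space :: "('a \<Rightarrow> complex) set \<Rightarrow> ('a \<Rightarrow> complex) set" where
  "cnj_space V = {F. (\<lambda>x. cnj (F x)) \<in> V}"

lemma cnj_space_cnj: "cnj_space (cnj_space V) = V" by (simp add: cnj_space_def)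

lemma cnj_space_mono: "V \<subseteq> W \<Longrightarrow> cnj_space V \<subseteq> cnj_space W" by (auto simp: cnj_space_def)

lemma cnj_in_cnj_space: "F \<in> V \<Longrightarrow> (\<lambda>x. cnj (F x)) \<in> cnj_space V" by (simp add: cnj_space_def)

lemma inv_space_cnj: assumes V: "inv_space V" shows "inv_space (cnj_space V)"
  unfolding inv_space_def
proof (intro conjI ballI allI impI)
  show "ap f" if "f \<in> cnj_space V" for f
    using ap_cnj[OF inv_space_ap[OF V]] that by (fastforce simp: cnj_space_def)
  show "(\<lambda>_. 0) \<in> cnj_space V" using inv_space_0[OF V] by (simp add: cnj_space_def)
  show "(\<lambda>x. f x + h x) \<in> cnj_space V" if "f \<in> cnj_space V" "h \<in> cnj_space V" for f h
    using that inv_space_add[OF V] by (simp add: cnj_space_def)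
  show "(\<lambda>x. c * f x) \<in> cnj_space V" if "f \<in> cnj_space V" for f c
    using that inv_space_cmult[OF V, of _ "cnj c"] by (simp add: cnj_space_def)
  show "L g f \<in> cnj_space V" if "g \<in> carrier G" "f \<in> cnj_space V" for f g
    using that inv_space_L[OF V, of "\<lambda>x. cnj (f x)" g] by (simp add: cnj_space_def L_def)
  show "f' \<in> cnj_space V" if "f \<in> cnj_space V" "\<forall>x\<in>carrier G. f' x = f x" for f f'
    using that inv_space_cong[OF V, of "\<lambda>x. cnj (f x)" "\<lambda>x. cnj (f' x)"] by (simp add: cnj_space_def)
qed

lemma uclosed_cnj: assumes V: "uclosed V" shows "uclosed (cnj_space V)"
  unfolding uclosed_def
proof (intro allI impI)
  fix f assume f: "\<forall>\<epsilon>>0. \<exists>h\<in>cnj_space V. \<forall>x\<in>carrier G. cmod (f x - h x) \<le> \<epsilon>"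
  have "(\<lambda>x. cnj (f x)) \<in> V"
  proof (rule uclosedD[OF V])
    fix \<epsilon> :: real assume "\<epsilon> > 0"
    then obtain h where h: "h \<in> cnj_space V" "\<forall>x\<in>carrier G. cmod (f x - h x) \<le> \<epsilon>" using f by blast
    have "cmod (cnj (f x) - cnj (h x)) = cmod (f x - h x)" for x
      by (simp flip: complex_cnj_diff)
    then show "\<exists>h\<in>V. \<forall>x\<in>carrier G. cmod (cnj (f x) - h x) \<le> \<epsilon>"
      using h by (intro bexI[of _ "\<lambda>x. cnj (h x)"]) (simp_all add: cnj_space_def)
  qed
  then show "f \<in> cnj_space V" by (simp add: cnj_space_def)
qed

lemma zero_space_cnj: "zero_space (cnj_space V) \<longleftrightarrow> zero_space V"
proof -
  have "zero_space W" if z: "zero_space (cnj_space W)" for W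
    unfolding zero_space_def
  proof (intro ballI)
    fix f x assume f: "f \<in> W" and x: "x \<in> carrier G"
    have "cnj (f x) = 0" using z[unfolded zero_space_def, rule_format, OF cnj_in_cnj_space[OF f] x] .
    then show "f x = 0" by simp
  qed
  from this[of V] this[of "cnj_space V"] show ?thesis unfolding cnj_space_cnj by (rule iffI)
qed

lemma irr_cnj: assumes V: "irr V" shows "irr (cnj_space V)"
  unfolding irr_def
proof (intro conjI allI impI)
  show "inv_space (cnj_space V)" "\<not> zero_space (cnj_space V)"
    using V inv_space_cnj by (auto simp: irr_def zero_space_cnj)
  fix W assume W: "inv_space W" "W \<subseteq> cnj_space V"
  have "cnj_space W \<subseteq> V" using cnj_space_mono[OF W(2)] unfolding cnj_space_cnj .
  then have "zero_space (cnj_space W) \<or> cnj_space W = V"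
    using V inv_space_cnj[OF W(1)] unfolding irr_def by blast
  then show "zero_space W \<or> W = cnj_space V" unfolding zero_space_cnj using cnj_space_cnj[of W] by auto
qed

lemma ip_cnj_cnj: "ap f \<Longrightarrow> ap h \<Longrightarrow> ip (\<lambda>x. cnj (f x)) (\<lambda>x. cnj (h x)) = cnj (ip f h)"
  unfolding ip_def by (subst mean_cnj[symmetric]) (auto simp: ap_ip)

lemma basis_cnj: assumes V: "inv_space V" and e: "basis V d e" shows "basis (cnj_space V) d (\<lambda>i x. cnj (e i x))"
  unfolding basis_def
proof (intro conjI ballI allI impI)
  have on: "onf d e" and eV: "\<And>i. i < d \<Longrightarrow> e i \<in> V" and
    sp: "\<And>f x. f \<in> V \<Longrightarrow> x \<in> carrier G \<Longrightarrow> f x = proj d e f x" using e unfolding basis_def by blast+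
  show "onf d (\<lambda>i x. cnj (e i x))"
    unfolding onf_def using onf_ap[OF on] onf_ip[OF on] by (simp add: ap_cnj ip_cnj_cnj)
  show "(\<lambda>x. cnj (e i x)) \<in> cnj_space V" if "i < d" for i using eV[OF that] by (rule cnj_in_cnj_space)
  fix f x assume f: "f \<in> cnj_space V" and x: "x \<in> carrier G"
  have fV: "(\<lambda>x. cnj (f x)) \<in> V" using f by (simp add: cnj_space_def)
  have "ap (\<lambda>x. cnj (cnj (f x)))" by (rule ap_cnj[OF inv_space_ap[OF V fV]])
  then have fa: "ap f" by simp
  have "ip (\<lambda>x. cnj (f x)) (e i) = cnj (ip f (\<lambda>x. cnj (e i x)))" if "i < d" for i
    using ip_cnj_cnj[OF fa ap_cnj[OF onf_ap[OF on that]]] by simp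
  then have "proj d e (\<lambda>x. cnj (f x)) x = cnj (proj d (\<lambda>i x. cnj (e i x)) f x)"
    by (simp add: proj_def)
  then have "cnj (f x) = cnj (proj d (\<lambda>i x. cnj (e i x)) f x)" using sp[OF fV x] by simp
  then show "f x = proj d (\<lambda>i x. cnj (e i x)) f x" by simp
qed

text \<open>
  The projection is characterised by its inner products with the invariant space, which makes it
  commute with translations.
\<close>

lemma ip_proj_eq:
  assumes U: "inv_space U" and u: "basis U d u" and f: "ap f" and h: "h \<in> U"
  shows "ip (proj d u f) h = ip f h"
proof -
  have on: "onf d u" using u by (simp add: basis_def)
  have q: "ap (\<lambda>x. f x - proj d u f x)" by (intro ap_diff f ap_proj on)
  have ha: "ap h" using inv_space_ap[OF U h] .
  have "ip (\<lambda>x. f x - proj d u f x) h = ip (\<lambda>x. f x - proj d u f x) (\<lambda>x. \<Sum>i<d. ip h (u i) * u i x)"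
    using u h unfolding basis_def proj_def by (intro ip_cong) auto
  also have "\<dots> = 0" by (rule ip_orth_comb[OF on q ip_residue[OF on f]])
  finally show ?thesis using ip_diff[OF f ap_proj[OF on] ha] by simp
qed

lemma proj_L:
  assumes U: "inv_space U" and u: "basis U d u" and f: "ap f" and g: "g \<in> carrier G" and x: "x \<in> carrier G"
  shows "proj d u (L g f) x = L g (proj d u f) x"
proof -
  have on: "onf d u" and uU: "\<And>i. i < d \<Longrightarrow> u i \<in> U" using u unfolding basis_def by blast+
  have pa: "ap (proj d u f)" by (rule ap_proj[OF on])
  have "L g (proj d u f) \<in> U" using g by (intro inv_space_L[OF U] proj_in[OF U] uU)
  then have "L g (proj d u f) x = proj d u (L g (proj d u f)) x" using u x unfolding basis_def by blast
  also have "\<dots> = proj d u (L g f) x"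
    unfolding proj_def
  proof (intro sum.cong refl arg_cong2[where f = "(*)"])
    fix i assume "i \<in> {..<d}"
    then have i: "i < d" by simp
    have "ip (L g (proj d u f)) (u i) = ip (proj d u f) (L (inv g) (u i))"
      by (rule ip_L_move[OF pa onf_ap[OF on i] g])
    also have "\<dots> = ip f (L (inv g) (u i))"
      using g by (intro ip_proj_eq[OF U u f] inv_space_L[OF U] uU i) auto
    also have "\<dots> = ip (L g f) (u i)" by (rule ip_L_move[OF f onf_ap[OF on i] g, symmetric])
    finally show "ip (L g (\<lambda>x. \<Sum>i<d. ip f (u i) * u i x)) (u i) = ip (L g f) (u i)" unfolding proj_def .
  qed
  finally show ?thesis ..
qed

end

section \<open>Compact groups and their homogeneous spaces\<close>

locale compact_group = Group.group G for G :: "('g, 'm) monoid_scheme" (structure) +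
  fixes T :: "'g topology"
  assumes topspace_carrier: "topspace T = carrier G"
    and compact: "compact_space T"
    and continuous_mult: "continuous_map (prod_topology T T) T (\<lambda>(g, h). g \<otimes> h)"
    and continuous_inv: "continuous_map T T (\<lambda>g. inv g)"
begin

lemma cm_mult: "continuous_map Y T a \<Longrightarrow> continuous_map Y T b \<Longrightarrow> continuous_map Y T (\<lambda>x. a x \<otimes> b x)"
  using continuous_map_compose[OF continuous_map_pairedI continuous_mult, of Y a b] by (simp add: o_def)

text \<open>
  Tube lemma for the compact parameter space \<open>T \<times> T\<close>: closeness at \<open>g0\<close> for all \<open>h, z\<close> spreads to
  a neighbourhood of \<open>g0\<close>.
\<close>

lemma near_nbhd:
  assumes f: "continuous_map T euclidean f" and g0: "g0 \<in> carrier G" and e: "\<epsilon> > 0"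
  shows "\<exists>U. openin T U \<and> g0 \<in> U \<and> (\<forall>g\<in>U. near f \<epsilon> g g0)"
proof -
  define Y where "Y = prod_topology T T"
  define F where "F p = f (fst (snd p) \<otimes> fst p \<otimes> snd (snd p)) - f (fst (snd p) \<otimes> g0 \<otimes> snd (snd p))" for p
  have p1: "continuous_map (prod_topology T Y) T fst" by (rule continuous_map_fst)
  have p2: "continuous_map (prod_topology T Y) T (\<lambda>p. fst (snd p))"
    using continuous_map_compose[OF continuous_map_snd continuous_map_fst, of T T T] by (simp add: Y_def o_def)
  have p3: "continuous_map (prod_topology T Y) T (\<lambda>p. snd (snd p))"
    using continuous_map_compose[OF continuous_map_snd continuous_map_snd, of T T T] by (simp add: Y_def o_def)
  have p0: "continuous_map (prod_topology T Y) T (\<lambda>p. g0)" using g0 topspace_carrier by simp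
  have "continuous_map (prod_topology T Y) euclidean F"
    unfolding F_def
    using continuous_map_compose[OF cm_mult[OF cm_mult[OF p2 p1] p3] f]
      continuous_map_compose[OF cm_mult[OF cm_mult[OF p2 p0] p3] f]
    by (intro continuous_map_diff) (simp_all add: o_def)
  then have W: "openin (prod_topology T Y) {p \<in> topspace (prod_topology T Y). F p \<in> ball 0 \<epsilon>}" (is "openin _ ?W")
    by (rule openin_continuous_map_preimage) (simp add: open_openin[symmetric])
  have "compact_space Y" unfolding Y_def using compact by (simp add: compact_space_prod_topology)
  then have cY: "compactin Y (topspace Y)" by (simp add: compact_space_def)
  have sub: "{g0} \<times> topspace Y \<subseteq> ?W"
    using g0 e by (auto simp: F_def topspace_carrier)
  have "g0 \<in> topspace T" using g0 topspace_carrier by simp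
  from tube_lemma_right[OF W cY this sub] obtain U V where
    UV: "openin T U" "g0 \<in> U" "topspace Y \<subseteq> V" "U \<times> V \<subseteq> ?W" by blast
  have "near f \<epsilon> g g0" if g: "g \<in> U" for g
    unfolding near_def
  proof (intro ballI)
    fix h z assume hz: "h \<in> carrier G" "z \<in> carrier G"
    have "(h, z) \<in> V" using UV(3) hz by (auto simp: Y_def topspace_carrier)
    then have "F (g, (h, z)) \<in> ball 0 \<epsilon>" using UV(4) g by blast
    then show "cmod (f (h \<otimes> g \<otimes> z) - f (h \<otimes> g0 \<otimes> z)) \<le> \<epsilon>" by (simp add: F_def)
  qed
  then show ?thesis using UV(1,2) by (intro exI[of _ U]) simp
qed

lemma ap_continuous: assumes f: "continuous_map T euclidean f" shows "ap f"
  unfolding ap_def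
proof (intro allI impI)
  fix \<epsilon> :: real assume e: "\<epsilon> > 0"
  have "\<forall>g\<in>carrier G. \<exists>U. openin T U \<and> g \<in> U \<and> (\<forall>y\<in>U. near f \<epsilon> y g)"
    using near_nbhd[OF f _ e] by (rule ballI)
  then obtain U where U: "\<forall>g\<in>carrier G. openin T (U g) \<and> g \<in> U g \<and> (\<forall>y\<in>U g. near f \<epsilon> y g)"
    by (rule bchoice[THEN exE])
  have "compactin T (carrier G)" using compact topspace_carrier by (simp add: compact_space_def)
  moreover have "\<forall>V \<in> U ` carrier G. openin T V" using U by simp
  moreover have "carrier G \<subseteq> \<Union>(U ` carrier G)" using U by auto
  ultimately obtain \<F> where F: "finite \<F>" "\<F> \<subseteq> U ` carrier G" "carrier G \<subseteq> \<Union>\<F>"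
    unfolding compactin_def by meson
  obtain N where N: "N \<subseteq> carrier G" "finite N" "\<F> = U ` N" using finite_subset_image[OF F(1,2)] by blast
  have "\<exists>n\<in>N. near f \<epsilon> g n" if "g \<in> carrier G" for g
  proof -
    obtain n where "n \<in> N" "g \<in> U n" using F(3) N(3) \<open>g \<in> carrier G\<close> by blast
    then show ?thesis using U N(1) by (intro bexI[of _ n]) auto
  qed
  then show "\<exists>N. finite N \<and> N \<subseteq> carrier G \<and> (\<forall>g\<in>carrier G. \<exists>n\<in>N. near f \<epsilon> g n)"
    using N(1,2) by (intro exI[of _ N]) simp
qed

lemma continuous_mapI_cmod:
  fixes F :: "'g \<Rightarrow> complex"
  assumes "\<And>g0 \<epsilon>. g0 \<in> carrier G \<Longrightarrow> \<epsilon> > 0 \<Longrightarrow> \<exists>U. openin T U \<and> g0 \<in> U \<and> (\<forall>g\<in>U. cmod (F g - F g0) < \<epsilon>)"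
  shows "continuous_map T euclidean F"
proof -
  have "continuous_map T Met_TC.mtopology F"
    unfolding Met_TC.continuous_map_to_metric
    using assms by (simp add: topspace_carrier dist_norm norm_minus_commute)
  then show ?thesis by simp
qed

lemma continuous_matrix_coeff:
  assumes f: "continuous_map T euclidean f" and h: "ap h"
  shows "continuous_map T euclidean (\<lambda>g. ip (L g f) h)"
proof (rule continuous_mapI_cmod)
  fix g0 and \<epsilon> :: real assume g0: "g0 \<in> carrier G" and e: "\<epsilon> > 0"
  have fa: "ap f" by (rule ap_continuous[OF f])
  obtain C where C: "C > 0" "\<And>g. g \<in> carrier G \<Longrightarrow> cmod (h g) \<le> C" using ap_bounded[OF h] by blast
  have eC: "\<epsilon> / (2 * C) > 0" using e C by simp
  obtain U where U: "openin T U" "inv g0 \<in> U" "\<forall>g\<in>U. near f (\<epsilon> / (2 * C)) g (inv g0)"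
    using near_nbhd[OF f inv_closed[OF g0] eC] by (elim exE conjE)
  define U' where "U' = {g \<in> topspace T. inv g \<in> U}"
  have oU': "openin T U'" unfolding U'_def by (rule openin_continuous_map_preimage[OF continuous_inv U(1)])
  have "cmod (ip (L g f) h - ip (L g0 f) h) < \<epsilon>" if "g \<in> U'" for g
  proof -
    have g: "g \<in> carrier G" "inv g \<in> U" using that by (auto simp: U'_def topspace_carrier)
    have "cmod (ip (L g f) h - ip (L g0 f) h) \<le> \<epsilon> / 2"
      unfolding ip_def
    proof (rule mean_diff_le)
      fix x assume x: "x \<in> carrier G"
      have "cmod (f (\<one> \<otimes> inv g \<otimes> x) - f (\<one> \<otimes> inv g0 \<otimes> x)) \<le> \<epsilon> / (2 * C)"
        by (rule nearD[OF bspec[OF U(3) g(2)] one_closed x])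
      then have "cmod (L g f x - L g0 f x) \<le> \<epsilon> / (2 * C)" using g g0 by (simp add: L_def)
      then have "cmod (L g f x - L g0 f x) * cmod (h x) \<le> \<epsilon> / (2 * C) * C"
        using C x e by (intro mult_mono) auto
      then show "cmod (L g f x * cnj (h x) - L g0 f x * cnj (h x)) \<le> \<epsilon> / 2"
        using C by (simp flip: left_diff_distrib add: norm_mult)
    qed (intro ap_ip ap_L fa h g g0)+
    then show ?thesis using e by simp
  qed
  moreover have "g0 \<in> U'" using U(2) g0 by (simp add: U'_def topspace_carrier)
  ultimately show "\<exists>U. openin T U \<and> g0 \<in> U \<and> (\<forall>g\<in>U. cmod (ip (L g f) h - ip (L g0 f) h) < \<epsilon>)"
    using oU' by blast
qed

lemma continuous_map_ulimit:
  fixes F :: "'g \<Rightarrow> complex"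
  assumes "\<And>\<epsilon>. \<epsilon> > 0 \<Longrightarrow> \<exists>h. continuous_map T euclidean h \<and> (\<forall>x\<in>carrier G. cmod (F x - h x) \<le> \<epsilon>)"
  shows "continuous_map T euclidean F"
proof (rule continuous_mapI_cmod)
  fix g0 and \<epsilon> :: real assume g0: "g0 \<in> carrier G" and e: "\<epsilon> > 0"
  have "\<epsilon> / 4 > 0" using e by simp
  from assms[OF this] obtain h where h: "continuous_map T euclidean h" "\<forall>x\<in>carrier G. cmod (F x - h x) \<le> \<epsilon> / 4"
    by (elim exE conjE)
  obtain U where U: "openin T U" "g0 \<in> U" "\<forall>g\<in>U. near h (\<epsilon> / 4) g g0"
    using near_nbhd[OF h(1) g0 \<open>\<epsilon> / 4 > 0\<close>] by (elim exE conjE)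
  have "cmod (F g - F g0) < \<epsilon>" if g: "g \<in> U" for g
  proof -
    have gc: "g \<in> carrier G" using openin_subset[OF U(1)] g topspace_carrier by blast
    have 1: "cmod (F g - h g) \<le> \<epsilon> / 4" by (rule bspec[OF h(2) gc])
    have 2: "cmod (h g - h g0) \<le> \<epsilon> / 4" by (rule near_point[OF bspec[OF U(3) g] gc g0])
    have 3: "cmod (h g0 - F g0) \<le> \<epsilon> / 4" using bspec[OF h(2) g0] by (simp add: norm_minus_commute)
    have "cmod (F g - h g + (h g - h g0) + (h g0 - F g0)) \<le> \<epsilon> / 4 + \<epsilon> / 4 + \<epsilon> / 4"
      by (rule norm_triangle_mono[OF norm_triangle_mono[OF 1 2] 3])
    then show ?thesis using e by simp
  qed
  then show "\<exists>U. openin T U \<and> g0 \<in> U \<and> (\<forall>g\<in>U. cmod (F g - F g0) < \<epsilon>)" using U(1,2) by blast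
qed

end

locale compact_homogeneous_space = compact_group G T for G :: "('g, 'm) monoid_scheme" (structure) and T +
  fixes H :: "'g set"
  assumes subgroup_H: "subgroup H G"
begin

lemma H_sub: "H \<subseteq> carrier G" using subgroup_H by (rule subgroup.subset)

lemma coset_in: "g \<in> carrier G \<Longrightarrow> g <# H \<in> lcosets H"
  by (auto simp: LCOSETS_def)

lemma cosetE: assumes "x \<in> lcosets H" obtains g where "g \<in> carrier G" "x = g <# H"
  using assms by (auto simp: LCOSETS_def)

lemma coset_mult: "g \<in> carrier G \<Longrightarrow> x \<in> carrier G \<Longrightarrow> g <# (x <# H) = (g \<otimes> x) <# H"
  by (rule lcos_m_assoc[OF H_sub])

lemma topspace_coset: "topspace (coset_topology G T H) = lcosets H"
proof -
  have "{g \<in> topspace T. g <# H \<in> lcosets H} = topspace T" using coset_in topspace_carrier by auto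
  then have "openin (coset_topology G T H) (lcosets H)" by (simp add: openin_coset_topology)
  then show ?thesis
    by (intro subset_antisym openin_subset) (auto simp: topspace_def openin_coset_topology)
qed

text \<open>
  With the quotient topology, functions on \<open>G/H\<close> can be studied through their lifts to \<open>G\<close>.
\<close>

lemma continuous_coset_iff:
  fixes f :: "'g set \<Rightarrow> complex"
  shows "continuous_map (coset_topology G T H) euclidean f \<longleftrightarrow> continuous_map T euclidean (\<lambda>g. f (g <# H))"
proof -
  have "openin (coset_topology G T H) {x \<in> lcosets H. f x \<in> U} \<longleftrightarrow> openin T {g \<in> topspace T. f (g <# H) \<in> U}" for U
  proof -
    have "{g \<in> topspace T. g <# H \<in> {x \<in> lcosets H. f x \<in> U}} = {g \<in> topspace T. f (g <# H) \<in> U}"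
      using coset_in topspace_carrier by auto
    then show ?thesis by (simp add: openin_coset_topology)
  qed
  then show ?thesis by (simp add: continuous_map_def topspace_coset)
qed

lemma CM_iff:
  "f \<in> mspace (CM_metric G T H) \<longleftrightarrow> f \<in> extensional (lcosets H) \<and> continuous_map T euclidean (\<lambda>g. f (g <# H))"
proof
  assume "f \<in> mspace (CM_metric G T H)"
  then show "f \<in> extensional (lcosets H) \<and> continuous_map T euclidean (\<lambda>g. f (g <# H))"
    by (simp add: topspace_coset continuous_coset_iff)
next
  assume f: "f \<in> extensional (lcosets H) \<and> continuous_map T euclidean (\<lambda>g. f (g <# H))"
  obtain C where C: "\<And>g. g \<in> carrier G \<Longrightarrow> cmod (f (g <# H)) \<le> C"
    using ap_bounded[OF ap_continuous] f by blast
  have "bounded (f ` (lcosets H))" unfolding bounded_iff using C by (auto elim!: cosetE)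
  then have "Met_TC.mbounded (f ` (lcosets H))" by simp
  then show "f \<in> mspace (CM_metric G T H)"
    using f by (simp add: topspace_coset continuous_coset_iff)
qed

text \<open>
  Membership ignores the values off the carrier, so lifted spaces are invariant spaces in the sense
  above. On functions that are constant on cosets \<open>desc\<close> inverts lifting, whatever representatives
  are chosen.
\<close>

definition Lift :: "('g set \<Rightarrow> complex) set \<Rightarrow> ('g \<Rightarrow> complex) set" where
  "Lift S = {F. \<exists>f\<in>S. \<forall>g\<in>carrier G. F g = f (g <# H)}"

definition desc :: "('g \<Rightarrow> complex) \<Rightarrow> 'g set \<Rightarrow> complex" where
  "desc F = (\<lambda>x\<in>lcosets H. F (SOME g. g \<in> carrier G \<and> g <# H = x))"

lemma desc_eq:
  assumes f: "f \<in> extensional (lcosets H)" and F: "\<And>g. g \<in> carrier G \<Longrightarrow> F g = f (g <# H)" shows "desc F = f"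
proof
  fix x
  show "desc F x = f x"
  proof (cases "x \<in> lcosets H")
    case True
    then have "\<exists>g. g \<in> carrier G \<and> g <# H = x" by (auto elim: cosetE)
    from someI_ex[OF this] show ?thesis using True F by (simp add: desc_def)
  qed (use f in \<open>simp add: desc_def extensional_def\<close>)
qed

lemma LiftI: "f \<in> S \<Longrightarrow> (\<And>g. g \<in> carrier G \<Longrightarrow> F g = f (g <# H)) \<Longrightarrow> F \<in> Lift S"
  unfolding Lift_def by blast

lemma LiftD: "F \<in> Lift S \<Longrightarrow> \<exists>f\<in>S. \<forall>g\<in>carrier G. F g = f (g <# H)"
  unfolding Lift_def by blast

lemma desc_Lift:
  assumes S: "S \<subseteq> mspace (CM_metric G T H)" and F: "F \<in> Lift S"
  shows "desc F \<in> S" "g \<in> carrier G \<Longrightarrow> desc F (g <# H) = F g"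
proof -
  obtain f where f: "f \<in> S" "\<forall>g\<in>carrier G. F g = f (g <# H)" using LiftD[OF F] by (elim bexE)
  have "f \<in> extensional (lcosets H)" using f(1) S CM_iff by blast
  then have "desc F = f" using bspec[OF f(2)] by (rule desc_eq)
  then show "desc F \<in> S" "g \<in> carrier G \<Longrightarrow> desc F (g <# H) = F g" using f by auto
qed

lemma Lift_continuous:
  assumes S: "S \<subseteq> mspace (CM_metric G T H)" and F: "F \<in> Lift S" shows "continuous_map T euclidean F"
proof -
  obtain f where f: "f \<in> S" "\<forall>g\<in>carrier G. F g = f (g <# H)" using LiftD[OF F] by (elim bexE)
  then have "continuous_map T euclidean (\<lambda>g. f (g <# H))" using S CM_iff by blast
  then show ?thesis by (rule continuous_map_eq) (simp add: f(2) topspace_carrier)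
qed

lemma translate_coset:
  "g \<in> carrier G \<Longrightarrow> x \<in> carrier G \<Longrightarrow> translate G H g f (x <# H) = f ((inv g \<otimes> x) <# H)"
  by (simp add: translate_def coset_in coset_mult)

lemma inv_space_Lift:
  assumes S: "S \<subseteq> mspace (CM_metric G T H)" and zero: "(\<lambda>x\<in>lcosets H. 0) \<in> S"
    and add: "\<And>f h. f \<in> S \<Longrightarrow> h \<in> S \<Longrightarrow> (\<lambda>x\<in>lcosets H. f x + h x) \<in> S"
    and cmult: "\<And>c f. f \<in> S \<Longrightarrow> (\<lambda>x\<in>lcosets H. c * f x) \<in> S"
    and trans: "\<And>g f. g \<in> carrier G \<Longrightarrow> f \<in> S \<Longrightarrow> translate G H g f \<in> S"
  shows "inv_space (Lift S)"
  unfolding inv_space_def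
proof (intro conjI ballI allI impI)
  show "ap F" if "F \<in> Lift S" for F by (rule ap_continuous[OF Lift_continuous[OF S that]])
  show "(\<lambda>_. 0) \<in> Lift S" by (rule LiftI[OF zero]) (simp add: coset_in)
  show "(\<lambda>x. F x + K x) \<in> Lift S" if FK: "F \<in> Lift S" "K \<in> Lift S" for F K
  proof -
    obtain f where f: "f \<in> S" "\<forall>g\<in>carrier G. F g = f (g <# H)" using LiftD[OF FK(1)] by (elim bexE)
    obtain k where k: "k \<in> S" "\<forall>g\<in>carrier G. K g = k (g <# H)" using LiftD[OF FK(2)] by (elim bexE)
    show ?thesis by (rule LiftI[OF add[OF f(1) k(1)]]) (simp add: coset_in f k)
  qed
  show "(\<lambda>x. c * F x) \<in> Lift S" if F: "F \<in> Lift S" for F c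
  proof -
    obtain f where f: "f \<in> S" "\<forall>g\<in>carrier G. F g = f (g <# H)" using LiftD[OF F] by (elim bexE)
    show ?thesis by (rule LiftI[OF cmult[OF f(1), of c]]) (simp add: coset_in f)
  qed
  show "L g F \<in> Lift S" if g: "g \<in> carrier G" and F: "F \<in> Lift S" for g F
  proof -
    obtain f where f: "f \<in> S" "\<forall>g\<in>carrier G. F g = f (g <# H)" using LiftD[OF F] by (elim bexE)
    show ?thesis by (rule LiftI[OF trans[OF g f(1)]]) (simp add: translate_coset L_def g f)
  qed
  show "F' \<in> Lift S" if F: "F \<in> Lift S" "\<forall>x\<in>carrier G. F' x = F x" for F F'
    using F unfolding Lift_def by auto
qed

text \<open>
  A uniform limit of lifts is constant on cosets and continuous, so it is the lift of a continuous
  function on \<open>G/H\<close>, which lies in the closed set \<open>S\<close>.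
\<close>

lemma uclosed_Lift:
  assumes S: "closedin (mtopology_of (CM_metric G T H)) S" shows "uclosed (Lift S)"
  unfolding uclosed_def
proof (intro allI impI)
  interpret m: Metric_space "mspace (CM_metric G T H)" "mdist (CM_metric G T H)" by (rule Metric_space_mspace_mdist)
  have cl: "closedin m.mtopology S" using S by (simp only: mtopology_of_def)
  have Ssub: "S \<subseteq> mspace (CM_metric G T H)" using cl unfolding m.closedin_metric by (elim conjE)
  fix F assume F: "\<forall>\<epsilon>>0. \<exists>K\<in>Lift S. \<forall>x\<in>carrier G. cmod (F x - K x) \<le> \<epsilon>"
  have appr: "\<exists>k\<in>S. \<forall>x\<in>carrier G. cmod (F x - k (x <# H)) \<le> \<epsilon>" if e: "\<epsilon> > 0" for \<epsilon>
  proof -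
    obtain K where K: "K \<in> Lift S" "\<forall>x\<in>carrier G. cmod (F x - K x) \<le> \<epsilon>" using F e by blast
    obtain k where k: "k \<in> S" "\<forall>g\<in>carrier G. K g = k (g <# H)" using LiftD[OF K(1)] by (elim bexE)
    show ?thesis by (rule bexI[OF _ k(1)]) (use K(2) k(2) in simp)
  qed
  have inv: "F a = F b" if ab: "a \<in> carrier G" "b \<in> carrier G" "a <# H = b <# H" for a b
  proof -
    have "cmod (F a - F b) \<le> 0 + e" if e: "e > 0" for e
    proof -
      have "e / 2 > 0" using e by simp
      from appr[OF this] obtain k where k: "k \<in> S" "\<forall>x\<in>carrier G. cmod (F x - k (x <# H)) \<le> e / 2" by blast
      have 1: "cmod (F a - k (a <# H)) \<le> e / 2" using k(2) ab(1) by (rule bspec)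
      have "cmod (F b - k (b <# H)) \<le> e / 2" using k(2) ab(2) by (rule bspec)
      then have 2: "cmod (k (a <# H) - F b) \<le> e / 2" unfolding ab(3) by (simp add: norm_minus_commute)
      from norm_triangle_mono[OF 1 2] show ?thesis by simp
    qed
    then have "cmod (F a - F b) \<le> 0" by (rule field_le_epsilon)
    then show ?thesis by simp
  qed
  define f where "f = desc F"
  have fF: "f (g <# H) = F g" if g: "g \<in> carrier G" for g
  proof -
    have "\<exists>y. y \<in> carrier G \<and> y <# H = g <# H" using g by blast
    from someI_ex[OF this] show ?thesis
      using inv[OF _ g] by (simp add: f_def desc_def coset_in[OF g])
  qed
  have fext: "f \<in> extensional (lcosets H)" by (simp add: f_def desc_def)
  have Fc: "continuous_map T euclidean F"
  proof (rule continuous_map_ulimit)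
    fix \<epsilon> :: real assume e: "\<epsilon> > 0"
    from appr[OF e] obtain k where k: "k \<in> S" "\<forall>x\<in>carrier G. cmod (F x - k (x <# H)) \<le> \<epsilon>" by blast
    have "continuous_map T euclidean (\<lambda>g. k (g <# H))" using k(1) Ssub CM_iff by blast
    then show "\<exists>h. continuous_map T euclidean h \<and> (\<forall>x\<in>carrier G. cmod (F x - h x) \<le> \<epsilon>)" using k(2) by blast
  qed
  have "continuous_map T euclidean (\<lambda>g. f (g <# H))"
    by (rule continuous_map_eq[OF Fc]) (simp add: fF topspace_carrier)
  then have fM: "f \<in> mspace (CM_metric G T H)" using fext CM_iff by blast
  have "f \<in> S"
  proof (rule ccontr)
    assume "f \<notin> S"
    then obtain r where r: "r > 0" "disjnt S (m.mball f r)" using cl fM unfolding m.closedin_metric by blast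
    have "r / 2 > 0" using r(1) by simp
    from appr[OF this] obtain k where k: "k \<in> S" "\<forall>x\<in>carrier G. cmod (F x - k (x <# H)) \<le> r / 2" by blast
    have "mdist (CM_metric G T H) f k \<le> r / 2"
    proof (rule mdist_cfunspace_le)
      fix x assume "x \<in> topspace (coset_topology G T H)"
      then obtain g where g: "g \<in> carrier G" "x = g <# H" unfolding topspace_coset by (rule cosetE)
      then show "mdist euclidean_metric (f x) (k x) \<le> r / 2" using k(2) fF by (simp add: dist_norm)
    qed (use r(1) in simp)
    moreover have "k \<in> mspace (CM_metric G T H)" using k(1) Ssub by blast
    ultimately have "k \<in> m.mball f r" using r(1) fM by (simp only: m.in_mball) simp
    then show False using r(2) k(1) by (auto simp: disjnt_def)
  qed
  then show "F \<in> Lift S" by (rule LiftI) (simp add: fF)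
qed

end

section \<open>Irreducible spaces as matrix representations\<close>

context compact_group
begin

text \<open>
  The matrix of left translation by \<open>g\<close> with respect to an orthonormal family that spans an
  invariant space.
\<close>

definition coeff_rep :: "nat \<Rightarrow> (nat \<Rightarrow> 'g \<Rightarrow> complex) \<Rightarrow> 'g \<Rightarrow> complex mat" where
  "coeff_rep d e g = mat d d (\<lambda>(i, j). ip (L g (e j)) (e i))"

definition comb :: "nat \<Rightarrow> (nat \<Rightarrow> 'g \<Rightarrow> complex) \<Rightarrow> complex vec \<Rightarrow> 'g \<Rightarrow> complex" where
  "comb d e v = (\<lambda>x. \<Sum>i<d. v $ i * e i x)"

lemma comb_add: "w \<in> carrier_vec d \<Longrightarrow> comb d e (v + w) = (\<lambda>x. comb d e v x + comb d e w x)"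
  unfolding comb_def by (auto simp: distrib_right sum.distrib[symmetric] intro!: ext sum.cong)

lemma comb_smult: "v \<in> carrier_vec d \<Longrightarrow> comb d e (c \<cdot>\<^sub>v v) = (\<lambda>x. c * comb d e v x)"
  unfolding comb_def by (auto simp: sum_distrib_left mult.assoc intro!: ext sum.cong)

lemma comb_zero: "comb d e (0\<^sub>v d) = (\<lambda>x. 0)"
  unfolding comb_def by (intro ext sum.neutral) auto

lemma ip_comb_vec: "onf d e \<Longrightarrow> i < d \<Longrightarrow> ip (comb d e v) (e i) = v $ i"
  unfolding comb_def by (rule ip_comb)

lemma comb_in: "inv_space W \<Longrightarrow> (\<And>i. i < d \<Longrightarrow> e i \<in> W) \<Longrightarrow> comb d e v \<in> W"
  unfolding comb_def by (rule inv_space_sum) (auto intro: inv_space_cmult)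

lemma comb_inj:
  assumes e: "onf d e" and v: "v \<in> carrier_vec d" "w \<in> carrier_vec d"
    and eq: "\<And>x. x \<in> carrier G \<Longrightarrow> comb d e v x = comb d e w x"
  shows "v = w"
proof (rule eq_vecI)
  fix i assume "i < dim_vec w"
  then have i: "i < d" using v by simp
  have "ip (comb d e v) (e i) = ip (comb d e w) (e i)" using eq by (intro ip_cong) auto
  then show "v $ i = w $ i" unfolding ip_comb_vec[OF e i] .
qed (use v in simp)

lemma basisD: assumes "basis W d e"
  shows basis_onf: "onf d e" and basis_mem: "i < d \<Longrightarrow> e i \<in> W"
    and basis_span: "f \<in> W \<Longrightarrow> x \<in> carrier G \<Longrightarrow> f x = (\<Sum>i<d. ip f (e i) * e i x)"
  using assms unfolding basis_def proj_def by blast+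

lemma comb_L:
  assumes W: "inv_space W" and e: "basis W d e" and g: "g \<in> carrier G" and v: "v \<in> carrier_vec d"
    and x: "x \<in> carrier G"
  shows "comb d e (coeff_rep d e g *\<^sub>v v) x = L g (comb d e v) x"
proof -
  have Lj: "L g (e j) x = (\<Sum>i<d. ip (L g (e j)) (e i) * e i x)" if "j < d" for j
    by (rule basis_span[OF e inv_space_L[OF W basis_mem[OF e that] g] x])
  have "L g (comb d e v) x = (\<Sum>j<d. v $ j * L g (e j) x)" by (simp add: comb_def L_def)
  also have "\<dots> = (\<Sum>j<d. \<Sum>i<d. v $ j * (ip (L g (e j)) (e i) * e i x))"
    using Lj by (intro sum.cong refl) (simp add: sum_distrib_left)
  also have "\<dots> = (\<Sum>i<d. \<Sum>j<d. v $ j * (ip (L g (e j)) (e i) * e i x))" by (rule sum.swap)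
  also have "\<dots> = (\<Sum>i<d. (coeff_rep d e g *\<^sub>v v) $ i * e i x)"
  proof (intro sum.cong refl)
    fix i assume "i \<in> {..<d}"
    then have "(coeff_rep d e g *\<^sub>v v) $ i = (\<Sum>j<d. ip (L g (e j)) (e i) * v $ j)"
      using v by (simp add: coeff_rep_def scalar_prod_def atLeast0LessThan)
    then show "(\<Sum>j<d. v $ j * (ip (L g (e j)) (e i) * e i x)) = (coeff_rep d e g *\<^sub>v v) $ i * e i x"
      by (simp add: sum_distrib_right mult.left_commute mult.assoc)
  qed
  finally show ?thesis by (simp add: comb_def)
qed

lemma coeff_rep_carrier: "coeff_rep d e g \<in> carrier_mat d d"
  by (simp add: coeff_rep_def)

lemma coeff_rep_mult:
  assumes W: "inv_space W" and e: "basis W d e" and g: "g \<in> carrier G" and h: "h \<in> carrier G"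
  shows "coeff_rep d e (g \<otimes> h) = coeff_rep d e g * coeff_rep d e h"
proof (rule eq_matI)
  fix i j assume "i < dim_row (coeff_rep d e g * coeff_rep d e h)" "j < dim_col (coeff_rep d e g * coeff_rep d e h)"
  then have i: "i < d" and j: "j < d" by (simp_all add: coeff_rep_def)
  have eo: "\<And>k. k < d \<Longrightarrow> ap (e k)" using onf_ap[OF basis_onf[OF e]] .
  have "ip (L (g \<otimes> h) (e j)) (e i) = ip (\<lambda>x. \<Sum>k<d. ip (L h (e j)) (e k) * L g (e k) x) (e i)"
  proof (rule ip_cong)
    fix x assume x: "x \<in> carrier G"
    have "L (g \<otimes> h) (e j) x = L h (e j) (inv g \<otimes> x)"
      using g h x by (simp add: L_def inv_mult_group m_assoc)
    also have "\<dots> = (\<Sum>k<d. ip (L h (e j)) (e k) * e k (inv g \<otimes> x))"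
      using g x by (intro basis_span[OF e inv_space_L[OF W basis_mem[OF e j] h]]) simp
    finally show "L (g \<otimes> h) (e j) x = (\<Sum>k<d. ip (L h (e j)) (e k) * L g (e k) x)" by (simp add: L_def)
  qed simp
  also have "\<dots> = (\<Sum>k<d. ip (\<lambda>x. ip (L h (e j)) (e k) * L g (e k) x) (e i))"
    using eo i g by (intro ip_sum ap_cmult ap_L) auto
  also have "\<dots> = (\<Sum>k<d. ip (L h (e j)) (e k) * ip (L g (e k)) (e i))"
    using eo i g by (intro sum.cong refl ip_cmult ap_L) auto
  finally show "coeff_rep d e (g \<otimes> h) $$ (i, j) = (coeff_rep d e g * coeff_rep d e h) $$ (i, j)"
    using i j by (simp add: coeff_rep_def scalar_prod_def atLeast0LessThan mult.commute)
qed (simp_all add: coeff_rep_def)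

lemma coeff_rep_one: assumes e: "onf d e" shows "coeff_rep d e \<one> = 1\<^sub>m d"
proof (rule eq_matI)
  fix i j assume "i < dim_row (1\<^sub>m d :: complex mat)" "j < dim_col (1\<^sub>m d :: complex mat)"
  then have i: "i < d" and j: "j < d" by simp_all
  have "ip (L \<one> (e j)) (e i) = ip (e j) (e i)" by (rule ip_cong) (simp_all add: L_def)
  then show "coeff_rep d e \<one> $$ (i, j) = (1\<^sub>m d :: complex mat) $$ (i, j)"
    using i j onf_ip[OF e j i] by (simp add: coeff_rep_def)
qed (simp_all add: coeff_rep_def)

lemma continuous_rep_coeff:
  assumes W: "inv_space W" and e: "basis W d e" and c: "\<And>i. i < d \<Longrightarrow> continuous_map T euclidean (e i)"
  shows "continuous_rep G T d (coeff_rep d e)"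
  unfolding continuous_rep_def
proof (intro conjI allI impI)
  let ?R = "ring_mat TYPE(complex) d ()"
  note mult = coeff_rep_mult[OF W e] and one = coeff_rep_one[OF basis_onf[OF e]]
  show "coeff_rep d e \<in> hom G (units_of ?R)"
  proof (rule homI)
    fix g assume g: "g \<in> carrier G"
    have "coeff_rep d e (inv g) * coeff_rep d e g = 1\<^sub>m d" "coeff_rep d e g * coeff_rep d e (inv g) = 1\<^sub>m d"
      using g by (simp_all add: mult[symmetric] one)
    then show "coeff_rep d e g \<in> carrier (units_of ?R)"
      unfolding units_of_carrier Units_def
      using coeff_rep_carrier by (auto simp: ring_mat_simps intro!: bexI[of _ "coeff_rep d e (inv g)"])
    fix h assume h: "h \<in> carrier G"
    show "coeff_rep d e (g \<otimes> h) = coeff_rep d e g \<otimes>\<^bsub>units_of ?R\<^esub> coeff_rep d e h"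
      by (simp add: units_of_mult ring_mat_simps mult[OF g h])
  qed
  fix i j assume i: "i < d" and j: "j < d"
  have "continuous_map T euclidean (\<lambda>g. ip (L g (e j)) (e i))"
    by (rule continuous_matrix_coeff[OF c[OF j] onf_ap[OF basis_onf[OF e] i]])
  then show "continuous_map T euclidean (\<lambda>g. coeff_rep d e g $$ (i, j))"
    using i j by (simp add: coeff_rep_def)
qed

text \<open>
  Coordinates identify the invariant subspaces of the matrix representation with the invariant
  spaces contained in \<open>W\<close>.
\<close>

lemma irreducible_coeff_rep:
  assumes irr: "irr W" and e: "basis W d e" and c: "\<And>i. i < d \<Longrightarrow> continuous_map T euclidean (e i)"
  shows "irreducible_rep G T d (coeff_rep d e)"
  unfolding irreducible_rep_def
proof (intro conjI allI impI)
  have W: "inv_space W" and nz: "\<not> zero_space W" using irr by (simp_all add: irr_def)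
  note on = basis_onf[OF e] and mem = basis_mem[OF e]
  show "continuous_rep G T d (coeff_rep d e)" by (rule continuous_rep_coeff[OF W e c])
  obtain f x where f: "f \<in> W" "x \<in> carrier G" "f x \<noteq> 0" using nz unfolding zero_space_def by blast
  show "d > 0"
  proof (rule ccontr)
    assume "\<not> d > 0"
    then show False using basis_span[OF e f(1,2)] f(3) by simp
  qed
  fix Y assume Y: "invariant_subspace G d (coeff_rep d e) Y"
  have Xc: "v \<in> carrier_vec d" if "v \<in> Y" for v using Y that unfolding invariant_subspace_def by blast
  have X0: "0\<^sub>v d \<in> Y" using Y unfolding invariant_subspace_def by (elim conjE)
  define W' where "W' = {F. \<exists>v\<in>Y. \<forall>x\<in>carrier G. F x = comb d e v x}"
  have W'I: "F \<in> W'" if "v \<in> Y" "\<And>x. x \<in> carrier G \<Longrightarrow> F x = comb d e v x" for F v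
    using that unfolding W'_def by blast
  have W'E: "\<exists>v\<in>Y. \<forall>x\<in>carrier G. F x = comb d e v x" if "F \<in> W'" for F using that unfolding W'_def by blast
  have W'W: "W' \<subseteq> W"
  proof
    fix F assume "F \<in> W'"
    from W'E[OF this] obtain v where v: "v \<in> Y" "\<forall>x\<in>carrier G. F x = comb d e v x" by (elim bexE)
    show "F \<in> W" by (rule inv_space_cong[OF W comb_in[OF W mem, where v = v]]) (use v(2) in auto)
  qed
  have "inv_space W'"
    unfolding inv_space_def
  proof (intro conjI ballI allI impI)
    show "ap f" if "f \<in> W'" for f using that W'W inv_space_ap[OF W] by blast
    show "(\<lambda>_. 0) \<in> W'" by (rule W'I[OF X0]) (simp add: comb_zero)
    show "(\<lambda>x. F x + K x) \<in> W'" if FK: "F \<in> W'" "K \<in> W'" for F K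
    proof -
      obtain v where v: "v \<in> Y" "\<forall>x\<in>carrier G. F x = comb d e v x" using W'E[OF FK(1)] by (elim bexE)
      obtain w where w: "w \<in> Y" "\<forall>x\<in>carrier G. K x = comb d e w x" using W'E[OF FK(2)] by (elim bexE)
      have "v + w \<in> Y" using Y v(1) w(1) unfolding invariant_subspace_def by blast
      then show ?thesis by (rule W'I) (simp add: comb_add[OF Xc[OF w(1)]] v(2) w(2))
    qed
    show "(\<lambda>x. c * F x) \<in> W'" if F: "F \<in> W'" for c F
    proof -
      obtain v where v: "v \<in> Y" "\<forall>x\<in>carrier G. F x = comb d e v x" using W'E[OF F] by (elim bexE)
      have "c \<cdot>\<^sub>v v \<in> Y" using Y v(1) unfolding invariant_subspace_def by blast
      then show ?thesis by (rule W'I) (simp add: comb_smult[OF Xc[OF v(1)]] v(2))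
    qed
    show "L g F \<in> W'" if g: "g \<in> carrier G" and F: "F \<in> W'" for g F
    proof -
      obtain v where v: "v \<in> Y" "\<forall>x\<in>carrier G. F x = comb d e v x" using W'E[OF F] by (elim bexE)
      have "coeff_rep d e g *\<^sub>v v \<in> Y" using Y v(1) g unfolding invariant_subspace_def by blast
      then show ?thesis
      proof (rule W'I)
        fix x assume x: "x \<in> carrier G"
        show "L g F x = comb d e (coeff_rep d e g *\<^sub>v v) x"
          unfolding comb_L[OF W e g Xc[OF v(1)] x] using v(2) g x by (simp add: L_def)
      qed
    qed
    show "F' \<in> W'" if F: "F \<in> W'" "\<forall>x\<in>carrier G. F' x = F x" for F F'
    proof -
      obtain v where v: "v \<in> Y" "\<forall>x\<in>carrier G. F x = comb d e v x" using W'E[OF F(1)] by (elim bexE)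
      show ?thesis by (rule W'I[OF v(1)]) (use v(2) F(2) in simp)
    qed
  qed
  then have "zero_space W' \<or> W' = W" using irr W'W unfolding irr_def by blast
  then show "Y = {0\<^sub>v d} \<or> Y = carrier_vec d"
  proof
    assume z: "zero_space W'"
    have "v = 0\<^sub>v d" if v: "v \<in> Y" for v
    proof (rule comb_inj[OF on Xc[OF v]])
      fix x assume x: "x \<in> carrier G"
      have "comb d e v \<in> W'" by (rule W'I[OF v]) simp
      then show "comb d e v x = comb d e (0\<^sub>v d) x" using z x by (simp add: zero_space_def comb_zero)
    qed simp
    then show ?thesis using X0 by blast
  next
    assume eq: "W' = W"
    have "v \<in> Y" if v: "v \<in> carrier_vec d" for v
    proof -
      have "comb d e v \<in> W'" unfolding eq by (rule comb_in[OF W mem])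
      from W'E[OF this] obtain w where w: "w \<in> Y" "\<forall>x\<in>carrier G. comb d e v x = comb d e w x" by (elim bexE)
      have "v = w" by (rule comb_inj[OF on v Xc[OF w(1)]]) (use w(2) in simp)
      then show ?thesis using w(1) by simp
    qed
    then show ?thesis using Xc by blast
  qed
qed

end

section \<open>Multiplicity freeness\<close>

context compact_homogeneous_space
begin

text \<open>
  An equivariant linear map \<open>\<psi>\<close> from \<open>W\<close> into lifted functions, read in coordinates. The
  assumption on congruence is needed because matrix and translation agree only on the carrier.
\<close>

lemma intertwiner_desc:
  assumes W: "inv_space W" and e: "basis W d e" and S: "S \<subseteq> mspace (CM_metric G T H)"
    and lift: "\<And>f. f \<in> W \<Longrightarrow> \<psi> f \<in> Lift S"
    and add: "\<And>f h x. f \<in> W \<Longrightarrow> h \<in> W \<Longrightarrow> x \<in> carrier G \<Longrightarrow> \<psi> (\<lambda>x. f x + h x) x = \<psi> f x + \<psi> h x"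
    and cmult: "\<And>f c x. f \<in> W \<Longrightarrow> x \<in> carrier G \<Longrightarrow> \<psi> (\<lambda>x. c * f x) x = c * \<psi> f x"
    and equiv: "\<And>f g x. f \<in> W \<Longrightarrow> g \<in> carrier G \<Longrightarrow> x \<in> carrier G \<Longrightarrow> \<psi> (L g f) x = L g (\<psi> f) x"
    and cong: "\<And>f h x. f \<in> W \<Longrightarrow> h \<in> W \<Longrightarrow> (\<And>x. x \<in> carrier G \<Longrightarrow> f x = h x) \<Longrightarrow> x \<in> carrier G \<Longrightarrow> \<psi> f x = \<psi> h x"
  shows "(\<lambda>v. desc (\<psi> (comb d e v))) \<in> intertwiners G T H d (coeff_rep d e)"
  unfolding intertwiners_def mem_Collect_eq
proof (intro conjI ballI allI)
  have mem: "comb d e v \<in> W" for v by (rule comb_in[OF W basis_mem[OF e]])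
  note D = desc_Lift[OF S lift[OF mem]]
  show "desc (\<psi> (comb d e v)) \<in> mspace (CM_metric G T H)" for v using D(1) S by blast
  show "desc (\<psi> (comb d e (v + w))) = (\<lambda>x\<in>lcosets H. desc (\<psi> (comb d e v)) x + desc (\<psi> (comb d e w)) x)"
    if "v \<in> carrier_vec d" "w \<in> carrier_vec d" for v w
    by (rule desc_eq) (simp_all add: comb_add that add[OF mem mem] coset_in D(2))
  show "desc (\<psi> (comb d e (c \<cdot>\<^sub>v v))) = (\<lambda>x\<in>lcosets H. c * desc (\<psi> (comb d e v)) x)"
    if "v \<in> carrier_vec d" for c v
    by (rule desc_eq) (simp_all add: comb_smult that cmult[OF mem] coset_in D(2))
  show "desc (\<psi> (comb d e (coeff_rep d e g *\<^sub>v v))) = translate G H g (desc (\<psi> (comb d e v)))"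
    if g: "g \<in> carrier G" and v: "v \<in> carrier_vec d" for g v
  proof (rule desc_eq)
    show "translate G H g (desc (\<psi> (comb d e v))) \<in> extensional (lcosets H)" by (simp add: translate_def)
    fix x assume x: "x \<in> carrier G"
    have "\<psi> (comb d e (coeff_rep d e g *\<^sub>v v)) x = \<psi> (L g (comb d e v)) x"
      using comb_L[OF W e g v] by (intro cong mem inv_space_L[OF W mem g] x)
    also have "\<dots> = L g (\<psi> (comb d e v)) x" by (rule equiv[OF mem g x])
    also have "\<dots> = translate G H g (desc (\<psi> (comb d e v))) (x <# H)"
      using g x by (simp add: translate_coset D(2) L_def)
    finally show "\<psi> (comb d e (coeff_rep d e g *\<^sub>v v)) x = translate G H g (desc (\<psi> (comb d e v))) (x <# H)" .
  qed
qed

lemma multiplicity_ge_2: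
  assumes P: "\<Phi>0 \<in> intertwiners G T H d \<rho>" "\<Phi>1 \<in> intertwiners G T H d \<rho>"
    and ind: "\<And>a b. (\<And>v x. v \<in> carrier_vec d \<Longrightarrow> x \<in> lcosets H \<Longrightarrow> a * \<Phi>0 v x + b * \<Phi>1 v x = 0) \<Longrightarrow> a = 0 \<and> b = 0"
  shows "multiplicity_in_CM G T H d \<rho> \<notin> {0, 1}"
proof -
  define \<Phi> where "\<Phi> i = (if i = (0::nat) then \<Phi>0 else \<Phi>1)" for i
  have s2: "(\<Sum>i<2. f i) = f 0 + f 1" for f :: "nat \<Rightarrow> complex" by (simp add: numeral_2_eq_2)
  have "\<forall>i<2. \<Phi> i \<in> intertwiners G T H d \<rho>" using P by (simp add: \<Phi>_def)
  moreover have "\<forall>c. (\<forall>v\<in>carrier_vec d. \<forall>x\<in>lcosets H. (\<Sum>i<2. c i * \<Phi> i v x) = 0) \<longrightarrow> (\<forall>i<2. c i = 0)"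
  proof (intro allI impI)
    fix c :: "nat \<Rightarrow> complex" and i :: nat
    assume *: "\<forall>v\<in>carrier_vec d. \<forall>x\<in>lcosets H. (\<Sum>i<2. c i * \<Phi> i v x) = 0" and i: "i < 2"
    have "c 0 = 0 \<and> c 1 = 0"
      by (rule ind) (use * in \<open>simp add: s2 \<Phi>_def\<close>)
    then show "c i = 0" using i by (auto simp: less_2_cases_iff)
  qed
  ultimately have "enat 2 \<le> multiplicity_in_CM G T H d \<rho>"
    unfolding multiplicity_in_CM_def by (intro Sup_upper) blast
  then show ?thesis by (auto simp: zero_enat_def one_enat_def)
qed

text \<open>
  The place where multiplicity freeness enters: an irreducible \<open>W\<close> not contained in \<open>A\<close> is
  orthogonal to \<open>A\<close>. Otherwise the Peter-Weyl theorem, applied to the orthogonal complement of \<open>W\<close>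
  in \<open>A\<close>, yields a finite-dimensional invariant \<open>U\<close> in \<open>A\<close> that is not orthogonal to \<open>W\<close>. Then the
  inclusion of \<open>W\<close> and its orthogonal projection to \<open>U\<close> are two intertwiners. They are linearly
  independent, since a relation between them would put a nonzero vector into the intersection of
  \<open>W\<close> and \<open>A\<close>, which is trivial by irreducibility.
\<close>

lemma multiplicity_free_orth:
  assumes comm: "commutative_homogeneous_space G T H"
    and S: "S \<subseteq> mspace (CM_metric G T H)" and A: "inv_space (Lift S)" "uclosed (Lift S)"
    and W: "irr W" "basis W d e" "W \<subseteq> Lift (mspace (CM_metric G T H))" and nW: "\<not> W \<subseteq> Lift S"
    and f: "f \<in> Lift S" and w: "w \<in> W"
  shows "ip f w = 0"
proof (rule ccontr)
  assume ne: "ip f w \<noteq> 0"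
  have Wi: "inv_space W" and nz: "\<not> zero_space W" using W(1) by (simp_all add: irr_def)
  define P where "P = orth (Lift S) W"
  have P: "inv_space P" "uclosed P" unfolding P_def
    by (rule inv_space_orth[OF A(1) Wi], rule uclosed_orth[OF A inv_space_ap[OF Wi]])
  have "f \<notin> P" using ne w by (auto simp: P_def orth_def)
  then have PA: "P \<subseteq> Lift S" "P \<noteq> Lift S" using f by (auto simp: P_def orth_def)
  obtain U d' u where U: "irr U" "U \<subseteq> Lift S" "\<not> U \<subseteq> P" "basis U d' u"
    using Peter_Weyl[OF A P PA] by (elim exE conjE)
  have Ui: "inv_space U" using U(1) by (simp add: irr_def)
  obtain y where y: "y \<in> U" "y \<notin> P" using U(3) by blast
  obtain w1 where w1: "w1 \<in> W" "ip y w1 \<noteq> 0" using y U(2) by (auto simp: P_def orth_def)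
  define \<psi> where "\<psi> = proj d' u"
  have onu: "onf d' u" by (rule basis_onf[OF U(4)])
  have wap: "ap h" if "h \<in> W" for h by (rule inv_space_ap[OF Wi that])
  have \<psi>U: "\<psi> h \<in> U" for h unfolding \<psi>_def by (rule proj_in[OF Ui basis_mem[OF U(4)]])
  have "ip (\<psi> w1) y = ip w1 y" unfolding \<psi>_def by (rule ip_proj_eq[OF Ui U(4) wap[OF w1(1)] y(1)])
  also have "\<dots> = cnj (ip y w1)" by (rule ip_cnj[OF inv_space_ap[OF Ui y(1)] wap[OF w1(1)]])
  finally have "ip (\<psi> w1) y \<noteq> 0" using w1(2) by simp
  then obtain x1 where x1: "x1 \<in> carrier G" "\<psi> w1 x1 \<noteq> 0"
    using ip_cong[of "\<psi> w1" "\<lambda>_. 0" y y] by (auto simp: ip_def)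
  define \<Phi>0 where "\<Phi>0 v = desc (comb d e v)" for v
  define \<Phi>1 where "\<Phi>1 v = desc (\<psi> (comb d e v))" for v
  have mem: "comb d e v \<in> W" for v by (rule comb_in[OF Wi basis_mem[OF W(2)]])
  have I0: "\<Phi>0 \<in> intertwiners G T H d (coeff_rep d e)"
    unfolding \<Phi>0_def
    by (rule intertwiner_desc[OF Wi W(2) subset_refl, where \<psi> = "\<lambda>f. f"]) (use W(3) in auto)
  have I1: "\<Phi>1 \<in> intertwiners G T H d (coeff_rep d e)"
    unfolding \<Phi>1_def
  proof (rule intertwiner_desc[OF Wi W(2) S])
    show "\<psi> h \<in> Lift S" for h using \<psi>U U(2) by blast
    show "\<psi> (\<lambda>x. h x + h' x) x = \<psi> h x + \<psi> h' x" if "h \<in> W" "h' \<in> W" for h h' x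
      unfolding \<psi>_def proj_def using onf_ap[OF onu] wap that
      by (simp add: ip_add distrib_right sum.distrib)
    show "\<psi> (\<lambda>x. c * h x) x = c * \<psi> h x" if "h \<in> W" for h c x
      unfolding \<psi>_def proj_def using onf_ap[OF onu] wap that
      by (simp add: ip_cmult mult.assoc sum_distrib_left)
    show "\<psi> (L g h) x = L g (\<psi> h) x" if "h \<in> W" "g \<in> carrier G" "x \<in> carrier G" for h g x
      unfolding \<psi>_def by (rule proj_L[OF Ui U(4) wap[OF that(1)] that(2,3)])
    show "\<psi> h x = \<psi> h' x" if "\<And>x. x \<in> carrier G \<Longrightarrow> h x = h' x" for h h' x
      unfolding \<psi>_def proj_def using ip_cong[of h h'] that by simp
  qed
  have cont: "continuous_map T euclidean (e i)" if "i < d" for i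
    using W(3) basis_mem[OF W(2) that] by (intro Lift_continuous[OF subset_refl]) auto
  have "multiplicity_in_CM G T H d (coeff_rep d e) \<in> {0, 1}"
    using comm irreducible_coeff_rep[OF W(1,2) cont] unfolding commutative_homogeneous_space_def by blast
  moreover have "multiplicity_in_CM G T H d (coeff_rep d e) \<notin> {0, 1}"
  proof (rule multiplicity_ge_2[OF I0 I1])
    fix a b assume *: "\<And>v x. v \<in> carrier_vec d \<Longrightarrow> x \<in> lcosets H \<Longrightarrow> a * \<Phi>0 v x + b * \<Phi>1 v x = 0"
    have eq: "a * h x + b * \<psi> h x = 0" if h: "h \<in> W" and x: "x \<in> carrier G" for h x
    proof -
      define v where "v = vec d (\<lambda>i. ip h (e i))"
      have v: "v \<in> carrier_vec d" by (simp add: v_def)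
      have hv: "h z = comb d e v z" if "z \<in> carrier G" for z
        using basis_span[OF W(2) h that] by (simp add: comb_def v_def)
      have "\<Phi>0 v (x <# H) = comb d e v x" unfolding \<Phi>0_def
        using W(3) mem by (intro desc_Lift(2)[OF subset_refl _ x]) auto
      moreover have "\<Phi>1 v (x <# H) = \<psi> (comb d e v) x" unfolding \<Phi>1_def
        using \<psi>U U(2) by (intro desc_Lift(2)[OF S _ x]) auto
      moreover have "\<psi> (comb d e v) x = \<psi> h x"
        unfolding \<psi>_def proj_def using ip_cong[of "comb d e v" h] hv by simp
      ultimately show ?thesis using *[OF v coset_in[OF x]] hv[OF x] by simp
    qed
    have b0: "b = 0"
    proof (rule ccontr)
      assume b: "b \<noteq> 0"
      have "(\<lambda>x. (- a / b) * w1 x) \<in> W" by (rule inv_space_cmult[OF Wi w1(1)])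
      then have \<psi>W: "\<psi> w1 \<in> W"
      proof (rule inv_space_cong[OF Wi])
        fix x assume x: "x \<in> carrier G"
        have "b * \<psi> w1 x = - (a * w1 x)" using eq[OF w1(1) x] by (simp add: eq_neg_iff_add_eq_0 add.commute)
        also have "\<dots> = b * (- a / b * w1 x)" using b by simp
        finally show "\<psi> w1 x = - a / b * w1 x" unfolding mult_left_cancel[OF b] .
      qed
      define Z where "Z = W \<inter> Lift S"
      have Z: "inv_space Z" unfolding Z_def by (rule inv_space_Int[OF Wi A(1)])
      have "\<psi> w1 \<in> Z" using \<psi>W \<psi>U U(2) by (auto simp: Z_def)
      then have "\<not> zero_space Z" using x1 unfolding zero_space_def by blast
      moreover have "zero_space Z \<or> Z = W" using W(1) Z unfolding irr_def Z_def by blast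
      ultimately have "Z = W" by blast
      then show False using nW by (auto simp: Z_def)
    qed
    obtain h x where h: "h \<in> W" "x \<in> carrier G" "h x \<noteq> 0" using nz unfolding zero_space_def by blast
    have "a = 0" using eq[OF h(1,2)] b0 h(3) by simp
    then show "a = 0 \<and> b = 0" using b0 by simp
  qed
  ultimately show False by (rule notE[rotated])
qed

end

section \<open>Invariant ideals\<close>

context compact_homogeneous_space
begin

lemma function_algebraD:
  assumes "invariant_function_algebra G T H A"
  shows algebra_closed: "closedin (mtopology_of (CM_metric G T H)) A"
    and algebra_const: "(\<lambda>x\<in>lcosets H. c) \<in> A"
    and algebra_add: "f \<in> A \<Longrightarrow> h \<in> A \<Longrightarrow> (\<lambda>x\<in>lcosets H. f x + h x) \<in> A"
    and algebra_mult: "f \<in> A \<Longrightarrow> h \<in> A \<Longrightarrow> (\<lambda>x\<in>lcosets H. f x * h x) \<in> A"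
    and algebra_cmult: "f \<in> A \<Longrightarrow> (\<lambda>x\<in>lcosets H. c * f x) \<in> A"
    and algebra_translate: "g \<in> carrier G \<Longrightarrow> f \<in> A \<Longrightarrow> translate G H g f \<in> A"
  using assms unfolding invariant_function_algebra_def by blast+

lemma algebra_sub: assumes "invariant_function_algebra G T H A" shows "A \<subseteq> mspace (CM_metric G T H)"
  using closedin_subset[OF algebra_closed[OF assms]] by (simp only: topspace_mtopology_of)

lemma algebra_ext: assumes "invariant_function_algebra G T H A" "f \<in> A" shows "f \<in> extensional (lcosets H)"
  using subsetD[OF algebra_sub[OF assms(1)] assms(2)] unfolding CM_iff by (rule conjunct1)

lemma algebra_eqI:
  fixes f h :: "'g set \<Rightarrow> complex"
  assumes "f \<in> extensional (lcosets H)" "h \<in> extensional (lcosets H)" "\<And>g. g \<in> carrier G \<Longrightarrow> f (g <# H) = h (g <# H)"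
  shows "f = h"
proof -
  have "desc (\<lambda>g. h (g <# H)) = f" using assms(3)[symmetric] by (rule desc_eq[OF assms(1)])
  moreover have "desc (\<lambda>g. h (g <# H)) = h" by (rule desc_eq[OF assms(2)]) (rule refl)
  ultimately show ?thesis by (rule trans[OF sym])
qed

lemma inv_space_algebra: assumes A: "invariant_function_algebra G T H A" shows "inv_space (Lift A)"
  by (intro inv_space_Lift algebra_sub[OF A] algebra_const[OF A] algebra_add[OF A] algebra_cmult[OF A] algebra_translate[OF A])

lemma uclosed_algebra: assumes A: "invariant_function_algebra G T H A" shows "uclosed (Lift A)"
  by (rule uclosed_Lift[OF algebra_closed[OF A]])

lemma Lift_mem: "f \<in> A \<Longrightarrow> (\<lambda>g. f (g <# H)) \<in> Lift A"
  by (rule LiftI) auto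

lemma Lift_memD:
  assumes A: "invariant_function_algebra G T H A" and f: "f \<in> extensional (lcosets H)"
    and F: "F \<in> Lift A" "\<And>g. g \<in> carrier G \<Longrightarrow> f (g <# H) = F g"
  shows "f \<in> A"
proof -
  obtain k where k: "k \<in> A" "\<forall>g\<in>carrier G. F g = k (g <# H)" using LiftD[OF F(1)] by (elim bexE)
  have "f = k" by (rule algebra_eqI[OF f algebra_ext[OF A k(1)]]) (simp add: F(2) k(2))
  then show ?thesis using k(1) by simp
qed

lemma Lift_mult:
  assumes A: "invariant_function_algebra G T H A" and FK: "F \<in> Lift A" "K \<in> Lift A"
  shows "(\<lambda>x. F x * K x) \<in> Lift A"
proof -
  obtain f where f: "f \<in> A" "\<forall>g\<in>carrier G. F g = f (g <# H)" using LiftD[OF FK(1)] by (elim bexE)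
  obtain k where k: "k \<in> A" "\<forall>g\<in>carrier G. K g = k (g <# H)" using LiftD[OF FK(2)] by (elim bexE)
  show ?thesis by (rule LiftI[OF algebra_mult[OF A f(1) k(1)]]) (simp add: coset_in f(2) k(2))
qed

lemma ring_pointwise:
  assumes A: "invariant_function_algebra G T H A"
  shows "ring (pointwise_ring (lcosets H) A)"
proof (rule ringI)
  note ext = algebra_ext[OF A] and sc = pointwise_ring_def
  let ?R = "pointwise_ring (lcosets H) A"
  have car: "carrier ?R = A" by (simp add: sc)
  show "abelian_group ?R"
  proof (rule abelian_groupI)
    fix x assume x: "x \<in> carrier ?R"
    have "(\<lambda>y\<in>lcosets H. (-1) * x y) \<oplus>\<^bsub>?R\<^esub> x = \<zero>\<^bsub>?R\<^esub>" by (rule extensionalityI[where A = "lcosets H"]) (simp_all add: sc)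
    moreover have "(\<lambda>y\<in>lcosets H. (-1) * x y) \<in> carrier ?R" using algebra_cmult[OF A, of x "-1"] x unfolding car .
    ultimately show "\<exists>y\<in>carrier ?R. y \<oplus>\<^bsub>?R\<^esub> x = \<zero>\<^bsub>?R\<^esub>" by (intro bexI)
    show "\<zero>\<^bsub>?R\<^esub> \<oplus>\<^bsub>?R\<^esub> x = x" by (rule extensionalityI[where A = "lcosets H"]) (use x ext in \<open>simp_all add: sc\<close>)
    fix y assume y: "y \<in> carrier ?R"
    show "x \<oplus>\<^bsub>?R\<^esub> y \<in> carrier ?R" using algebra_add[OF A, of x y] x y by (simp add: sc)
    show "x \<oplus>\<^bsub>?R\<^esub> y = y \<oplus>\<^bsub>?R\<^esub> x" by (rule extensionalityI[where A = "lcosets H"]) (simp_all add: sc)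
    fix z assume "z \<in> carrier ?R"
    show "x \<oplus>\<^bsub>?R\<^esub> y \<oplus>\<^bsub>?R\<^esub> z = x \<oplus>\<^bsub>?R\<^esub> (y \<oplus>\<^bsub>?R\<^esub> z)" by (rule extensionalityI[where A = "lcosets H"]) (simp_all add: sc)
  next
    show "\<zero>\<^bsub>?R\<^esub> \<in> carrier ?R" using algebra_const[OF A, of 0] by (simp add: sc)
  qed
  show "monoid ?R"
  proof (rule monoidI)
    show "\<one>\<^bsub>?R\<^esub> \<in> carrier ?R" using algebra_const[OF A, of 1] by (simp add: sc)
    fix x assume x: "x \<in> carrier ?R"
    show "\<one>\<^bsub>?R\<^esub> \<otimes>\<^bsub>?R\<^esub> x = x" by (rule extensionalityI[where A = "lcosets H"]) (use x ext in \<open>simp_all add: sc\<close>)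
    show "x \<otimes>\<^bsub>?R\<^esub> \<one>\<^bsub>?R\<^esub> = x" by (rule extensionalityI[where A = "lcosets H"]) (use x ext in \<open>simp_all add: sc\<close>)
    fix y assume y: "y \<in> carrier ?R"
    show "x \<otimes>\<^bsub>?R\<^esub> y \<in> carrier ?R" using algebra_mult[OF A, of x y] x y by (simp add: sc)
    fix z assume "z \<in> carrier ?R"
    show "x \<otimes>\<^bsub>?R\<^esub> y \<otimes>\<^bsub>?R\<^esub> z = x \<otimes>\<^bsub>?R\<^esub> (y \<otimes>\<^bsub>?R\<^esub> z)" by (rule extensionalityI[where A = "lcosets H"]) (simp_all add: sc)
  qed
  fix x y z
  show "(x \<oplus>\<^bsub>?R\<^esub> y) \<otimes>\<^bsub>?R\<^esub> z = x \<otimes>\<^bsub>?R\<^esub> z \<oplus>\<^bsub>?R\<^esub> y \<otimes>\<^bsub>?R\<^esub> z"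
    by (rule extensionalityI[where A = "lcosets H"]) (simp_all add: sc distrib_right)
  show "z \<otimes>\<^bsub>?R\<^esub> (x \<oplus>\<^bsub>?R\<^esub> y) = z \<otimes>\<^bsub>?R\<^esub> x \<oplus>\<^bsub>?R\<^esub> z \<otimes>\<^bsub>?R\<^esub> y"
    by (rule extensionalityI[where A = "lcosets H"]) (simp_all add: sc distrib_left)
qed

text \<open>
  In a self-conjugate algebra an ideal contains \<open>|f|\<^sup>2\<close> with every \<open>f\<close>. By almost periodicity
  finitely many translates of \<open>|f|\<^sup>2\<close> have a sum \<open>p\<close> that is bounded below by a positive constant;
  \<open>p\<close> lies in the invariant ideal and is invertible in the algebra.
\<close>

lemma ideal_eq_algebra:
  assumes A: "invariant_function_algebra G T H A" and sc: "self_conjugate G H A"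
    and I: "invariant_ideal G H A I" and nz: "I \<noteq> {\<lambda>x\<in>lcosets H. 0}"
  shows "I = A"
proof -
  let ?R = "pointwise_ring (lcosets H) A"
  have id: "ideal I ?R" and tr: "\<And>g f. g \<in> carrier G \<Longrightarrow> f \<in> I \<Longrightarrow> translate G H g f \<in> I"
    using I unfolding invariant_ideal_def by blast+
  have as: "additive_subgroup I ?R" by (rule ideal.axioms(1)[OF id])
  have IA: "f \<in> A" if "f \<in> I" for f using ideal.Icarr[OF id that] by (simp add: pointwise_ring_def)
  have I0: "(\<lambda>x\<in>lcosets H. 0) \<in> I" using additive_subgroup.zero_closed[OF as] by (simp add: pointwise_ring_def)
  have Iadd: "(\<lambda>x\<in>lcosets H. f x + h x) \<in> I" if "f \<in> I" "h \<in> I" for f h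
    using additive_subgroup.a_closed[OF as that] by (simp add: pointwise_ring_def)
  have Imult: "(\<lambda>x\<in>lcosets H. f x * h x) \<in> I" if "f \<in> I" "h \<in> A" for f h
    using ideal.I_r_closed[OF id that(1), of h] that(2) by (simp add: pointwise_ring_def)
  obtain f where f: "f \<in> I" "f \<noteq> (\<lambda>x\<in>lcosets H. 0)" using nz I0 by blast
  obtain g0 where g0: "g0 \<in> carrier G" "f (g0 <# H) \<noteq> 0"
    using algebra_eqI[OF algebra_ext[OF A IA[OF f(1)]], of "\<lambda>x\<in>lcosets H. 0"] f(2) coset_in by auto
  define h where "h = (\<lambda>x\<in>lcosets H. f x * (\<lambda>x\<in>lcosets H. cnj (f x)) x)"
  have hI: "h \<in> I" unfolding h_def
    by (rule Imult[OF f(1) bspec[OF sc[unfolded self_conjugate_def] IA[OF f(1)]]])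
  define K where "K = (\<lambda>g. h (g <# H))"
  have K: "K g = complex_of_real ((cmod (f (g <# H)))\<^sup>2)" if "g \<in> carrier G" for g
    using that by (simp add: K_def h_def coset_in mult_cnj_cmod)
  have Kap: "ap K" unfolding K_def by (rule inv_space_ap[OF inv_space_algebra[OF A] Lift_mem[OF IA[OF hI]]])
  define \<delta> where "\<delta> = (cmod (f (g0 <# H)))\<^sup>2 / 2"
  have d: "\<delta> > 0" using g0(2) by (simp add: \<delta>_def)
  obtain N where N: "finite N" "N \<subseteq> carrier G" "\<forall>g\<in>carrier G. \<exists>n\<in>N. near K \<delta> g n"
    using Kap[unfolded ap_def, rule_format, OF d] by (elim exE conjE)
  define p where "p = (\<lambda>x\<in>lcosets H. \<Sum>n\<in>N. translate G H (inv n) h x)"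
  have pI: "p \<in> I" unfolding p_def using N(1,2)
  proof (induction N rule: finite_induct)
    case empty
    show ?case unfolding sum.empty by (rule I0)
  next
    case (insert n N)
    have "(\<lambda>x\<in>lcosets H. translate G H (inv n) h x + (\<lambda>x\<in>lcosets H. \<Sum>n\<in>N. translate G H (inv n) h x) x) \<in> I"
      using insert by (intro Iadd tr hI) auto
    moreover have "(\<lambda>x\<in>lcosets H. translate G H (inv n) h x + (\<lambda>x\<in>lcosets H. \<Sum>n\<in>N. translate G H (inv n) h x) x)
        = (\<lambda>x\<in>lcosets H. \<Sum>n\<in>insert n N. translate G H (inv n) h x)"
      using insert by (intro restrict_ext) simp
    ultimately show ?case by (rule subst[rotated, where P = "\<lambda>z. z \<in> I"])
  qed
  define P where "P = (\<lambda>g. p (g <# H))"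
  have Psum: "P g = complex_of_real (\<Sum>n\<in>N. (cmod (f ((n \<otimes> g) <# H)))\<^sup>2)" if g: "g \<in> carrier G" for g
  proof -
    have "P g = (\<Sum>n\<in>N. K (n \<otimes> g))"
      unfolding P_def p_def K_def using g N(2) by (simp add: coset_in translate_coset subset_iff)
    also have "\<dots> = (\<Sum>n\<in>N. complex_of_real ((cmod (f ((n \<otimes> g) <# H)))\<^sup>2))"
      using g N(2) by (intro sum.cong refl K) auto
    finally show ?thesis by simp
  qed
  have Plow: "\<delta> \<le> Re (P g)" if g: "g \<in> carrier G" for g
  proof -
    have "g0 \<otimes> inv g \<in> carrier G" using g g0(1) by simp
    from bspec[OF N(3) this] obtain n where n: "n \<in> N" "near K \<delta> (g0 \<otimes> inv g) n" by (elim bexE)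
    have nc: "n \<in> carrier G" using n(1) N(2) by blast
    have "cmod (K (\<one> \<otimes> (g0 \<otimes> inv g) \<otimes> g) - K (\<one> \<otimes> n \<otimes> g)) \<le> \<delta>" by (rule nearD[OF n(2) one_closed g])
    moreover have "\<one> \<otimes> (g0 \<otimes> inv g) \<otimes> g = g0" "\<one> \<otimes> n \<otimes> g = n \<otimes> g" using g g0(1) nc by (simp_all add: m_assoc)
    ultimately have "cmod (K g0 - K (n \<otimes> g)) \<le> \<delta>" by simp
    then have "Re (K g0) - Re (K (n \<otimes> g)) \<le> \<delta>" using complex_Re_le_cmod[of "K g0 - K (n \<otimes> g)"] by simp
    then have "\<delta> \<le> (cmod (f ((n \<otimes> g) <# H)))\<^sup>2" using K[OF g0(1)] K[of "n \<otimes> g"] g nc by (simp add: \<delta>_def)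
    also have "\<dots> \<le> (\<Sum>n\<in>N. (cmod (f ((n \<otimes> g) <# H)))\<^sup>2)" using n(1) N(1) by (intro member_le_sum) auto
    finally show ?thesis by (simp add: Psum[OF g])
  qed
  have PL: "P \<in> Lift A" unfolding P_def by (rule Lift_mem[OF IA[OF pI]])
  have oneL: "(\<lambda>_. 1) \<in> Lift A" by (rule LiftI[OF algebra_const[OF A, of 1]]) (simp add: coset_in)
  have "(\<lambda>x. 1 / P x) \<in> Lift A"
    by (rule inverse_in[OF inv_space_algebra[OF A] uclosed_algebra[OF A] Lift_mult[OF A] oneL PL d _ Plow])
      (simp_all add: Psum)
  from LiftD[OF this] obtain q where q: "q \<in> A" "\<forall>g\<in>carrier G. 1 / P g = q (g <# H)" by (elim bexE)
  have "a \<in> I" if a: "a \<in> A" for a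
  proof -
    have "(\<lambda>x\<in>lcosets H. p x * (\<lambda>x\<in>lcosets H. q x * a x) x) \<in> I" by (intro Imult pI algebra_mult[OF A] q(1) a)
    moreover have "(\<lambda>x\<in>lcosets H. p x * (\<lambda>x\<in>lcosets H. q x * a x) x) = a"
    proof (rule algebra_eqI[OF _ algebra_ext[OF A a]])
      fix g assume g: "g \<in> carrier G"
      have "P g \<noteq> 0" using Plow[OF g] d by auto
      moreover have "q (g <# H) = 1 / P g" using q(2) g by simp
      ultimately show "(\<lambda>x\<in>lcosets H. p x * (\<lambda>x\<in>lcosets H. q x * a x) x) (g <# H) = a (g <# H)"
        by (simp add: coset_in[OF g] P_def)
    qed simp
    ultimately show ?thesis by simp
  qed
  then show ?thesis using IA by blast
qed

text \<open>
  The elements of \<open>A\<close> whose complex conjugate is orthogonal to \<open>A\<close>. Unlike the ideal generated by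
  a subspace it is visibly an ideal, visibly invariant, and does not contain \<open>1\<close>.
\<close>

definition mean_ideal :: "('g set \<Rightarrow> complex) set \<Rightarrow> ('g set \<Rightarrow> complex) set" where
  "mean_ideal A = {f \<in> A. \<forall>a\<in>A. mean (\<lambda>g. f (g <# H) * a (g <# H)) = 0}"

lemma algebra_ap: assumes "invariant_function_algebra G T H A" "f \<in> A" shows "ap (\<lambda>g. f (g <# H))"
  by (rule inv_space_ap[OF inv_space_algebra[OF assms(1)] Lift_mem[OF assms(2)]])

lemma mean_ideal_invariant:
  assumes A: "invariant_function_algebra G T H A" shows "invariant_ideal G H A (mean_ideal A)"
  unfolding invariant_ideal_def
proof (intro conjI ballI)
  let ?R = "pointwise_ring (lcosets H) A" and ?J = "mean_ideal A"
  note apA = algebra_ap[OF A]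
  have JA: "f \<in> A" and Jm: "a \<in> A \<Longrightarrow> mean (\<lambda>g. f (g <# H) * a (g <# H)) = 0" if "f \<in> ?J" for f a
    using that by (auto simp: mean_ideal_def)
  have Jadd: "(\<lambda>x\<in>lcosets H. f x + h x) \<in> ?J" if fh: "f \<in> ?J" "h \<in> ?J" for f h
    unfolding mean_ideal_def mem_Collect_eq
  proof (intro conjI ballI)
    show "(\<lambda>x\<in>lcosets H. f x + h x) \<in> A" by (intro algebra_add[OF A] JA fh)
    fix a assume a: "a \<in> A"
    have "mean (\<lambda>g. (\<lambda>x\<in>lcosets H. f x + h x) (g <# H) * a (g <# H)) =
        mean (\<lambda>g. f (g <# H) * a (g <# H) + h (g <# H) * a (g <# H))"
      by (rule mean_cong) (simp add: coset_in distrib_right)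
    also have "\<dots> = mean (\<lambda>g. f (g <# H) * a (g <# H)) + mean (\<lambda>g. h (g <# H) * a (g <# H))"
      by (intro mean_add ap_mult apA JA fh a)
    also have "\<dots> = 0" using Jm[OF fh(1) a] Jm[OF fh(2) a] by simp
    finally show "mean (\<lambda>g. (\<lambda>x\<in>lcosets H. f x + h x) (g <# H) * a (g <# H)) = 0" .
  qed
  have Jmult: "(\<lambda>x\<in>lcosets H. f x * h x) \<in> ?J" if f: "f \<in> ?J" and h: "h \<in> A" for f h
    unfolding mean_ideal_def mem_Collect_eq
  proof (intro conjI ballI)
    show "(\<lambda>x\<in>lcosets H. f x * h x) \<in> A" by (intro algebra_mult[OF A] JA f h)
    fix a assume a: "a \<in> A"
    have "mean (\<lambda>g. (\<lambda>x\<in>lcosets H. f x * h x) (g <# H) * a (g <# H)) =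
        mean (\<lambda>g. f (g <# H) * (\<lambda>x\<in>lcosets H. h x * a x) (g <# H))"
      by (rule mean_cong) (simp add: coset_in mult.assoc)
    also have "\<dots> = 0" by (intro Jm f algebra_mult[OF A] h a)
    finally show "mean (\<lambda>g. (\<lambda>x\<in>lcosets H. f x * h x) (g <# H) * a (g <# H)) = 0" .
  qed
  have J0: "(\<lambda>x\<in>lcosets H. 0) \<in> ?J"
    unfolding mean_ideal_def mem_Collect_eq
  proof (intro conjI ballI)
    show "(\<lambda>x\<in>lcosets H. 0) \<in> A" by (rule algebra_const[OF A])
    fix a assume a: "a \<in> A"
    have "mean (\<lambda>g. (\<lambda>x\<in>lcosets H. 0) (g <# H) * a (g <# H)) = mean (\<lambda>g. 0)"
      by (rule mean_cong) (simp add: coset_in)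
    then show "mean (\<lambda>g. (\<lambda>x\<in>lcosets H. 0) (g <# H) * a (g <# H)) = 0" by simp
  qed
  show "ideal ?J ?R"
  proof (rule idealI[OF ring_pointwise[OF A]])
    interpret R: ring ?R by (rule ring_pointwise[OF A])
    show "subgroup ?J (add_monoid ?R)"
    proof (rule group.subgroupI[OF R.a_group])
      show "?J \<subseteq> carrier (add_monoid ?R)" using JA by (auto simp: pointwise_ring_def)
      show "?J \<noteq> {}" using J0 by blast
      show "f \<otimes>\<^bsub>add_monoid ?R\<^esub> h \<in> ?J" if "f \<in> ?J" "h \<in> ?J" for f h
        using Jadd[OF that] by (simp add: pointwise_ring_def)
      fix f assume f: "f \<in> ?J"
      have fR: "f \<in> carrier ?R" using JA[OF f] by (simp add: pointwise_ring_def)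
      have "\<ominus>\<^bsub>?R\<^esub> \<one>\<^bsub>?R\<^esub> \<in> A" using R.a_inv_closed[OF R.one_closed] by (simp add: pointwise_ring_def)
      then have "f \<otimes>\<^bsub>?R\<^esub> (\<ominus>\<^bsub>?R\<^esub> \<one>\<^bsub>?R\<^esub>) \<in> ?J" using Jmult[OF f] by (simp add: pointwise_ring_def)
      moreover have "f \<otimes>\<^bsub>?R\<^esub> (\<ominus>\<^bsub>?R\<^esub> \<one>\<^bsub>?R\<^esub>) = \<ominus>\<^bsub>?R\<^esub> f" using fR by (simp add: R.r_minus)
      ultimately show "inv\<^bsub>add_monoid ?R\<^esub> f \<in> ?J" by (simp add: a_inv_def)
    qed
    fix f h assume f: "f \<in> ?J" and h: "h \<in> carrier ?R"
    have hA: "h \<in> A" using h by (simp add: pointwise_ring_def)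
    show "f \<otimes>\<^bsub>?R\<^esub> h \<in> ?J" using Jmult[OF f hA] by (simp add: pointwise_ring_def)
    moreover have "h \<otimes>\<^bsub>?R\<^esub> f = f \<otimes>\<^bsub>?R\<^esub> h" by (simp add: pointwise_ring_def mult.commute)
    ultimately show "h \<otimes>\<^bsub>?R\<^esub> f \<in> ?J" by simp
  qed
  fix g f assume g: "g \<in> carrier G" and f: "f \<in> ?J"
  show "translate G H g f \<in> ?J"
    unfolding mean_ideal_def mem_Collect_eq
  proof (intro conjI ballI)
    show tA: "translate G H g f \<in> A" by (rule algebra_translate[OF A g JA[OF f]])
    fix a assume a: "a \<in> A"
    let ?b = "translate G H (inv g) a"
    have bA: "?b \<in> A" using g by (intro algebra_translate[OF A] a) simp
    have "mean (\<lambda>x. translate G H g f (x <# H) * a (x <# H)) =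
        mean (\<lambda>x. translate G H g f ((g \<otimes> x) <# H) * a ((g \<otimes> x) <# H))"
      using mean_ltrans[OF ap_mult[OF apA[OF tA] apA[OF a]] g] by simp
    also have "\<dots> = mean (\<lambda>x. f (x <# H) * ?b (x <# H))"
      using g by (intro mean_cong) (simp add: translate_coset inv_cancel)
    also have "\<dots> = 0" by (rule Jm[OF f bA])
    finally show "mean (\<lambda>x. translate G H g f (x <# H) * a (x <# H)) = 0" .
  qed
qed

lemma one_notin_mean_ideal: assumes A: "invariant_function_algebra G T H A" shows "mean_ideal A \<noteq> A"
proof
  assume eq: "mean_ideal A = A"
  let ?one = "\<lambda>x\<in>lcosets H. 1 :: complex"
  have "?one \<in> A" by (rule algebra_const[OF A])
  then have "mean (\<lambda>g. ?one (g <# H) * ?one (g <# H)) = 0" using eq unfolding mean_ideal_def by blast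
  moreover have "mean (\<lambda>g. ?one (g <# H) * ?one (g <# H)) = mean (\<lambda>g. 1)"
    by (rule mean_cong) (simp add: coset_in)
  ultimately show False by simp
qed

text \<open>
  If \<open>A\<close> is not self-conjugate, the functions in \<open>A\<close> with conjugate in \<open>A\<close> form a proper closed
  invariant subspace \<open>B\<close>, so some irreducible \<open>V\<close> in \<open>A\<close> is not contained in \<open>B\<close>. The conjugate of
  \<open>V\<close> is irreducible and not contained in \<open>A\<close>, hence orthogonal to \<open>A\<close>, which means that \<open>V\<close> is
  contained in the ideal.
\<close>

lemma self_conjugate_of_mean_ideal_zero:
  assumes comm: "commutative_homogeneous_space G T H" and A: "invariant_function_algebra G T H A"
    and z: "mean_ideal A = {\<lambda>x\<in>lcosets H. 0}"
  shows "self_conjugate G H A"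
proof -
  note Ai = inv_space_algebra[OF A] and Ac = uclosed_algebra[OF A]
  define B where "B = Lift A \<inter> cnj_space (Lift A)"
  have B: "inv_space B" "uclosed B" unfolding B_def
    by (intro inv_space_Int inv_space_cnj Ai, intro uclosed_Int uclosed_cnj Ac)
  have "B = Lift A"
  proof (rule ccontr)
    assume ne: "B \<noteq> Lift A"
    have BA: "B \<subseteq> Lift A" by (simp add: B_def)
    obtain V d e where V: "irr V" "V \<subseteq> Lift A" "\<not> V \<subseteq> B" "basis V d e"
      using Peter_Weyl[OF Ai Ac B BA ne] by (elim exE conjE)
    have Vi: "inv_space V" and Vnz: "\<not> zero_space V" using V(1) by (simp_all add: irr_def)
    let ?W = "cnj_space V"
    have WC: "?W \<subseteq> Lift (mspace (CM_metric G T H))"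
    proof
      fix F assume "F \<in> ?W"
      then have "(\<lambda>x. cnj (F x)) \<in> Lift A" using V(2) by (auto simp: cnj_space_def)
      from LiftD[OF this] obtain f where f: "f \<in> A" "\<forall>g\<in>carrier G. cnj (F g) = f (g <# H)" by (elim bexE)
      have Fc: "F g = cnj (f (g <# H))" if "g \<in> carrier G" for g using f(2) that by (metis complex_cnj_cnj)
      have "continuous_map T euclidean (\<lambda>g. f (g <# H))" using subsetD[OF algebra_sub[OF A] f(1)] unfolding CM_iff by (rule conjunct2)
      then have "continuous_map T euclidean (cnj \<circ> (\<lambda>g. f (g <# H)))"
        by (rule continuous_map_compose) (simp add: continuous_on_cnj)
      then have "continuous_map T euclidean (\<lambda>g. (\<lambda>x\<in>lcosets H. cnj (f x)) (g <# H))"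
        by (rule continuous_map_eq) (simp add: coset_in topspace_carrier)
      then have "(\<lambda>x\<in>lcosets H. cnj (f x)) \<in> mspace (CM_metric G T H)" unfolding CM_iff by simp
      then show "F \<in> Lift (mspace (CM_metric G T H))" by (rule LiftI) (simp add: coset_in Fc)
    qed
    have nW: "\<not> ?W \<subseteq> Lift A"
    proof
      assume W: "?W \<subseteq> Lift A"
      have "V \<subseteq> cnj_space (Lift A)" using cnj_space_mono[OF W] unfolding cnj_space_cnj .
      then show False using V(2,3) by (simp add: B_def)
    qed
    obtain F x where F: "F \<in> V" "x \<in> carrier G" "F x \<noteq> 0" using Vnz unfolding zero_space_def by blast
    have FA: "F \<in> Lift A" using F(1) V(2) by blast
    note df = desc_Lift[OF algebra_sub[OF A] FA]
    have "desc F \<in> mean_ideal A"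
      unfolding mean_ideal_def mem_Collect_eq
    proof (intro conjI ballI)
      show "desc F \<in> A" by (rule df(1))
      fix a assume a: "a \<in> A"
      have "ip (\<lambda>g. a (g <# H)) (\<lambda>x. cnj (F x)) = 0"
        by (rule multiplicity_free_orth[OF comm algebra_sub[OF A] Ai Ac irr_cnj[OF V(1)]
            basis_cnj[OF Vi V(4)] WC nW Lift_mem[OF a] cnj_in_cnj_space[OF F(1)]])
      moreover have "ip (\<lambda>g. a (g <# H)) (\<lambda>x. cnj (F x)) = mean (\<lambda>g. desc F (g <# H) * a (g <# H))"
        unfolding ip_def by (rule mean_cong) (simp add: df(2) mult.commute)
      ultimately show "mean (\<lambda>g. desc F (g <# H) * a (g <# H)) = 0" by simp
    qed
    then have "desc F (x <# H) = 0" unfolding z using coset_in[OF F(2)] by simp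
    then show False using df(2)[OF F(2)] F(3) by simp
  qed
  then have sub: "Lift A \<subseteq> cnj_space (Lift A)" by (auto simp: B_def)
  show ?thesis
    unfolding self_conjugate_def
  proof
    fix f assume f: "f \<in> A"
    have "(\<lambda>g. cnj (f (g <# H))) \<in> Lift A" using Lift_mem[OF f] sub by (auto simp: cnj_space_def)
    then show "(\<lambda>x\<in>lcosets H. cnj (f x)) \<in> A"
      by (rule Lift_memD[OF A, rotated]) (simp_all add: coset_in)
  qed
qed

end

theorem corollary4:
  fixes G :: "('g, 'm) monoid_scheme"
    and T :: "'g topology"
    and n :: nat
    and \<A> :: "'g chart set"
    and H :: "'g set"
    and A :: "('g set \<Rightarrow> complex) set"
  assumes "compact_lie_group G T n \<A>"
    and "subgroup H G"
    and "closedin T H"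
    and "commutative_homogeneous_space G T H"
    and "invariant_function_algebra G T H A"
  shows "self_conjugate G H A \<longleftrightarrow> \<not> (\<exists>I. proper_invariant_ideal G H A I)"
proof -
  have tg: "topological_group G T" "compact_space T"
    using assms(1) by (simp_all add: compact_lie_group_def lie_group_def)
  interpret Group.group G using tg(1) by (simp add: topological_group_def)
  interpret compact_homogeneous_space G T H
    by (intro compact_homogeneous_space.intro compact_group.intro compact_group_axioms.intro
        compact_homogeneous_space_axioms.intro)
      (use tg assms(2) in \<open>simp_all add: topological_group_def\<close>)
  show ?thesis
  proof
    assume "self_conjugate G H A"
    then show "\<not> (\<exists>I. proper_invariant_ideal G H A I)"
      using ideal_eq_algebra[OF assms(5)] unfolding proper_invariant_ideal_def by blast
  next
    assume "\<not> (\<exists>I. proper_invariant_ideal G H A I)"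
    then have "mean_ideal A = {\<lambda>x\<in>lcosets\<^bsub>G\<^esub> H. 0}"
      using mean_ideal_invariant[OF assms(5)] one_notin_mean_ideal[OF assms(5)]
      unfolding proper_invariant_ideal_def by blast
    then show "self_conjugate G H A" by (rule self_conjugate_of_mean_ideal_zero[OF assms(4,5)])
  qed
qed

end
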